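(* Let $p>2$ and $\nu>0$. Consider on $\mathbb{T}^2$ the advective $p$-Laplacian equation $$\partial_t\vartheta+v\cdot\nabla\vartheta-\nu\,\nabla\cdot\big(|\nabla\vartheta|^{p-2}\nabla\vartheta\big)=0,\qquad \vartheta(x,0)=\vartheta_0(x),$$ with $\vartheta_0\in L^2_0(\mathbb{T}^2)$ and $\|\vartheta_0\|_{L^2}=1$, and let $\vartheta$ be its (unique) weak solution. Then for any $\tau>0$ there exist a cell size $m$ and an amplitude $A$ (depending on $\tau$, $\|\vartheta_0\|_{L^2}$ and $\nu$) such that, with the cellular flow $v(x)=A\,u(mx)$, $u(x)=\nabla^{\perp}\big(\sin(2\pi x_1)\sin(2\pi x_2)\big)$, $$\|\vartheta(\cdot,\tau)\|_{L^2}\leq\tfrac12 .$$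
   Context: $\nabla^\perp=(-\partial_{x_2},\partial_{x_1})$; $\mathbb{T}^2=[0,1]^2$; $L^2_0(\mathbb{T}^2)$ is the space of mean-zero square-integrable functions. *)

theory Defs
  imports "HOL-Analysis.Analysis"
begin

(* The torus T^2 = [0,1]^2 is modelled by functions on R^2 (= real \<times> real)
   that are 1-periodic in both coordinates; integrals over T^2 are integrals
   over the fundamental cell [0,1]^2 w.r.t. Lebesgue measure. *)

definition cell :: "(real \<times> real) set" where
  "cell = {0..1} \<times> {0..1}"

definition periodic_x :: "(real \<times> real \<Rightarrow> 'a) \<Rightarrow> bool" where
  "periodic_x f \<longleftrightarrow>
     (\<forall>a b (k::int) (l::int). f (a + of_int k, b + of_int l) = f (a, b))"

definition L2norm_cell :: "(real \<times> real \<Rightarrow> real) \<Rightarrow> real" where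
  "L2norm_cell f = sqrt (LINT x:cell|lborel. (f x)^2)"

(* u(x) = \<nabla>^\<perp>(sin(2 pi x1) sin(2 pi x2)) with \<nabla>^\<perp> = (-d/dx2, d/dx1), written out *)
definition cell_flow :: "real \<times> real \<Rightarrow> real \<times> real" where
  "cell_flow x =
     (- (2*pi) * sin (2*pi * fst x) * cos (2*pi * snd x),
        (2*pi) * cos (2*pi * fst x) * sin (2*pi * snd x))"

definition test_function ::
  "(real \<times> real \<Rightarrow> real \<Rightarrow> real) \<Rightarrow> ((real \<times> real) \<times> real \<Rightarrow> (real \<times> real) \<times> real) \<Rightarrow> bool" where
  "test_function \<psi> D \<longleftrightarrow>
     (\<forall>z. ((\<lambda>w. \<psi> (fst w) (snd w)) has_derivative (\<lambda>h. inner (D z) h)) (at z)) \<and>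
     continuous_on UNIV D \<and>
     (\<forall>t. periodic_x (\<lambda>x. \<psi> x t))"

(* Weak solution on [0,\<infinity>) of
     d_t theta + v . grad theta - nu div(|grad theta|^(p-2) grad theta) = 0,  theta(.,0) = theta0
   in the class theta \<in> C([0,T];L^2(T^2)) \<inter> L^p(0,T;W^{1,p}(T^2)) for every T \<ge> 0.
   g is the weak spatial gradient of theta. *)
definition weak_solution ::
  "real \<Rightarrow> real \<Rightarrow> (real \<times> real \<Rightarrow> real \<times> real) \<Rightarrow> (real \<times> real \<Rightarrow> real)
     \<Rightarrow> (real \<times> real \<Rightarrow> real \<Rightarrow> real) \<Rightarrow> bool" where
  "weak_solution p \<nu> v \<theta>0 \<theta> \<longleftrightarrow>
     (\<forall>t. periodic_x (\<lambda>x. \<theta> x t)) \<and>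
     (\<lambda>z. \<theta> (fst z) (snd z)) \<in> borel_measurable lborel \<and>
     (\<forall>t\<ge>0. set_integrable lborel cell (\<lambda>x. (\<theta> x t)^2)) \<and>
     (\<forall>t\<ge>0. ((\<lambda>s. LINT x:cell|lborel. (\<theta> x s - \<theta> x t)^2) \<longlongrightarrow> 0) (at t within {0..})) \<and>
     (AE x in lborel. x \<in> cell \<longrightarrow> \<theta> x 0 = \<theta>0 x) \<and>
     (\<exists>g :: real \<times> real \<Rightarrow> real \<Rightarrow> real \<times> real.
        (\<lambda>z. g (fst z) (snd z)) \<in> borel_measurable lborel \<and>
        (\<forall>T\<ge>0. set_integrable lborel (cell \<times> {0..T}) (\<lambda>z. norm (g (fst z) (snd z)) powr p)) \<and>
        (\<forall>\<psi> D T. test_function \<psi> D \<and> T \<ge> 0 \<longrightarrow>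
            (LINT z:(cell \<times> {0..T})|lborel. \<theta> (fst z) (snd z) *\<^sub>R fst (D z))
            = - (LINT z:(cell \<times> {0..T})|lborel. \<psi> (fst z) (snd z) *\<^sub>R g (fst z) (snd z))) \<and>
        (\<forall>\<psi> D t. test_function \<psi> D \<and> t \<ge> 0 \<longrightarrow>
            (LINT x:cell|lborel. \<theta> x t * \<psi> x t) - (LINT x:cell|lborel. \<theta>0 x * \<psi> x 0)
            = (LINT z:(cell \<times> {0..t})|lborel.
                 \<theta> (fst z) (snd z) * snd (D z)
                 - inner (v (fst z)) (g (fst z) (snd z)) * \<psi> (fst z) (snd z)
                 - \<nu> * norm (g (fst z) (snd z)) powr (p - 2) * inner (g (fst z) (snd z)) (fst (D z)))))"

end

theory Submission
  imports Defs
begin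

text \<open>
  Suppose that the $L^2$ norm at time $\tau$ exceeds $1/2$. By the energy identity the gradient is then
  bounded in $L^p$ of space-time, uniformly in $m$, $A$ and the initial datum. The flow vanishes at the corners
  of the grid of mesh $h = 1/(2m)$ and is parallel to its edges (the separatrices). Mollify the
  solution at scale $\rho$. Comparing a point of an edge with the corner, the squared difference, integrated
  in time, has a derivative along the edge that is $O(\rho^{1-2/p}) + O_\rho(1/A)$ up to the factor
  $1/\sin(2\pi m z)$, whose integral is only logarithmic in $\rho$: no mixing inside the cells is needed.
  Hence, on the whole grid, the solution is nearly equal to a function of time alone, and a one-dimensional
  Poincare inequality in the rows of the grid gives a time average of the squared $L^2$ norm of order $h$.
  Choosing $m$, then $\rho$, then $A$ contradicts the monotonicity of the energy.
\<close>

section \<open>A periodic mollifier\<close>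

text \<open>The obstacle is the commutator of mollification and transport. It is multiplied by A, so
  dividing the equation by A does not shrink it; it must be small uniformly in A. The kernel
  supplies a factor \<rho>, while averaging at scale \<rho> a gradient known only in L^p of the
  two-dimensional torus costs \<rho>^(-2/p), and the product \<rho>^(1-2/p) vanishes with \<rho>
  because p > 2. All terms without the factor A (end values in time, diffusive flux against the
  kernel gradient) blow up as \<rho> tends to 0 but are beaten by A. Going from one edge to the
  whole grid multiplies the error by 4 per edge, which is affordable since m is fixed before \<rho>.
  Integrating squared differences over time replaces the time derivative by bounded end values. That
  the nearly constant value is an unknown function of time is harmless: the mean is zero, and the
  mean is the constant closest in L^2. The energy identity also goes through the mollified equation,
  since the solution is not itself a test function; there A and m stay fixed while the kernel
  shrinks, so that the commutator disappears.\<close>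

definition bump :: "nat \<Rightarrow> real \<Rightarrow> real" where
  "bump n z = 1 - (real n + 1)\<^sup>2 * (sin (pi * z))\<^sup>2"

definition bump' :: "nat \<Rightarrow> real \<Rightarrow> real" where
  "bump' n z = - (real n + 1)\<^sup>2 * (2 * pi * sin (pi * z) * cos (pi * z))"

definition ker_mass :: "nat \<Rightarrow> real" where
  "ker_mass n = integral {0..1} (\<lambda>z. max 0 (bump n z) ^ 3)"

text \<open>A function of $\sin^2(\pi z)$ only, so that periodicity needs no summation over the lattice.\<close>

definition ker :: "nat \<Rightarrow> real \<Rightarrow> real" where
  "ker n z = max 0 (bump n z) ^ 3 / ker_mass n"

definition ker' :: "nat \<Rightarrow> real \<Rightarrow> real" where
  "ker' n z = 3 * max 0 (bump n z) ^ 2 * bump' n z / ker_mass n"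

text \<open>At the kink the difference quotient is bounded by |h|^k, which tends to 0 as soon as the
  exponent is at least 2. It makes the cubed cut-off of \<open>bump\<close> continuously
  differentiable.\<close>

lemma DERIV_max_power:
  fixes x :: real
  assumes "k \<ge> 1"
  shows "((\<lambda>x. max 0 x ^ Suc k) has_field_derivative (real (Suc k) * max 0 x ^ k)) (at x)"
proof -
  consider "x > 0" | "x < 0" | "x = 0" by linarith
  then show ?thesis
  proof cases
    case 1
    have "((\<lambda>x. x ^ Suc k) has_field_derivative (real (Suc k) * x ^ k)) (at x)"
      by (rule DERIV_cong[OF DERIV_power[OF DERIV_ident]]) simp
    moreover have "\<forall>\<^sub>F y in nhds x. max 0 y ^ Suc k = y ^ Suc k"
      using eventually_nhds_in_open[of "{0<..}" x] 1 by (auto elim!: eventually_mono)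
    ultimately show ?thesis
      using 1 DERIV_cong_ev by (simp add: DERIV_cong_ev)
  next
    case 2
    have ev: "\<forall>\<^sub>F y in nhds x. max 0 y ^ Suc k = 0"
      using eventually_nhds_in_open[of "{..<0}" x] 2 by (auto elim!: eventually_mono)
    show ?thesis
      by (rule DERIV_cong_ev[THEN iffD2, OF refl ev refl]) (use 2 assms in \<open>auto simp: power_0_left\<close>)
  next
    case 3
    have "(\<lambda>h. max 0 h ^ Suc k / h) \<midarrow>0\<rightarrow> (0::real)"
    proof (rule Lim_null_comparison[where g="\<lambda>h. \<bar>h\<bar> ^ k"])
      show "\<forall>\<^sub>F h in at 0. norm (max 0 h ^ Suc k / h) \<le> \<bar>h\<bar> ^ k"
        by (auto simp: eventually_at_filter max_def abs_if)
      have "((\<lambda>h::real. \<bar>h\<bar> ^ k) \<longlongrightarrow> \<bar>0\<bar> ^ k) (at 0)"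
        by (intro tendsto_intros)
      moreover have "\<bar>0::real\<bar> ^ k = 0" using assms by (auto simp: power_0_left)
      ultimately show "((\<lambda>h::real. \<bar>h\<bar> ^ k) \<longlongrightarrow> 0) (at 0)" by metis
    qed
    then show ?thesis
      using 3 assms by (simp add: DERIV_def power_0_left)
  qed
qed

lemma DERIV_bump: "(bump n has_field_derivative bump' n z) (at z)"
  unfolding bump_def[abs_def] bump'_def by (auto intro!: derivative_eq_intros simp: algebra_simps)

lemma continuous_bump [continuous_intros]:
  fixes f :: "'a::t2_space \<Rightarrow> real"
  assumes "continuous_on A f"
  shows "continuous_on A (\<lambda>x. bump n (f x))" "continuous_on A (\<lambda>x. bump' n (f x))"
  unfolding bump_def bump'_def by (intro continuous_intros assms)+

lemma bump_le_1: "bump n z \<le> 1"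
  unfolding bump_def by simp

lemma ker_mass_ge: "ker_mass n \<ge> 1 / (64 * (real n + 1))"
proof -
  \<comment> \<open>On [0, d] the sine is at most 4 d, and (n + 1) * 4 d = 1/2 keeps
    \<open>bump\<close> above 3/4. The interval has length of order 1/(n + 1), which is also the
    width of the kernel, so the lower bound has the right order.\<close>
  define d where "d = 1 / (8 * (real n + 1))"
  have d: "0 < d" "d \<le> 1/8" unfolding d_def by (auto simp: field_simps)
  have "bump n z \<ge> 1/2" if "z \<in> {0..d}" for z
  proof -
    have "\<bar>sin (pi*z)\<bar> \<le> pi * z" using abs_sin_x_le_abs_x[of "pi*z"] that by simp
    also have "\<dots> \<le> 4 * d" using that pi_less_4 by (intro mult_mono) auto
    finally have "(sin (pi*z))\<^sup>2 \<le> (4 * d)\<^sup>2"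
      using abs_le_square_iff[of "sin (pi*z)" "4*d"] d by simp
    then have "(real n + 1)\<^sup>2 * (sin (pi * z))\<^sup>2 \<le> (real n + 1)\<^sup>2 * (4*d)\<^sup>2"
      by (intro mult_left_mono) auto
    also have "\<dots> = ((real n + 1) * (4 * d))\<^sup>2" by (simp only: power_mult_distrib)
    also have "(real n + 1) * (4 * d) = 1/2" unfolding d_def by (simp add: field_simps)
    also have "(1/2::real)\<^sup>2 = 1/4" by (simp add: power2_eq_square)
    finally show ?thesis unfolding bump_def by simp
  qed
  then have *: "max 0 (bump n z) ^ 3 \<ge> 1/8" if "z \<in> {0..d}" for z
    using power_mono[of "1/2" "max 0 (bump n z)" 3] that by (fastforce simp: power3_eq_cube)
  have int: "(\<lambda>z. max 0 (bump n z) ^ 3) integrable_on {a..b}" for a b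
    by (intro integrable_continuous_interval continuous_intros)
  have "d * (1/8) = integral {0..d} (\<lambda>z. 1/8)" using d by simp
  also have "\<dots> \<le> integral {0..d} (\<lambda>z. max 0 (bump n z) ^ 3)"
    by (rule integral_le[OF _ int *]) auto
  also have "\<dots> \<le> integral {0..1} (\<lambda>z. max 0 (bump n z) ^ 3)"
    using d by (intro integral_subset_le int) auto
  finally show ?thesis unfolding d_def ker_mass_def by (simp add: field_simps)
qed

lemma ker_mass_pos: "ker_mass n > 0"
  using ker_mass_ge[of n] by (smt (verit) divide_pos_pos of_nat_0_le_iff)

lemma ker_nonneg: "0 \<le> ker n z"
  unfolding ker_def using ker_mass_pos[of n] by simp

lemma ker_le: "ker n z \<le> 64 * (real n + 1)"
proof -
  have "max 0 (bump n z) ^ 3 \<le> 1"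
    using bump_le_1[of n z] by (intro power_le_one) auto
  then have "ker n z \<le> 1 / ker_mass n"
    unfolding ker_def using ker_mass_pos[of n] by (intro divide_right_mono) auto
  also have "\<dots> \<le> 64 * (real n + 1)"
    using ker_mass_ge[of n] ker_mass_pos[of n] by (simp add: field_simps)
  finally show ?thesis .
qed

lemma ker_supp: "ker n z \<noteq> 0 \<Longrightarrow> \<bar>sin (pi * z)\<bar> \<le> 1 / (real n + 1)"
proof -
  assume "ker n z \<noteq> 0"
  then have "bump n z > 0" unfolding ker_def by (auto simp: max_def split: if_splits)
  then have "((real n + 1) * \<bar>sin (pi * z)\<bar>)\<^sup>2 \<le> 1\<^sup>2"
    unfolding bump_def by (simp add: power_mult_distrib)
  then have "(real n + 1) * \<bar>sin (pi * z)\<bar> \<le> 1"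
    by (rule power2_le_imp_le) simp
  then show ?thesis by (simp add: field_simps)
qed

lemma DERIV_ker: "(ker n has_field_derivative ker' n z) (at z)"
proof -
  have "((\<lambda>z. max 0 (bump n z) ^ Suc 2 / ker_mass n) has_field_derivative
    (real (Suc 2) * max 0 (bump n z) ^ 2 * bump' n z) / ker_mass n) (at z)"
    by (intro DERIV_cdivide DERIV_chain2[OF DERIV_max_power DERIV_bump]) auto
  then show ?thesis unfolding ker_def[abs_def] ker'_def by (simp add: numeral_3_eq_3)
qed

lemma continuous_ker [continuous_intros]:
  fixes f :: "'a::t2_space \<Rightarrow> real"
  assumes "continuous_on A f"
  shows "continuous_on A (\<lambda>x. ker n (f x))" "continuous_on A (\<lambda>x. ker' n (f x))"
  unfolding ker_def ker'_def using ker_mass_pos[of n]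
  by (intro continuous_intros assms; simp)+

lemma sin_shift: "\<bar>sin (pi * (z + of_int k))\<bar> = \<bar>sin (pi * z)\<bar>"
  and sincos_shift: "sin (pi * (z + of_int k)) * cos (pi * (z + of_int k)) = sin (pi * z) * cos (pi * z)"
proof -
  have s: "sin (pi * of_int k) = 0" using sin_int_times_real[of k] sin_npi_int[of k] by simp
  have c: "(cos (pi * of_int k))\<^sup>2 = 1" using sin_cos_squared_add[of "pi * of_int k"] s by simp
  then have c': "cos (pi * of_int k) = 1 \<or> cos (pi * of_int k) = -1"
    by (simp add: power2_eq_1_iff)
  show "\<bar>sin (pi * (z + of_int k))\<bar> = \<bar>sin (pi * z)\<bar>"
    using c' by (auto simp: distrib_left sin_add s)
  show "sin (pi * (z + of_int k)) * cos (pi * (z + of_int k)) = sin (pi * z) * cos (pi * z)"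
    using c' by (auto simp: distrib_left sin_add cos_add s)
qed

lemma ker_periodic: "ker n (z + of_int k) = ker n z" "ker' n (z + of_int k) = ker' n z"
proof -
  have b: "bump n (z + of_int k) = bump n z"
    unfolding bump_def using sin_shift[of z k] by (metis power2_abs)
  have "bump' n (z + of_int k) = bump' n z"
    unfolding bump'_def using sincos_shift[of z k] by (metis mult.assoc)
  with b show "ker n (z + of_int k) = ker n z" "ker' n (z + of_int k) = ker' n z"
    unfolding ker_def ker'_def by auto
qed

lemma ker_minus: "ker n (- z) = ker n z" "ker' n (- z) = - ker' n z"
  unfolding ker_def ker'_def bump_def bump'_def by auto

lemma ker_commute: "ker n (x - y) = ker n (y - x)" "ker' n (x - y) = - ker' n (y - x)"
  using ker_minus[of n "y - x"] by auto

lemma abs_bump'_le: "\<bar>bump' n z\<bar> \<le> 8 * (real n + 1)\<^sup>2"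
proof -
  have "\<bar>sin (pi*z) * cos (pi*z)\<bar> \<le> 1 * 1"
    unfolding abs_mult by (intro mult_mono) auto
  then have "2 * pi * \<bar>sin (pi*z) * cos (pi*z)\<bar> \<le> 8 * 1"
    using pi_less_4 by (intro mult_mono) auto
  then have "(real n+1)\<^sup>2 * (2 * pi * \<bar>sin (pi*z) * cos (pi*z)\<bar>) \<le> (real n+1)\<^sup>2 * 8"
    by (intro mult_left_mono) auto
  then show ?thesis unfolding bump'_def by (simp add: abs_mult algebra_simps)
qed

lemma abs_ker'_le: "\<bar>ker' n z\<bar> \<le> 24 * (real n + 1)\<^sup>2 / ker_mass n"
proof -
  have "max 0 (bump n z) ^ 2 \<le> 1"
    using bump_le_1[of n z] by (intro power_le_one) auto
  then have "max 0 (bump n z) ^ 2 * \<bar>bump' n z\<bar> \<le> 1 * (8 * (real n + 1)\<^sup>2)"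
    by (intro mult_mono abs_bump'_le) auto
  then have "3 * max 0 (bump n z) ^ 2 * \<bar>bump' n z\<bar> / ker_mass n \<le> 24 * (real n + 1)\<^sup>2 / ker_mass n"
    using ker_mass_pos[of n] by (intro divide_right_mono) (auto simp: mult_ac)
  then show ?thesis unfolding ker'_def using ker_mass_pos[of n] by (simp add: abs_mult)
qed

text \<open>With P a primitive of the kernel, P(w) - P(w - 1) has derivative
  \<open>ker n w - ker n (w - 1)\<close>, which is zero by periodicity. The integral over a period
  is therefore independent of the shift, and its value is read off at w = 1, where evenness and the
  normalisation by \<open>ker_mass\<close> apply.\<close>

lemma ker_integral_shift: "integral {0..1} (\<lambda>y. ker n (x - y)) = 1"
proof -
  \<comment> \<open>P is differentiable only inside (a, b); the margin of 3 keeps every argument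
    that occurs, down to w - 1 with w near -|x| - 1, in that open interval.\<close>
  define a where "a = - (\<bar>x\<bar> + 3)"
  define b where "b = \<bar>x\<bar> + 3"
  define P where "P u = integral {a..u} (ker n)" for u
  have P: "(P has_vector_derivative ker n u) (at u)" if "a < u" "u < b" for u
  proof -
    have "(P has_vector_derivative ker n u) (at u within {a..b})"
      unfolding P_def using that by (intro integral_has_vector_derivative continuous_intros) auto
    then show ?thesis using that at_within_interior[of u "{a..b}"] by simp
  qed
  then have PD: "(P has_field_derivative ker n u) (at u)" if "a < u" "u < b" for u
    using that by (simp add: has_real_derivative_iff_has_vector_derivative)
  have 1: "((\<lambda>y. ker n (w - y)) has_integral (P w - P (w - 1))) {0..1}" if "\<bar>w\<bar> \<le> \<bar>x\<bar> + 1" for w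
  proof -
    have "((\<lambda>y. ker n (w - y)) has_integral ((\<lambda>y. - P (w - y)) 1 - (\<lambda>y. - P (w - y)) 0)) {0..1}"
    proof (rule fundamental_theorem_of_calculus)
      fix y :: real assume y: "y \<in> {0..1}"
      have "((\<lambda>y. - P (w - y)) has_field_derivative - (ker n (w - y) * (0 - 1))) (at y)"
        using that y by (intro DERIV_minus DERIV_chain2[OF PD] derivative_intros) (auto simp: a_def b_def)
      then show "((\<lambda>y. - P (w - y)) has_vector_derivative ker n (w - y)) (at y within {0..1})"
        by (simp add: has_real_derivative_iff_has_vector_derivative has_vector_derivative_at_within)
    qed simp
    then show ?thesis by simp
  qed
  have "(\<lambda>w. P w - P (w - 1)) constant_on {-\<bar>x\<bar>-1<..<\<bar>x\<bar>+1 + 1/2}"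
  proof (rule has_field_derivative_0_imp_constant_on)
    fix w :: real assume w: "w \<in> {-\<bar>x\<bar>-1<..<\<bar>x\<bar>+1+1/2}"
    have "((\<lambda>w. P w - P (w - 1)) has_field_derivative ker n w - ker n (w - 1) * (1 - 0)) (at w)"
      using w by (intro DERIV_diff PD DERIV_chain2[OF PD] derivative_intros) (auto simp: a_def b_def)
    moreover have "ker n (w - 1) = ker n w" using ker_periodic(1)[of n w "-1"] by simp
    ultimately show "((\<lambda>w. P w - P (w - 1)) has_field_derivative 0) (at w)" by simp
  qed auto
  then obtain c where c: "P w - P (w - 1) = c" if "w \<in> {-\<bar>x\<bar>-1<..<\<bar>x\<bar>+1 + 1/2}" for w
    unfolding constant_on_def by auto
  have "x \<in> {-\<bar>x\<bar>-1<..<\<bar>x\<bar>+1 + 1/2}" "1 \<in> {-\<bar>x\<bar>-1<..<\<bar>x\<bar>+1 + 1/2}" by auto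
  then have "P x - P (x - 1) = P 1 - P (1 - 1)" using c by metis
  moreover have "P 1 - P (1-1) = 1"
  proof -
    have "P 1 - P (1 - 1) = integral {0..1} (\<lambda>y. ker n (1 - y))"
      using integral_unique[OF 1[of 1]] by simp
    also have "(\<lambda>y. ker n (1 - y)) = ker n"
    proof
      fix y
      show "ker n (1 - y) = ker n y"
        using ker_periodic(1)[of n "-y" 1] ker_minus(1)[of n y] by simp
    qed
    also have "integral {0..1} (ker n) = 1"
      unfolding ker_def[abs_def] using ker_mass_pos[of n] by (simp add: ker_mass_def)
    finally show ?thesis .
  qed
  ultimately show ?thesis using integral_unique[OF 1[of x]] by simp
qed

text \<open>Points in the support of the kernel are close only modulo 1, which is expressed through
  |sin (pi (x - y))|. The flow has phase 2 pi m x; passing to the m-fold angle costs at most a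
  factor m.\<close>

lemma abs_sin_nat_mult_le: "\<bar>sin (real m * x)\<bar> \<le> real m * \<bar>sin x\<bar>"
proof (induction m)
  case (Suc m)
  have "\<bar>sin (real (Suc m) * x)\<bar> = \<bar>sin (real m * x) * cos x + cos (real m * x) * sin x\<bar>"
    by (simp add: distrib_right sin_add add.commute[of x])
  also have "\<dots> \<le> \<bar>sin (real m * x)\<bar> * \<bar>cos x\<bar> + \<bar>cos (real m * x)\<bar> * \<bar>sin x\<bar>"
    by (metis abs_mult abs_triangle_ineq)
  also have "\<dots> \<le> \<bar>sin (real m * x)\<bar> * 1 + 1 * \<bar>sin x\<bar>"
    by (intro add_mono mult_mono) auto
  finally show ?case using Suc by (simp add: algebra_simps)
qed simp

section \<open>Mollification on the torus\<close>

text \<open>A density on the whole line rather than a restricted space: the measurable functions are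
  then simply the Borel functions, and a negative T gives the zero measure.\<close>

definition ivl :: "real \<Rightarrow> real measure" where
  "ivl T = density lborel (\<lambda>x. ennreal (indicator {0..T} x))"

definition Mx :: "(real \<times> real) measure" where
  "Mx = ivl 1 \<Otimes>\<^sub>M ivl 1"

lemma sets_ivl [simp, measurable_cong]: "sets (ivl T) = sets borel"
  and space_ivl [simp]: "space (ivl T) = UNIV"
  unfolding ivl_def by simp_all

lemma sets_Mx [simp, measurable_cong]: "sets Mx = sets borel"
  and space_Mx [simp]: "space Mx = UNIV"
proof -
  have "sets Mx = sets (borel \<Otimes>\<^sub>M borel)"
    unfolding Mx_def by (intro sets_pair_measure_cong) auto
  then show "sets Mx = sets borel" by (simp only: borel_prod)
  show "space Mx = UNIV" unfolding Mx_def by (simp add: space_pair_measure)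
qed

lemma emeasure_ivl_UNIV: "emeasure (ivl T) UNIV = ennreal (max 0 T)"
proof -
  have "emeasure (ivl T) UNIV = (\<integral>\<^sup>+x. indicator {0..T} x \<partial>lborel)"
    unfolding ivl_def by (subst emeasure_density) (auto simp: ennreal_indicator)
  also have "\<dots> = ennreal (max 0 T)"
    by (cases "T \<ge> 0") (auto simp: max_def)
  finally show ?thesis .
qed

lemma measure_ivl_UNIV: "T \<ge> 0 \<Longrightarrow> measure (ivl T) UNIV = T"
  unfolding measure_def emeasure_ivl_UNIV by simp

interpretation ivl: finite_measure "ivl T" for T
  by standard (simp add: emeasure_ivl_UNIV)

interpretation ivlp: pair_sigma_finite "ivl T1" "ivl T2" for T1 T2 ..

lemma finite_measure_Mx: "emeasure Mx UNIV = 1"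
proof -
  have "emeasure Mx (UNIV \<times> UNIV) = emeasure (ivl 1) UNIV * emeasure (ivl 1) UNIV"
    unfolding Mx_def by (rule ivl.emeasure_pair_measure_Times) auto
  then show ?thesis by (simp add: emeasure_ivl_UNIV)
qed

interpretation Mx: finite_measure Mx
  by standard (simp add: finite_measure_Mx)

lemma measure_Mx_UNIV [simp]: "measure Mx UNIV = 1"
  unfolding measure_def finite_measure_Mx by simp

interpretation MxMx: pair_sigma_finite Mx Mx ..

interpretation Mt: pair_sigma_finite Mx "ivl T" for T ..

lemma cell_borel [measurable]: "cell \<in> sets borel"
  unfolding cell_def by (intro borel_Times) auto

text \<open>Bridge between Fubini in the two coordinates, for which \<open>Mx\<close> is built as a
  product, and the set integrals over \<open>cell\<close> in the weak formulation.\<close>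

lemma Mx_eq: "Mx = density lborel (\<lambda>x. ennreal (indicator cell x))"
proof -
  have "Mx = density (lborel \<Otimes>\<^sub>M lborel) (\<lambda>(x,y). ennreal (indicator {0..1} x) * ennreal (indicator {0..1} y))"
    unfolding Mx_def ivl_def
    by (rule pair_measure_density) (auto simp flip: ivl_def intro: ivl.sigma_finite_measure_axioms sigma_finite_lborel)
  also have "\<dots> = density (lborel \<Otimes>\<^sub>M lborel) (\<lambda>x. ennreal (indicator cell x))"
    by (rule density_cong) (measurable, auto simp: cell_def lborel_prod borel_prod indicator_def)
  also have "\<dots> = density lborel (\<lambda>x. ennreal (indicator cell x))" by (simp only: lborel_prod)
  finally show ?thesis .
qed

lemma Mt_eq: "Mx \<Otimes>\<^sub>M ivl T = density lborel (\<lambda>x. ennreal (indicator (cell \<times> {0..T}) x))"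
proof -
  have "Mx \<Otimes>\<^sub>M ivl T = density (lborel \<Otimes>\<^sub>M lborel) (\<lambda>(x,y). ennreal (indicator cell x) * ennreal (indicator {0..T} y))"
    unfolding Mx_eq ivl_def
    by (rule pair_measure_density) (auto simp flip: ivl_def Mx_eq intro: Mx.sigma_finite_measure_axioms ivl.sigma_finite_measure_axioms sigma_finite_lborel)
  also have "\<dots> = density (lborel \<Otimes>\<^sub>M lborel) (\<lambda>x. ennreal (indicator (cell \<times> {0..T}) x))"
    by (rule density_cong) (measurable, auto simp: indicator_def)
  also have "\<dots> = density lborel (\<lambda>x. ennreal (indicator (cell \<times> {0..T}) x))" by (simp only: lborel_prod)
  finally show ?thesis .
qed

lemma density_indicator_integral:
  fixes f :: "'a::euclidean_space \<Rightarrow> 'b::{banach, second_countable_topology}"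
  assumes "f \<in> borel_measurable borel" "A \<in> sets borel"
  shows "(LINT x|density lborel (\<lambda>x. ennreal (indicator A x)). f x) = (LINT x:A|lborel. f x)"
    and "integrable (density lborel (\<lambda>x. ennreal (indicator A x))) f \<longleftrightarrow> set_integrable lborel A f"
  using assms unfolding set_lebesgue_integral_def set_integrable_def
  by (auto simp: integral_density integrable_density)

lemma Mx_integral:
  fixes f :: "real \<times> real \<Rightarrow> 'b::{banach, second_countable_topology}"
  assumes "f \<in> borel_measurable borel"
  shows "(LINT x:cell|lborel. f x) = (LINT x|Mx. f x)"
    and "set_integrable lborel cell f \<longleftrightarrow> integrable Mx f"
  unfolding Mx_eq using density_indicator_integral[OF assms, of cell] by auto

lemma Mt_integral:
  fixes f :: "(real \<times> real) \<times> real \<Rightarrow> 'b::{banach, second_countable_topology}"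
  assumes "f \<in> borel_measurable borel"
  shows "(LINT x:(cell \<times> {0..T})|lborel. f x) = (LINT x|(Mx \<Otimes>\<^sub>M ivl T). f x)"
    and "set_integrable lborel (cell \<times> {0..T}) f \<longleftrightarrow> integrable (Mx \<Otimes>\<^sub>M ivl T) f"
proof -
  have "cell \<times> {0..T} \<in> sets borel" by (intro borel_Times cell_borel) auto
  from density_indicator_integral[OF assms this]
  show "(LINT x:(cell \<times> {0..T})|lborel. f x) = (LINT x|(Mx \<Otimes>\<^sub>M ivl T). f x)"
    "set_integrable lborel (cell \<times> {0..T}) f \<longleftrightarrow> integrable (Mx \<Otimes>\<^sub>M ivl T) f"
    unfolding Mt_eq by auto
qed

lemma sets_Mt [simp, measurable_cong]: "sets (Mx \<Otimes>\<^sub>M ivl T) = sets borel"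
  unfolding Mt_eq by simp

lemma ivl_continuous:
  fixes f :: "real \<Rightarrow> real"
  assumes "f \<in> borel_measurable borel" "continuous_on {0..T} f"
  shows "integrable (ivl T) f" "(LINT x|ivl T. f x) = integral {0..T} f"
proof -
  have s: "set_integrable lborel {0..T} f"
    by (rule borel_integrable_atLeastAtMost'[OF assms(2)])
  then show "integrable (ivl T) f"
    unfolding ivl_def using density_indicator_integral(2)[OF assms(1), of "{0..T}"] by simp
  show "(LINT x|ivl T. f x) = integral {0..T} f"
    unfolding ivl_def using density_indicator_integral(1)[OF assms(1), of "{0..T}"]
      set_borel_integral_eq_integral(2)[OF s] by simp
qed

lemma AE_ivl: "(AE x in ivl T. P x) \<longleftrightarrow> (AE x in lborel. x \<in> {0..T} \<longrightarrow> P x)"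
  unfolding ivl_def by (subst AE_density) (auto simp: indicator_def)

lemma AE_Mx_cell: "AE x in Mx. x \<in> cell"
  unfolding Mx_eq by (subst AE_density) (auto simp: indicator_def)

section \<open>The product kernel on the torus and its sup bounds\<close>

definition ker2 :: "nat \<Rightarrow> real \<times> real \<Rightarrow> real" where
  "ker2 n z = ker n (fst z) * ker n (snd z)"

definition ker2_grad :: "nat \<Rightarrow> real \<times> real \<Rightarrow> real \<times> real" where
  "ker2_grad n z = (ker' n (fst z) * ker n (snd z), ker n (fst z) * ker' n (snd z))"

definition ker2_bd :: "nat \<Rightarrow> real" where "ker2_bd n = (64 * (real n + 1))\<^sup>2"

definition ker2_grad_bd :: "nat \<Rightarrow> real" where
  "ker2_grad_bd n = 2 * (24 * (real n + 1)\<^sup>2 / ker_mass n) * (64 * (real n + 1))"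

lemma ker2_nonneg: "0 \<le> ker2 n z"
  unfolding ker2_def by (simp add: ker_nonneg)

lemma ker2_le: "ker2 n z \<le> ker2_bd n"
  unfolding ker2_def ker2_bd_def power2_eq_square by (intro mult_mono ker_le) (auto simp: ker_nonneg)

lemma ker2_abs_le: "\<bar>ker2 n z\<bar> \<le> ker2_bd n"
  using ker2_nonneg[of n z] ker2_le[of n z] by simp

lemma ker2_bd_pos: "ker2_bd n > 0" unfolding ker2_bd_def by (intro zero_less_power) simp

lemma ker2_grad_bd_pos: "ker2_grad_bd n > 0" unfolding ker2_grad_bd_def using ker_mass_pos[of n]
  by (simp add: zero_less_mult_iff zero_less_divide_iff)

lemma ker2_grad_le: "norm (ker2_grad n z) \<le> ker2_grad_bd n"
proof -
  define a where "a = 24 * (real n + 1)\<^sup>2 / ker_mass n"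
  have a: "\<bar>ker' n z\<bar> \<le> a" for z unfolding a_def by (rule abs_ker'_le)
  have b: "\<bar>ker n z\<bar> \<le> 64 * (real n + 1)" for z using ker_le[of n z] ker_nonneg[of n z] by simp
  have "a \<ge> 0" using a[of 0] by linarith
  have "norm (ker2_grad n z) \<le> \<bar>ker' n (fst z) * ker n (snd z)\<bar> + \<bar>ker n (fst z) * ker' n (snd z)\<bar>"
    unfolding ker2_grad_def using norm_Pair_le[of "ker' n (fst z) * ker n (snd z)" "ker n (fst z) * ker' n (snd z)"] by simp
  also have "\<dots> \<le> a * (64 * (real n + 1)) + (64 * (real n + 1)) * a"
    unfolding abs_mult by (intro add_mono mult_mono a b) (use \<open>a \<ge> 0\<close> in auto)
  also have "\<dots> = ker2_grad_bd n" unfolding ker2_grad_bd_def a_def by (simp add: algebra_simps)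
  finally show ?thesis .
qed

lemma ker2_commute: "ker2 n (x - y) = ker2 n (y - x)" "ker2_grad n (x - y) = - ker2_grad n (y - x)"
proof -
  have "fst (x - y) = fst x - fst y" "snd (x - y) = snd x - snd y"
    "fst (y - x) = fst y - fst x" "snd (y - x) = snd y - snd x" by auto
  then show "ker2 n (x - y) = ker2 n (y - x)" "ker2_grad n (x - y) = - ker2_grad n (y - x)"
    unfolding ker2_def ker2_grad_def using ker_commute[of n "fst x" "fst y"] ker_commute[of n "snd x" "snd y"] by auto
qed

lemma continuous_ker2 [continuous_intros]:
  fixes f :: "'a::t2_space \<Rightarrow> real \<times> real"
  assumes "continuous_on A f"
  shows "continuous_on A (\<lambda>x. ker2 n (f x))" "continuous_on A (\<lambda>x. ker2_grad n (f x))"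
  unfolding ker2_def ker2_grad_def by (intro continuous_intros assms)+

lemma ker2_measurable [measurable]:
  "ker2 n \<in> borel_measurable borel" "ker2_grad n \<in> borel_measurable borel"
  by (intro borel_measurable_continuous_onI continuous_intros)+

lemma ker_measurable [measurable]: "ker n \<in> borel_measurable borel" "ker' n \<in> borel_measurable borel"
  by (intro borel_measurable_continuous_onI continuous_intros)+

lemma ker2_supp:
  assumes "ker2 n (x - y) \<noteq> 0"
  shows "\<bar>sin (pi * (fst x - fst y))\<bar> \<le> 1 / (real n + 1)" "\<bar>sin (pi * (snd x - snd y))\<bar> \<le> 1 / (real n + 1)"
  using assms ker_supp unfolding ker2_def by auto

lemma ker_LINT: "(LINT y|ivl 1. ker n (x - y)) = 1"
  by (subst ivl_continuous(2)) (auto intro!: continuous_intros simp: ker_integral_shift)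

lemma ker2_LINT: "(LINT y|Mx. ker2 n (x - y)) = 1"
proof -
  have "integrable Mx (\<lambda>y. ker2 n (x - y))"
    by (rule Mx.integrable_const_bound[where B="ker2_bd n"]) (auto simp: ker2_abs_le)
  then have "(LINT y|Mx. ker2 n (x - y)) = (LINT a|ivl 1. LINT b|ivl 1. ker2 n (x - (a, b)))"
    unfolding Mx_def by (subst ivlp.integral_fst'[symmetric]) auto
  also have "\<dots> = (LINT a|ivl 1. ker n (fst x - a) * (LINT b|ivl 1. ker n (snd x - b)))"
    unfolding ker2_def by simp
  also have "\<dots> = 1" by (simp add: ker_LINT)
  finally show ?thesis .
qed

lemma integrable_bounded_scaleR:
  fixes f :: "'a \<Rightarrow> 'b::{banach, second_countable_topology}" and k :: "'a \<Rightarrow> real"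
  assumes "integrable M f" "k \<in> borel_measurable M" "\<And>x. \<bar>k x\<bar> \<le> C"
  shows "integrable M (\<lambda>x. k x *\<^sub>R f x)"
proof (rule Bochner_Integration.integrable_bound)
  show "integrable M (\<lambda>x. C * norm (f x))" using assms(1) by auto
  show "(\<lambda>x. k x *\<^sub>R f x) \<in> borel_measurable M" using assms(1,2) by auto
  show "AE x in M. norm (k x *\<^sub>R f x) \<le> norm (C * norm (f x))"
  proof (rule AE_I2)
    fix x
    have "\<bar>k x\<bar> * norm (f x) \<le> C * norm (f x)" by (intro mult_right_mono assms) auto
    then show "norm (k x *\<^sub>R f x) \<le> norm (C * norm (f x))" by simp
  qed
qed

lemma integrable_scaleR_bounded:
  fixes k :: "'a \<Rightarrow> 'b::{banach, second_countable_topology}" and f :: "'a \<Rightarrow> real"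
  assumes "integrable M f" "k \<in> borel_measurable M" "\<And>x. norm (k x) \<le> C"
  shows "integrable M (\<lambda>x. f x *\<^sub>R k x)"
proof (rule Bochner_Integration.integrable_bound)
  show "integrable M (\<lambda>x. C * norm (f x))" using assms(1) by auto
  show "(\<lambda>x. f x *\<^sub>R k x) \<in> borel_measurable M" using assms(1,2) by auto
  show "AE x in M. norm (f x *\<^sub>R k x) \<le> norm (C * norm (f x))"
  proof (rule AE_I2)
    fix x
    have "norm (k x) * norm (f x) \<le> C * norm (f x)" by (intro mult_right_mono assms) auto
    then show "norm (f x *\<^sub>R k x) \<le> norm (C * norm (f x))" by (simp add: mult.commute)
  qed
qed

section \<open>Mollification: derivatives, Jensen inequalities, self-adjointness\<close>

definition mol :: "nat \<Rightarrow> (real \<times> real \<Rightarrow> 'b::{banach, second_countable_topology}) \<Rightarrow> real \<times> real \<Rightarrow> 'b" where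
  "mol n f x = (LINT y|Mx. ker2 n (x - y) *\<^sub>R f y)"

text \<open>The derivative falls on the kernel, so this makes sense for merely integrable f. It is
  the classical gradient of \<open>mol n f\<close>; for a weakly differentiable f it equals the
  mollified weak gradient.\<close>

definition mol_grad :: "nat \<Rightarrow> (real \<times> real \<Rightarrow> real) \<Rightarrow> real \<times> real \<Rightarrow> real \<times> real" where
  "mol_grad n f x = (LINT y|Mx. f y *\<^sub>R ker2_grad n (x - y))"

lemma mol_integrable:
  fixes f :: "real \<times> real \<Rightarrow> 'b::{banach, second_countable_topology}"
  shows "integrable Mx f \<Longrightarrow> integrable Mx (\<lambda>y. ker2 n (x - y) *\<^sub>R f y)"
  by (rule integrable_bounded_scaleR[where C="ker2_bd n"]) (auto simp: ker2_abs_le)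

lemma mol_grad_integrable: "integrable Mx f \<Longrightarrow> integrable Mx (\<lambda>y. f y *\<^sub>R ker2_grad n (x - y))"
  by (rule integrable_scaleR_bounded[where C="ker2_grad_bd n"]) (auto simp: ker2_grad_le)

lemma continuous_param_integral:
  fixes f :: "'a \<Rightarrow> 'b::{banach, second_countable_topology}" and k :: "'c::metric_space \<Rightarrow> 'a \<Rightarrow> 'b"
  assumes w: "integrable M w"
    and meas: "\<And>x. k x \<in> borel_measurable M"
    and bd: "\<And>x y. norm (k x y) \<le> w y"
    and cont: "\<And>y. continuous_on UNIV (\<lambda>x. k x y)"
  shows "continuous_on UNIV (\<lambda>x. LINT y|M. k x y)"
proof (rule continuous_on_sequentiallyI)
  fix u a assume u: "\<forall>n. u n \<in> UNIV" "a \<in> UNIV" "u \<longlonglongrightarrow> (a::'c)"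
  show "(\<lambda>n. LINT y|M. k (u n) y) \<longlonglongrightarrow> (LINT y|M. k a y)"
  proof (rule integral_dominated_convergence[OF meas meas w])
    show "AE y in M. (\<lambda>n. k (u n) y) \<longlonglongrightarrow> k a y"
      using continuous_on_tendsto_compose[OF cont u(3)] by auto
    show "\<And>n. AE y in M. norm (k (u n) y) \<le> w y" using bd by auto
  qed
qed

text \<open>The bound w on the derivative holds for all s, so the mean value inequality dominates
  every difference quotient by the same integrable function.\<close>

lemma DERIV_param_integral:
  fixes k :: "real \<Rightarrow> 'a \<Rightarrow> real"
  assumes w: "integrable M w"
    and int: "\<And>s. integrable M (k s)"
    and meas: "\<And>s. k' s \<in> borel_measurable M"
    and bd: "\<And>s y. \<bar>k' s y\<bar> \<le> w y"
    and der: "\<And>s y. ((\<lambda>s. k s y) has_field_derivative k' s y) (at s)"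
  shows "((\<lambda>s. LINT y|M. k s y) has_field_derivative (LINT y|M. k' s y)) (at s)"
  unfolding DERIV_def tendsto_at_iff_sequentially comp_def
proof (intro allI impI)
  fix X :: "nat \<Rightarrow> real" assume X0: "\<forall>i. X i \<in> UNIV - {0}" and X: "X \<longlonglongrightarrow> 0"
  have "(\<lambda>i. LINT y|M. (k (s + X i) y - k s y) / X i) \<longlonglongrightarrow> (LINT y|M. k' s y)"
  proof (rule integral_dominated_convergence[OF meas _ w])
    show "(\<lambda>y. (k (s + X i) y - k s y) / X i) \<in> borel_measurable M" for i
      using int[of s] int[of "s + X i"] by auto
    show "AE y in M. (\<lambda>i. (k (s + X i) y - k s y) / X i) \<longlonglongrightarrow> k' s y"
      using der[of _ s] X X0 unfolding DERIV_def tendsto_at_iff_sequentially comp_def by auto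
    show "AE y in M. norm ((k (s + X i) y - k s y) / X i) \<le> w y" for i
    proof (rule AE_I2)
      fix y
      have "norm (k (s + X i) y - k s y) \<le> w y * norm (s + X i - s)"
        by (rule field_differentiable_bound[where S=UNIV]) (use der bd in \<open>auto intro: has_field_derivative_at_within\<close>)
      then show "norm ((k (s + X i) y - k s y) / X i) \<le> w y"
        using X0 by (auto simp: field_simps)
    qed
  qed
  moreover have "(LINT y|M. (k (s + X i) y - k s y) / X i) = ((LINT y|M. k (s + X i) y) - (LINT y|M. k s y)) / X i" for i
    by (simp only: integral_divide_zero Bochner_Integration.integral_diff[OF int int])
  ultimately show "(\<lambda>i. ((LINT y|M. k (s + X i) y) - (LINT y|M. k s y)) / X i) \<longlonglongrightarrow> (LINT y|M. k' s y)"
    by (simp only:)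
qed

lemma mol_continuous:
  fixes f :: "real \<times> real \<Rightarrow> 'b::{banach, second_countable_topology}"
  assumes "integrable Mx f"
  shows "continuous_on UNIV (mol n f)"
  unfolding mol_def[abs_def]
proof (rule continuous_param_integral[where w="\<lambda>y. ker2_bd n * norm (f y)"])
  show "norm (ker2 n (x - y) *\<^sub>R f y) \<le> ker2_bd n * norm (f y)" for x y
    using ker2_abs_le[of n "x - y"] by (simp add: mult_right_mono)
  show "continuous_on UNIV (\<lambda>x. ker2 n (x - y) *\<^sub>R f y)" for y
    by (intro continuous_intros)
qed (use assms in auto)

lemma mol_grad_continuous:
  assumes "integrable Mx f"
  shows "continuous_on UNIV (mol_grad n f)"
  unfolding mol_grad_def[abs_def]
proof (rule continuous_param_integral[where w="\<lambda>y. ker2_grad_bd n * norm (f y)"])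
  show "norm (f y *\<^sub>R ker2_grad n (x - y)) \<le> ker2_grad_bd n * norm (f y)" for x y
    using mult_right_mono[OF ker2_grad_le[of n "x - y"], of "\<bar>f y\<bar>"] by (simp add: mult.commute)
  show "continuous_on UNIV (\<lambda>x. f y *\<^sub>R ker2_grad n (x - y))" for y
    by (intro continuous_intros)
qed (use assms in auto)

lemma mol_grad_fst_snd:
  assumes "integrable Mx f"
  shows "fst (mol_grad n f x) = (LINT y|Mx. f y * fst (ker2_grad n (x - y)))"
    "snd (mol_grad n f x) = (LINT y|Mx. f y * snd (ker2_grad n (x - y)))"
  unfolding mol_grad_def
  using integral_bounded_linear[OF bounded_linear_fst mol_grad_integrable[OF assms, of n x]]
    integral_bounded_linear[OF bounded_linear_snd mol_grad_integrable[OF assms, of n x]]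
  by auto

lemma abs_fst_le: "\<bar>fst z\<bar> \<le> norm (z::real\<times>real)" and abs_snd_le: "\<bar>snd z\<bar> \<le> norm (z::real\<times>real)"
  using norm_fst_le[of "fst z" "snd z"] norm_snd_le[of "snd z" "fst z"] by auto

lemma fst_snd_borel [measurable]:
  "fst \<in> borel_measurable (borel :: ('a::topological_space \<times> 'b::topological_space) measure)"
  "snd \<in> borel_measurable (borel :: ('a::topological_space \<times> 'b::topological_space) measure)"
  by (intro borel_measurable_continuous_onI continuous_intros)+

lemma mol_DERIV1:
  assumes f: "integrable Mx f"
  shows "((\<lambda>s. mol n f (s, b)) has_field_derivative fst (mol_grad n f (s, b))) (at s)"
  unfolding mol_grad_fst_snd[OF f] mol_def
proof (rule DERIV_param_integral[where w="\<lambda>y. ker2_grad_bd n * norm (f y)"])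
  show "\<bar>f y * fst (ker2_grad n ((s, b) - y))\<bar> \<le> ker2_grad_bd n * norm (f y)" for s y
    unfolding abs_mult
    using mult_right_mono[OF order_trans[OF abs_fst_le[of "ker2_grad n ((s, b) - y)"] ker2_grad_le], of "\<bar>f y\<bar>"]
    by (simp add: mult.commute)
  show "((\<lambda>s. ker2 n ((s, b) - y) *\<^sub>R f y) has_real_derivative f y * fst (ker2_grad n ((s, b) - y))) (at s)" for s y
    unfolding ker2_def ker2_grad_def
    by (auto intro!: derivative_eq_intros DERIV_chain2[OF DERIV_ker])
qed (use f mol_integrable[OF f, of n] in auto)

lemma mol_DERIV2:
  assumes f: "integrable Mx f"
  shows "((\<lambda>s. mol n f (a, s)) has_field_derivative snd (mol_grad n f (a, s))) (at s)"
  unfolding mol_grad_fst_snd[OF f] mol_def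
proof (rule DERIV_param_integral[where w="\<lambda>y. ker2_grad_bd n * norm (f y)"])
  show "\<bar>f y * snd (ker2_grad n ((a, s) - y))\<bar> \<le> ker2_grad_bd n * norm (f y)" for s y
    unfolding abs_mult
    using mult_right_mono[OF order_trans[OF abs_snd_le[of "ker2_grad n ((a, s) - y)"] ker2_grad_le], of "\<bar>f y\<bar>"]
    by (simp add: mult.commute)
  show "((\<lambda>s. ker2 n ((a, s) - y) *\<^sub>R f y) has_real_derivative f y * snd (ker2_grad n ((a, s) - y))) (at s)" for s y
    unfolding ker2_def ker2_grad_def
    by (auto intro!: derivative_eq_intros DERIV_chain2[OF DERIV_ker])
qed (use f mol_integrable[OF f, of n] in auto)

lemma mol_periodic: "mol n f (a + of_int k, b + of_int l) = mol n f (a, b)"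
  "mol_grad n g (a + of_int k, b + of_int l) = mol_grad n g (a, b)"
proof -
  have "ker n (a + of_int k - u) = ker n (a - u)" "ker' n (a + of_int k - u) = ker' n (a - u)" for a u k
    using ker_periodic[of n "a - u" k] by (auto simp: algebra_simps)
  then show "mol n f (a + of_int k, b + of_int l) = mol n f (a, b)"
    "mol_grad n g (a + of_int k, b + of_int l) = mol_grad n g (a, b)"
    unfolding mol_def mol_grad_def ker2_def ker2_grad_def by auto
qed

lemma mol_diff:
  fixes f g :: "real \<times> real \<Rightarrow> 'b::{banach, second_countable_topology}"
  assumes "integrable Mx f" "integrable Mx g"
  shows "mol n (\<lambda>x. f x - g x) x = mol n f x - mol n g x"
  unfolding mol_def by (simp add: scaleR_diff_right mol_integrable assms)

lemma mol_const: "mol n (\<lambda>_. c::real) x = c"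
  unfolding mol_def by (simp add: ker2_LINT)

lemma mol_mono:
  fixes f g :: "real \<times> real \<Rightarrow> real"
  assumes "integrable Mx f" "integrable Mx g" "\<And>y. f y \<le> g y"
  shows "mol n f x \<le> mol n g x"
  unfolding mol_def using assms
  by (intro integral_mono mol_integrable) (auto intro!: mult_left_mono ker2_nonneg)

lemma mol_nonneg:
  fixes f :: "real \<times> real \<Rightarrow> real"
  assumes "\<And>y. 0 \<le> f y" shows "0 \<le> mol n f x"
  unfolding mol_def by (rule integral_nonneg_AE) (use assms in \<open>auto intro!: mult_nonneg_nonneg ker2_nonneg\<close>)

lemma norm_S_le:
  fixes f :: "real \<times> real \<Rightarrow> 'b::{banach, second_countable_topology}"
  assumes "integrable Mx f"
  shows "norm (mol n f x) \<le> mol n (\<lambda>y. norm (f y)) x"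
proof -
  have "norm (mol n f x) \<le> (LINT y|Mx. norm (ker2 n (x - y) *\<^sub>R f y))"
    unfolding mol_def by (rule integral_norm_bound)
  also have "\<dots> = mol n (\<lambda>y. norm (f y)) x"
    unfolding mol_def by (simp add: ker2_nonneg)
  finally show ?thesis .
qed

lemma norm_S_bound:
  fixes f :: "real \<times> real \<Rightarrow> 'b::{banach, second_countable_topology}"
  assumes "integrable Mx f"
  shows "norm (mol n f x) \<le> ker2_bd n * (LINT y|Mx. norm (f y))"
proof -
  have "mol n (\<lambda>y. norm (f y)) x \<le> (LINT y|Mx. ker2_bd n * norm (f y))"
    unfolding mol_def by (intro integral_mono mol_integrable integrable_mult_right integrable_norm assms)
      (auto intro!: mult_right_mono ker2_le)
  then show ?thesis using norm_S_le[OF assms, of n x] by simp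
qed

lemma integrable_of_square:
  fixes f :: "'a \<Rightarrow> 'b::{banach, second_countable_topology}"
  assumes "finite_measure M" "f \<in> borel_measurable M" "integrable M (\<lambda>x. (norm (f x))\<^sup>2)"
  shows "integrable M f"
proof (rule Bochner_Integration.integrable_bound)
  interpret finite_measure M by fact
  show "integrable M (\<lambda>x. 1 + (norm (f x))\<^sup>2)" using assms by auto
  have "norm (f x) \<le> 1 + (norm (f x))\<^sup>2" for x
    using zero_le_power2[of "norm (f x) - 1/2"] by (simp add: power2_eq_square algebra_simps)
  then show "AE x in M. norm (f x) \<le> norm (1 + (norm (f x))\<^sup>2)" by simp
qed (use assms in auto)

text \<open>Jensen for the probability density \<open>ker2 n (x - y)\<close>, obtained as
  nonnegativity of a variance: expand the average of (|f| - a)^2 with a the average of |f|.\<close>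

lemma mol_sq:
  fixes f :: "real \<times> real \<Rightarrow> 'b::{banach, second_countable_topology}"
  assumes [measurable]: "f \<in> borel_measurable borel" and f: "integrable Mx (\<lambda>x. (norm (f x))\<^sup>2)"
  shows "(norm (mol n f x))\<^sup>2 \<le> mol n (\<lambda>y. (norm (f y))\<^sup>2) x"
proof -
  have fi: "integrable Mx f"
    by (rule integrable_of_square) (use f in \<open>auto intro: Mx.finite_measure_axioms\<close>)
  define a where "a = mol n (\<lambda>y. norm (f y)) x"
  have "0 \<le> mol n (\<lambda>y. (norm (f y) - a)\<^sup>2) x" by (rule mol_nonneg) simp
  also have "\<dots> = (LINT y|Mx. ker2 n (x - y) * (norm (f y))\<^sup>2 - 2 * a * (ker2 n (x - y) * norm (f y)) + a\<^sup>2 * ker2 n (x - y))"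
    unfolding mol_def by (simp add: power2_diff algebra_simps)
  also have "\<dots> = mol n (\<lambda>y. (norm (f y))\<^sup>2) x - 2 * a * a + a\<^sup>2 * 1"
    using mol_integrable[OF f, of n x] mol_integrable[OF integrable_norm[OF fi], of n x] mol_integrable[of "\<lambda>_. 1::real" n x]
    unfolding a_def mol_def by (simp add: ker2_LINT)
  finally have "a\<^sup>2 \<le> mol n (\<lambda>y. (norm (f y))\<^sup>2) x" by (simp add: power2_eq_square)
  moreover have "(norm (mol n f x))\<^sup>2 \<le> a\<^sup>2"
    unfolding a_def by (intro power_mono norm_S_le fi) auto
  ultimately show ?thesis by simp
qed

text \<open>The convex function s^p lies above its tangent at a. Young's inequality for the
  exponents p and p/(p-1), applied to s and a^(p-1), is exactly this.\<close>

lemma powr_tangent: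
  fixes p a s :: real
  assumes "p > 1" "a \<ge> 0" "s \<ge> 0"
  shows "p * a powr (p - 1) * s - (p - 1) * a powr p \<le> s powr p"
proof -
  define q where "q = p / (p - 1)"
  have q: "q > 1" "1/p + 1/q = 1" unfolding q_def using assms by (auto simp: field_simps)
  have "s * a powr (p - 1) \<le> s powr p / p + (a powr (p - 1)) powr q / q"
    by (rule Youngs_inequality) (use assms q in auto)
  moreover have "(a powr (p - 1)) powr q = a powr p"
    unfolding powr_powr q_def using assms by simp
  ultimately have "p * (s * a powr (p - 1)) \<le> p * (s powr p / p + a powr p / q)"
    using assms by (intro mult_left_mono) auto
  also have "\<dots> = s powr p + (p - 1) * a powr p"
    unfolding q_def using assms by (simp add: field_simps)
  finally show ?thesis by (simp add: algebra_simps)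
qed

lemma integrable_of_powr:
  fixes f :: "'a \<Rightarrow> 'b::{banach, second_countable_topology}"
  assumes "finite_measure M" "f \<in> borel_measurable M" "integrable M (\<lambda>x. norm (f x) powr p)" "p \<ge> 1"
  shows "integrable M f"
proof (rule Bochner_Integration.integrable_bound)
  interpret finite_measure M by fact
  show "integrable M (\<lambda>x. 1 + norm (f x) powr p)" using assms by auto
  have "norm (f x) \<le> 1 + norm (f x) powr p" for x
  proof (cases "norm (f x) \<le> 1")
    case True then show ?thesis using powr_ge_zero[of "norm (f x)" p] by linarith
  next
    case False
    then have "norm (f x) powr 1 \<le> norm (f x) powr p" using assms by (intro powr_mono) auto
    then show ?thesis using False by simp
  qed
  then show "AE x in M. norm (f x) \<le> norm (1 + norm (f x) powr p)" by simp
qed (use assms in auto)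

text \<open>Jensen again: average the inequality of \<open>powr_tangent\<close> at the point a, the
  mollified |f|; the affine minorant then averages to a^p.\<close>

lemma mol_powr:
  fixes f :: "real \<times> real \<Rightarrow> real"
  assumes [measurable]: "f \<in> borel_measurable borel" and f: "integrable Mx (\<lambda>x. \<bar>f x\<bar> powr p)" and p: "p > 1"
  shows "\<bar>mol n f x\<bar> powr p \<le> mol n (\<lambda>y. \<bar>f y\<bar> powr p) x"
proof -
  have fi: "integrable Mx f"
    by (rule integrable_of_powr[where p=p]) (use f p in \<open>auto intro: Mx.finite_measure_axioms\<close>)
  define a where "a = mol n (\<lambda>y. \<bar>f y\<bar>) x"
  have a0: "a \<ge> 0" unfolding a_def by (rule mol_nonneg) simp
  have i: "integrable Mx (\<lambda>y. \<bar>f y\<bar>)" using fi by simp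
  have "p * a powr (p - 1) * a - (p - 1) * a powr p
      = (LINT y|Mx. p * a powr (p - 1) * (ker2 n (x - y) * \<bar>f y\<bar>) - (p - 1) * a powr p * ker2 n (x - y))"
    using mol_integrable[OF i, of n x] mol_integrable[of "\<lambda>_. 1::real" n x]
    unfolding a_def mol_def by (simp add: ker2_LINT)
  also have "\<dots> = mol n (\<lambda>y. p * a powr (p - 1) * \<bar>f y\<bar> - (p - 1) * a powr p) x"
    unfolding mol_def by (simp add: algebra_simps)
  also have "\<dots> \<le> mol n (\<lambda>y. \<bar>f y\<bar> powr p) x"
    by (rule mol_mono) (use f i powr_tangent[OF p a0] in auto)
  also have "p * a powr (p - 1) * a - (p - 1) * a powr p = a powr p"
  proof (cases "a = 0")
    case False
    then have "a powr (p - 1) * a = a powr p"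
      using a0 powr_add[of a "p - 1" 1] by simp
    then show ?thesis by (simp add: algebra_simps)
  qed simp
  finally have "a powr p \<le> mol n (\<lambda>y. \<bar>f y\<bar> powr p) x" .
  moreover have "\<bar>mol n f x\<bar> powr p \<le> a powr p"
    unfolding a_def using norm_S_le[OF fi, of n x] p by (intro powr_mono2) auto
  ultimately show ?thesis by linarith
qed

lemma mol_product_integrable:
  fixes f q :: "real \<times> real \<Rightarrow> real"
  assumes f: "integrable Mx f" and q: "integrable Mx q"
  shows "integrable (Mx \<Otimes>\<^sub>M Mx) (\<lambda>(x, y). q x * (ker2 n (x - y) * f y))"
proof -
  have m[measurable]: "f \<in> borel_measurable borel" "q \<in> borel_measurable borel" using f q by auto
  have "integrable (Mx \<Otimes>\<^sub>M Mx) (\<lambda>z. q (fst z) * f (snd z))"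
  proof (rule MxMx.Fubini_integrable)
    show "integrable Mx (\<lambda>x. LINT y|Mx. norm (q (fst (x, y)) * f (snd (x, y))))"
      using q by (simp add: abs_mult)
    show "AE x in Mx. integrable Mx (\<lambda>y. q (fst (x, y)) * f (snd (x, y)))"
      using f by simp
  qed measurable
  from integrable_bounded_scaleR[OF this, of "\<lambda>z. ker2 n (fst z - snd z)" "ker2_bd n"]
  show ?thesis by (auto simp: ker2_abs_le split_beta' mult_ac)
qed

text \<open>The kernel is even, so Fubini makes mollification self-adjoint. With q = 1 this yields
  conservation of the integral; it also identifies the squared norm of \<open>mol n f\<close> with
  the pairing of f and its double mollification.\<close>

lemma mol_integral:
  fixes f q :: "real \<times> real \<Rightarrow> real"
  assumes f: "integrable Mx f" and q: "integrable Mx q"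
  shows "(LINT x|Mx. q x * mol n f x) = (LINT y|Mx. mol n q y * f y)" "integrable Mx (\<lambda>x. q x * mol n f x)"
proof -
  note i = mol_product_integrable[OF f q, of n]
  have "(LINT x|Mx. LINT y|Mx. q x * (ker2 n (x - y) * f y)) = (LINT y|Mx. LINT x|Mx. q x * (ker2 n (x - y) * f y))"
    using MxMx.Fubini_integral[OF i] by simp
  moreover have "(LINT y|Mx. q x * (ker2 n (x - y) * f y)) = q x * mol n f x" for x
    unfolding mol_def by simp
  moreover have "(LINT x|Mx. q x * (ker2 n (x - y) * f y)) = mol n q y * f y" for y
  proof -
    have "(LINT x|Mx. q x * (ker2 n (x - y) * f y)) = (LINT x|Mx. (ker2 n (y - x) * q x) * f y)"
      by (subst ker2_commute(1)) (simp add: mult_ac)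
    then show ?thesis unfolding mol_def by simp
  qed
  ultimately show "(LINT x|Mx. q x * mol n f x) = (LINT y|Mx. mol n q y * f y)" by (simp only:)
  show "integrable Mx (\<lambda>x. q x * mol n f x)"
    using MxMx.integrable_fst[OF i] unfolding mol_def by simp
qed

lemma mol_integral_eq:
  fixes f :: "real \<times> real \<Rightarrow> real"
  assumes f: "integrable Mx f"
  shows "(LINT x|Mx. mol n f x) = (LINT y|Mx. f y)" "integrable Mx (mol n f)"
  using mol_integral[OF f, of "\<lambda>_. 1" n] by (auto simp: mol_const)

lemma mol_L1:
  fixes f :: "real \<times> real \<Rightarrow> real"
  assumes f: "integrable Mx f"
  shows "(LINT x|Mx. \<bar>mol n f x\<bar>) \<le> (LINT y|Mx. \<bar>f y\<bar>)"
proof -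
  have "(LINT x|Mx. \<bar>mol n f x\<bar>) \<le> (LINT x|Mx. mol n (\<lambda>y. \<bar>f y\<bar>) x)"
    using mol_integral_eq(2)[OF f] mol_integral_eq(2)[of "\<lambda>y. \<bar>f y\<bar>"] f norm_S_le[OF f]
    by (intro integral_mono) auto
  then show ?thesis using mol_integral_eq(1)[of "\<lambda>y. \<bar>f y\<bar>"] f by simp
qed

lemma mol_borel [measurable]:
  fixes f :: "real \<times> real \<Rightarrow> 'b::{banach, second_countable_topology}"
  assumes [measurable]: "f \<in> borel_measurable borel"
  shows "mol n f \<in> borel_measurable borel"
  unfolding mol_def[abs_def] by measurable

lemma mol_square_integral:
  fixes f :: "real \<times> real \<Rightarrow> 'b::{banach, second_countable_topology}"
  assumes [measurable]: "f \<in> borel_measurable borel" and f: "integrable Mx (\<lambda>x. (norm (f x))\<^sup>2)"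
  shows "integrable Mx (\<lambda>x. (norm (mol n f x))\<^sup>2)"
    "(LINT x|Mx. (norm (mol n f x))\<^sup>2) \<le> (LINT x|Mx. (norm (f x))\<^sup>2)"
proof -
  show i: "integrable Mx (\<lambda>x. (norm (mol n f x))\<^sup>2)"
    by (rule Bochner_Integration.integrable_bound[OF mol_integral_eq(2)[OF f, of n]])
      (auto intro!: AE_I2 order_trans[OF mol_sq[OF assms]])
  show "(LINT x|Mx. (norm (mol n f x))\<^sup>2) \<le> (LINT x|Mx. (norm (f x))\<^sup>2)"
    using integral_mono[OF i mol_integral_eq(2)[OF f] mol_sq[OF assms]] mol_integral_eq(1)[OF f, of n] by simp
qed

lemma mol_powr_integral:
  fixes f :: "real \<times> real \<Rightarrow> real"
  assumes [measurable]: "f \<in> borel_measurable borel" and f: "integrable Mx (\<lambda>x. \<bar>f x\<bar> powr p)" and p: "p > 1"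
  shows "integrable Mx (\<lambda>x. \<bar>mol n f x\<bar> powr p)"
    "(LINT x|Mx. \<bar>mol n f x\<bar> powr p) \<le> (LINT x|Mx. \<bar>f x\<bar> powr p)"
proof -
  show i: "integrable Mx (\<lambda>x. \<bar>mol n f x\<bar> powr p)"
    by (rule Bochner_Integration.integrable_bound[OF mol_integral_eq(2)[OF f, of n]])
      (auto intro!: AE_I2 order_trans[OF mol_powr[OF assms]])
  show "(LINT x|Mx. \<bar>mol n f x\<bar> powr p) \<le> (LINT x|Mx. \<bar>f x\<bar> powr p)"
    using integral_mono[OF i mol_integral_eq(2)[OF f] mol_powr[OF assms]] mol_integral_eq(1)[OF f, of n] by simp
qed

lemma sin_ge_linear: "0 \<le> z \<Longrightarrow> z \<le> 1/2 \<Longrightarrow> 2 * z \<le> sin (pi * z)"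
proof -
  assume z: "0 \<le> z" "z \<le> 1/2"
  have "concave_on {0..pi/2} sin"
    by (rule f''_le0_imp_concave[where f'=cos and f''="\<lambda>x. - sin x"])
      (auto intro!: derivative_eq_intros sin_ge_zero)
  from concave_onD[OF this, of "2 * z" 0 "pi/2"] z
  show ?thesis by (simp add: mult.commute)
qed

text \<open>Jordan's inequality on both halves of the unit interval. The minimum is the distance
  from z to the nearest integer, so the support condition of the kernel becomes a distance on the
  circle.\<close>

lemma abs_sin_ge_min:
  assumes "\<bar>z\<bar> \<le> 1" shows "2 * min \<bar>z\<bar> (1 - \<bar>z\<bar>) \<le> \<bar>sin (pi * z)\<bar>"
proof -
  have e: "\<bar>sin (pi * z)\<bar> = \<bar>sin (pi * \<bar>z\<bar>)\<bar>" by (auto simp: abs_if)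
  show ?thesis
  proof (cases "\<bar>z\<bar> \<le> 1/2")
    case True
    then show ?thesis using sin_ge_linear[of "\<bar>z\<bar>"] e by auto
  next
    case False
    have "sin (pi * \<bar>z\<bar>) = sin (pi * (1 - \<bar>z\<bar>))"
      by (simp add: right_diff_distrib)
    then show ?thesis using sin_ge_linear[of "1 - \<bar>z\<bar>"] e False assms by auto
  qed
qed

section \<open>Convergence of mollifications\<close>

definition approximable :: "(real \<times> real \<Rightarrow> real) \<Rightarrow> bool" where
  "approximable f \<longleftrightarrow> (\<lambda>n. LINT x|Mx. \<bar>mol n f x - f x\<bar>) \<longlonglongrightarrow> 0"

text \<open>Mollification is an L^1 contraction, so the approximable functions form an L^1-closed
  set: the errors of mollifying f - h, of mollifying h and of replacing f by h are each below
  e/4.\<close>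

lemma approximable_closure:
  assumes f: "integrable Mx f"
    and h: "\<And>e. e > 0 \<Longrightarrow> \<exists>h. integrable Mx h \<and> approximable h \<and> (LINT x|Mx. \<bar>f x - h x\<bar>) < e"
  shows "approximable f"
  unfolding approximable_def
proof (rule LIMSEQ_I)
  fix e :: real assume "e > 0"
  then obtain h where h: "integrable Mx h" "approximable h" "(LINT x|Mx. \<bar>f x - h x\<bar>) < e/4"
    using h[of "e/4"] by auto
  then obtain N where N: "\<And>n. n \<ge> N \<Longrightarrow> (LINT x|Mx. \<bar>mol n h x - h x\<bar>) < e/4"
    using order_tendstoD(2)[OF h(2)[unfolded approximable_def], of "e/4"] \<open>e > 0\<close>
    unfolding eventually_sequentially by auto
  have "norm ((LINT x|Mx. \<bar>mol n f x - f x\<bar>) - 0) < e" if "n \<ge> N" for n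
  proof -
    note si = mol_integral_eq(2)
    have "(LINT x|Mx. \<bar>mol n f x - f x\<bar>) \<le>
      (LINT x|Mx. \<bar>mol n (\<lambda>y. f y - h y) x\<bar> + \<bar>mol n h x - h x\<bar> + \<bar>f x - h x\<bar>)"
      using f h(1) si[OF f, of n] si[OF h(1), of n] by (intro integral_mono) (auto simp: mol_diff)
    also have "\<dots> = (LINT x|Mx. \<bar>mol n (\<lambda>y. f y - h y) x\<bar>) + (LINT x|Mx. \<bar>mol n h x - h x\<bar>) + (LINT x|Mx. \<bar>f x - h x\<bar>)"
      using f h(1) si[OF f, of n] si[OF h(1), of n] by (simp add: mol_diff)
    also have "\<dots> < e/4 + e/4 + e/4"
      using mol_L1[OF Bochner_Integration.integrable_diff[OF f h(1)], of n] h(3) N[OF that] by linarith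
    finally have "(LINT x|Mx. \<bar>mol n f x - f x\<bar>) < e" using \<open>e > 0\<close> by simp
    moreover have "(LINT x|Mx. \<bar>mol n f x - f x\<bar>) \<ge> 0" by simp
    ultimately show ?thesis by simp
  qed
  then show "\<exists>N. \<forall>n\<ge>N. norm ((LINT x|Mx. \<bar>mol n f x - f x\<bar>) - 0) < e" by blast
qed

text \<open>Periodicity of h is not among the hypotheses, and at a boundary point the kernel mixes
  values from opposite sides of the cell. Interior points suffice, being almost all points of the
  cell.\<close>

lemma mol_tendsto_continuous:
  fixes h :: "real \<times> real \<Rightarrow> real"
  assumes c: "continuous_on UNIV h" and b: "\<And>x. \<bar>h x\<bar> \<le> B"
    and x: "0 < fst x" "fst x < 1" "0 < snd x" "snd x < 1"
  shows "(\<lambda>n. mol n h x) \<longlonglongrightarrow> h x"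
proof (rule LIMSEQ_I)
  fix e :: real assume e: "e > 0"
  have [measurable]: "h \<in> borel_measurable borel" using c by (rule borel_measurable_continuous_onI)
  have hi: "integrable Mx h" by (rule Mx.integrable_const_bound[where B=B]) (use b in auto)
  obtain d where d: "d > 0" "\<And>y. dist y x < d \<Longrightarrow> dist (h y) (h x) < e/2"
    using c[unfolded continuous_on_iff, rule_format, of x "e/2"] e by auto
  \<comment> \<open>Distance of x to the boundary. A point of the cell differs from x by at most 1 -
    \<eta> in each coordinate, so once the kernel radius is below \<eta> the wrap-around alternative
    in \<open>abs_sin_ge_min\<close> is excluded.\<close>
  define \<eta> where "\<eta> = min (min (fst x) (1 - fst x)) (min (snd x) (1 - snd x))"
  have \<eta>: "\<eta> > 0" unfolding \<eta>_def using x by auto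
  obtain N where N: "1 / (real N + 1) < min \<eta> (d/2)"
    using \<eta> d(1) reals_Archimedean[of "min \<eta> (d/2)"] by (auto simp: inverse_eq_divide add.commute)
  have "norm (mol n h x - h x) < e" if n: "n \<ge> N" for n
  proof -
    have r: "1 / (real n + 1) \<le> 1 / (real N + 1)" using n by (simp add: field_simps)
    have *: "AE y in Mx. ker2 n (x - y) * \<bar>h y - h x\<bar> \<le> ker2 n (x - y) * (e/2)"
      using AE_Mx_cell
    proof eventually_elim
      case (elim y)
      show ?case
      proof (cases "ker2 n (x - y) = 0")
        case False
        have y: "0 \<le> fst y" "fst y \<le> 1" "0 \<le> snd y" "snd y \<le> 1"
          using elim unfolding cell_def by auto
        have close: "\<bar>z\<bar> < d/2" if "\<bar>z\<bar> \<le> 1 - \<eta>" "\<bar>sin (pi * z)\<bar> \<le> 1 / (real n + 1)" for z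
          using abs_sin_ge_min[of z] that r N \<eta> by (auto simp: min_def split: if_splits)
        have "\<bar>fst x - fst y\<bar> < d/2" "\<bar>snd x - snd y\<bar> < d/2"
          using close[OF _ ker2_supp(1)[OF False]] close[OF _ ker2_supp(2)[OF False]] x y unfolding \<eta>_def by linarith+
        moreover have "dist y x \<le> \<bar>fst x - fst y\<bar> + \<bar>snd x - snd y\<bar>"
          using norm_Pair_le[of "fst y - fst x" "snd y - snd x"]
          by (simp add: dist_norm minus_prod_def abs_minus_commute)
        ultimately have "dist (h y) (h x) < e/2" using d(2) by auto
        then show ?thesis by (intro mult_left_mono ker2_nonneg) (simp add: dist_real_def)
      qed simp
    qed
    have "mol n h x - h x = mol n (\<lambda>y. h y - h x) x"
      using mol_diff[OF hi, of "\<lambda>_. h x" n x] by (simp add: mol_const)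
    then have "norm (mol n h x - h x) \<le> mol n (\<lambda>y. norm (h y - h x)) x"
      using norm_S_le[of "\<lambda>y. h y - h x" n x] hi by simp
    also have "\<dots> \<le> mol n (\<lambda>y. e/2) x"
      unfolding mol_def by (intro integral_mono_AE mol_integrable) (use hi * in auto)
    also have "\<dots> < e" using e by (simp add: mol_const)
    finally show ?thesis .
  qed
  then show "\<exists>N. \<forall>n\<ge>N. norm (mol n h x - h x) < e" by blast
qed

lemma AE_Mx_interior: "AE x in Mx. 0 < fst x \<and> fst x < 1 \<and> 0 < snd x \<and> snd x < 1"
proof -
  have "AE a in ivl 1. 0 < a \<and> a < 1"
    unfolding AE_ivl using AE_lborel_singleton[of 0] AE_lborel_singleton[of 1]
    by eventually_elim auto
  then have "AE a in ivl 1. AE b in ivl 1. 0 < a \<and> a < 1 \<and> 0 < b \<and> b < 1"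
    by eventually_elim (use \<open>AE a in ivl 1. 0 < a \<and> a < 1\<close> in auto)
  then have *: "AE a in ivl 1. AE b in ivl 1. (\<lambda>x. 0 < fst x \<and> fst x < 1 \<and> 0 < snd x \<and> snd x < 1) (a, b)"
    by (simp only: fst_conv snd_conv)
  have "{x \<in> space Mx. 0 < fst x \<and> fst x < 1 \<and> 0 < snd x \<and> snd x < 1} = {0<..<1} \<times> {0<..<1}" by auto
  moreover have "\<dots> \<in> sets Mx" by (simp add: borel_Times)
  ultimately show ?thesis
    using ivlp.AE_pair_measure[OF _ *] unfolding Mx_def by (simp only:)
qed

lemma approximable_continuous:
  assumes c: "continuous_on UNIV h" and b: "\<And>x. \<bar>h x\<bar> \<le> B"
  shows "approximable h"
proof -
  have [measurable]: "h \<in> borel_measurable borel" using c by (rule borel_measurable_continuous_onI)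
  have hi: "integrable Mx h" by (rule Mx.integrable_const_bound[where B=B]) (use b in auto)
  have "(\<lambda>n. LINT x|Mx. \<bar>mol n h x - h x\<bar>) \<longlonglongrightarrow> (LINT x|Mx. 0)"
  proof (rule integral_dominated_convergence[where w="\<lambda>_. 2 * B"])
    show "AE x in Mx. (\<lambda>n. \<bar>mol n h x - h x\<bar>) \<longlonglongrightarrow> 0"
      using AE_Mx_interior
    proof eventually_elim
      case (elim x)
      then have "(\<lambda>n. mol n h x - h x) \<longlonglongrightarrow> 0"
        using mol_tendsto_continuous[OF c b, of x] LIM_zero by blast
      then show ?case using tendsto_rabs_zero by blast
    qed
    have "\<bar>mol n h x\<bar> \<le> B" for n x
    proof -
      have "\<bar>mol n h x\<bar> \<le> mol n (\<lambda>y. \<bar>h y\<bar>) x" using norm_S_le[OF hi] by simp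
      also have "\<dots> \<le> mol n (\<lambda>_. B) x" by (rule mol_mono) (use hi b in auto)
      finally show ?thesis by (simp add: mol_const)
    qed
    then show "AE x in Mx. norm \<bar>mol n h x - h x\<bar> \<le> 2 * B" for n
      using b by (intro AE_I2) (smt (verit) real_norm_def)
  qed auto
  then show ?thesis unfolding approximable_def by simp
qed

text \<open>A measurable function is an almost everywhere limit of continuous ones; clipping these
  at the level B permits dominated convergence.\<close>

lemma approximable_bounded:
  assumes [measurable]: "f \<in> borel_measurable borel" and b: "\<And>x. \<bar>f x\<bar> \<le> B"
  shows "approximable f"
proof (rule approximable_closure)
  show fi: "integrable Mx f" by (rule Mx.integrable_const_bound[where B=B]) (use b in auto)
  have "f measurable_on UNIV"
    by (rule lebesgue_measurable_imp_measurable_on_real) (auto intro: measurable_completion)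
  then obtain N g where N: "negligible N" and g: "\<And>j. continuous_on UNIV (g j)"
    and lim: "\<And>x. x \<notin> N \<Longrightarrow> (\<lambda>j. g j x) \<longlonglongrightarrow> f x"
    unfolding measurable_on_def by auto
  have [measurable]: "g j \<in> borel_measurable borel" for j using g by (rule borel_measurable_continuous_onI)
  define h where "h j x = max (- B) (min B (g j x))" for j x
  have hc: "continuous_on UNIV (h j)" for j unfolding h_def using g[of j] by (intro continuous_intros)
  have B0: "B \<ge> 0" using b[of undefined] by linarith
  have hb: "\<bar>h j x\<bar> \<le> B" for j x unfolding h_def using B0 by auto
  have [measurable]: "h j \<in> borel_measurable borel" for j using hc by (rule borel_measurable_continuous_onI)
  have hi: "integrable Mx (h j)" for j by (rule Mx.integrable_const_bound[where B=B]) (use hb in auto)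
  have "AE x in lebesgue. x \<notin> N"
    using N by (simp add: negligible_iff_null_sets AE_not_in)
  then have "AE x in lebesgue. (\<lambda>j. g j x) \<longlonglongrightarrow> f x" by eventually_elim (use lim in auto)
  then have "AE x in lborel. (\<lambda>j. g j x) \<longlonglongrightarrow> f x"
    by (subst (asm) AE_completion_iff) auto
  then have ae: "AE x in Mx. (\<lambda>j. g j x) \<longlonglongrightarrow> f x"
    unfolding Mx_eq by (subst AE_density) auto
  have "(\<lambda>j. LINT x|Mx. \<bar>f x - h j x\<bar>) \<longlonglongrightarrow> (LINT x|Mx. 0)"
  proof (rule integral_dominated_convergence[where w="\<lambda>_. 2 * B"])
    show "AE x in Mx. (\<lambda>j. \<bar>f x - h j x\<bar>) \<longlonglongrightarrow> 0"
      using ae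
    proof eventually_elim
      case (elim x)
      have "(\<lambda>j. h j x) \<longlonglongrightarrow> max (- B) (min B (f x))"
        unfolding h_def by (intro tendsto_intros elim)
      also have "max (- B) (min B (f x)) = f x" using b[of x] by auto
      finally have "(\<lambda>j. f x - h j x) \<longlonglongrightarrow> f x - f x" by (intro tendsto_intros)
      then show ?case using tendsto_rabs_zero by simp
    qed
    show "AE x in Mx. norm \<bar>f x - h j x\<bar> \<le> 2 * B" for j
      using b hb by (intro AE_I2) (smt (verit) real_norm_def)
  qed auto
  then have *: "(\<lambda>j. LINT x|Mx. \<bar>f x - h j x\<bar>) \<longlonglongrightarrow> 0" by simp
  fix e :: real assume "e > 0"
  from order_tendstoD(2)[OF * this] obtain j where "(LINT x|Mx. \<bar>f x - h j x\<bar>) < e"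
    using eventually_happens by fastforce
  then show "\<exists>h. integrable Mx h \<and> approximable h \<and> (LINT x|Mx. \<bar>f x - h x\<bar>) < e"
    using hi approximable_continuous[OF hc hb] by blast
qed

lemma approximable_integrable:
  assumes f: "integrable Mx f"
  shows "approximable f"
proof (rule approximable_closure[OF f])
  have [measurable]: "f \<in> borel_measurable borel" using f by auto
  define h where "h j x = max (- real j) (min (real j) (f x))" for j :: nat and x
  have hb: "\<bar>h j x\<bar> \<le> real j" for j x unfolding h_def by auto
  have [measurable]: "h j \<in> borel_measurable borel" for j unfolding h_def by auto
  have hi: "integrable Mx (h j)" for j by (rule Mx.integrable_const_bound[where B="real j"]) (use hb in auto)
  have "(\<lambda>j. LINT x|Mx. \<bar>f x - h j x\<bar>) \<longlonglongrightarrow> (LINT x|Mx. 0)"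
  proof (rule integral_dominated_convergence[where w="\<lambda>x. \<bar>f x\<bar>"])
    show "AE x in Mx. (\<lambda>j. \<bar>f x - h j x\<bar>) \<longlonglongrightarrow> 0"
    proof (rule AE_I2)
      fix x
      obtain N :: nat where N: "\<bar>f x\<bar> \<le> real N" using real_arch_simple by blast
      have "\<forall>\<^sub>F j in sequentially. \<bar>f x - h j x\<bar> = 0"
        using eventually_ge_at_top[of N] by eventually_elim (use N in \<open>auto simp: h_def\<close>)
      then show "(\<lambda>j. \<bar>f x - h j x\<bar>) \<longlonglongrightarrow> 0" by (rule tendsto_eventually)
    qed
    show "AE x in Mx. norm \<bar>f x - h j x\<bar> \<le> \<bar>f x\<bar>" for j
      by (intro AE_I2) (auto simp: h_def)
  qed (use f in auto)
  then have *: "(\<lambda>j. LINT x|Mx. \<bar>f x - h j x\<bar>) \<longlonglongrightarrow> 0" by simp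
  fix e :: real assume "e > 0"
  from order_tendstoD(2)[OF * this] obtain j where "(LINT x|Mx. \<bar>f x - h j x\<bar>) < e"
    using eventually_happens by fastforce
  moreover have "approximable (h j)" by (rule approximable_bounded[where B="real j"]) (use hb in auto)
  ultimately show "\<exists>h. integrable Mx h \<and> approximable h \<and> (LINT x|Mx. \<bar>f x - h x\<bar>) < e"
    using hi by blast
qed

lemma mol_tendsto_L1:
  fixes f :: "real \<times> real \<Rightarrow> real"
  assumes f: "integrable Mx f"
  shows "(\<lambda>n. LINT x|Mx. \<bar>mol n f x - f x\<bar>) \<longlonglongrightarrow> 0" "(\<lambda>n. LINT x|Mx. \<bar>mol n (mol n f) x - f x\<bar>) \<longlonglongrightarrow> 0"
proof -
  show 1: "(\<lambda>n. LINT x|Mx. \<bar>mol n f x - f x\<bar>) \<longlonglongrightarrow> 0"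
    using approximable_integrable[OF f] unfolding approximable_def .
  show "(\<lambda>n. LINT x|Mx. \<bar>mol n (mol n f) x - f x\<bar>) \<longlonglongrightarrow> 0"
  proof (rule Lim_null_comparison)
    show "(\<lambda>n. 2 * (LINT x|Mx. \<bar>mol n f x - f x\<bar>)) \<longlonglongrightarrow> 0"
      using tendsto_mult_right_zero[OF 1] .
    have "norm (LINT x|Mx. \<bar>mol n (mol n f) x - f x\<bar>) \<le> 2 * (LINT x|Mx. \<bar>mol n f x - f x\<bar>)" for n
    proof -
      note a = mol_integral_eq(2)[OF f, of n] mol_integral_eq(2)[OF mol_integral_eq(2)[OF f, of n], of n]
      have "(LINT x|Mx. \<bar>mol n (mol n f) x - f x\<bar>) \<le> (LINT x|Mx. \<bar>mol n (\<lambda>y. mol n f y - f y) x\<bar> + \<bar>mol n f x - f x\<bar>)"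
        using a f by (intro integral_mono) (auto simp: mol_diff)
      also have "\<dots> = (LINT x|Mx. \<bar>mol n (\<lambda>y. mol n f y - f y) x\<bar>) + (LINT x|Mx. \<bar>mol n f x - f x\<bar>)"
        using a f by (simp add: mol_diff)
      also have "\<dots> \<le> 2 * (LINT x|Mx. \<bar>mol n f x - f x\<bar>)"
        using mol_L1[of "\<lambda>y. mol n f y - f y" n] a f by simp
      finally show ?thesis by simp
    qed
    then show "\<forall>\<^sub>F n in sequentially. norm (LINT x|Mx. \<bar>mol n (mol n f) x - f x\<bar>) \<le> 2 * (LINT x|Mx. \<bar>mol n f x - f x\<bar>)"
      by simp
  qed
qed

text \<open>An L^p bound upgrades L^1 convergence to weak convergence against L^p'. Where |q| is at
  most J, the L^1 convergence acts. Where |q| exceeds J, Young's inequality with weight l separates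
  the factors: l makes the L^p part small and J the tail of q.\<close>

lemma integral_mult_tendsto_0:
  fixes u :: "nat \<Rightarrow> 'a \<Rightarrow> real" and q :: "'a \<Rightarrow> real"
  assumes p: "p > 1" and p': "1/p + 1/p' = 1"
    and u: "\<And>n. integrable M (u n)" "(\<lambda>n. LINT x|M. \<bar>u n x\<bar>) \<longlonglongrightarrow> 0"
    and up: "\<And>n. integrable M (\<lambda>x. \<bar>u n x\<bar> powr p)" "\<And>n. (LINT x|M. \<bar>u n x\<bar> powr p) \<le> C"
    and [measurable]: "q \<in> borel_measurable M" and q: "integrable M (\<lambda>x. \<bar>q x\<bar> powr p')"
  shows "(\<lambda>n. LINT x|M. q x * u n x) \<longlonglongrightarrow> 0"
proof (rule LIMSEQ_I)
  fix e :: real assume e: "e > 0"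
  have "1/p < 1" using p by simp
  then have "1/p' > 0" using p' by linarith
  then have "p' > 0" by simp
  have "1/p > 0" using p by simp
  then have "1/p' < 1" using p' by linarith
  then have p'1: "p' > 1" using \<open>p' > 0\<close> by (simp add: field_simps)
  have [measurable]: "u n \<in> borel_measurable M" for n using u(1) by auto
  have "C \<ge> 0"
  proof -
    have "0 \<le> (LINT x|M. \<bar>u 0 x\<bar> powr p)" by simp
    then show ?thesis using up(2)[of 0] by linarith
  qed
  \<comment> \<open>Solves l^p = e/(4 (C + 1)), so that l^p * C is at most e/4; the + 1 covers C =
    0.\<close>
  define l where "l = (e / (4 * (C + 1))) powr (1/p)"
  have l: "l > 0" "l powr p = e / (4 * (C + 1))"
    unfolding l_def using e \<open>C \<ge> 0\<close> p by (auto simp: powr_powr)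
  have lC: "l powr p * C \<le> e / 4"
    unfolding l(2) using e \<open>C \<ge> 0\<close> by (simp add: field_simps)
  define Q where "Q j x = (if \<bar>q x\<bar> > real j then \<bar>q x\<bar> powr p' else 0)" for j :: nat and x
  have [measurable]: "Q j \<in> borel_measurable M" for j unfolding Q_def by measurable
  have Qi: "integrable M (Q j)" for j
    by (rule Bochner_Integration.integrable_bound[OF q]) (auto simp: Q_def)
  have "(\<lambda>j. LINT x|M. Q j x) \<longlonglongrightarrow> (LINT x|M. 0)"
  proof (rule integral_dominated_convergence[OF _ _ q])
    show "AE x in M. (\<lambda>j. Q j x) \<longlonglongrightarrow> 0"
    proof (rule AE_I2)
      fix x
      obtain N :: nat where N: "\<bar>q x\<bar> \<le> real N" using real_arch_simple by blast
      have "\<forall>\<^sub>F j in sequentially. Q j x = 0"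
        using eventually_ge_at_top[of N] by eventually_elim (use N in \<open>auto simp: Q_def\<close>)
      then show "(\<lambda>j. Q j x) \<longlonglongrightarrow> 0" by (rule tendsto_eventually)
    qed
    show "AE x in M. norm (Q j x) \<le> \<bar>q x\<bar> powr p'" for j
      by (intro AE_I2) (auto simp: Q_def)
  qed auto
  then have Q0: "(\<lambda>j. LINT x|M. Q j x) \<longlonglongrightarrow> 0" by simp
  have "e / 4 * l powr p' > 0" using e l by simp
  \<comment> \<open>J is chosen after l, so the tail of q beats the large factor l^(-p').\<close>
  from order_tendstoD(2)[OF Q0 this] obtain J where J: "(LINT x|M. Q J x) < e / 4 * l powr p'"
    using eventually_happens by fastforce
  have lp': "l powr (- p') * (LINT x|M. Q J x) \<le> e / 4"
  proof -
    have "l powr (- p') * (LINT x|M. Q J x) \<le> l powr (- p') * (e / 4 * l powr p')"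
      using J by (intro mult_left_mono) auto
    also have "\<dots> = e / 4 * (l powr (-p') * l powr p')" by simp
    also have "l powr (-p') * l powr p' = 1" using l by (simp flip: powr_add)
    finally show ?thesis by simp
  qed
  have "e / (4 * (real J + 1)) > 0" using e by simp
  from order_tendstoD(2)[OF u(2) this] obtain N where N: "\<And>n. n \<ge> N \<Longrightarrow> (LINT x|M. \<bar>u n x\<bar>) < e / (4 * (real J + 1))"
    unfolding eventually_sequentially by auto
  have bound: "\<bar>q x * v\<bar> \<le> real J * \<bar>v\<bar> + l powr (- p') * Q J x + l powr p * \<bar>v\<bar> powr p" for x v
  proof (cases "\<bar>q x\<bar> > real J")
    case False
    then have "\<bar>q x * v\<bar> \<le> real J * \<bar>v\<bar>" unfolding abs_mult by (intro mult_right_mono) auto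
    then show ?thesis using False by (simp add: Q_def add_increasing2)
  next
    case True
    have "\<bar>q x * v\<bar> = (l * \<bar>v\<bar>) * (\<bar>q x\<bar> / l)" using l by (simp add: abs_mult)
    also have "\<dots> \<le> (l * \<bar>v\<bar>) powr p / p + (\<bar>q x\<bar> / l) powr p' / p'"
      by (rule Youngs_inequality) (use p p'1 p' l in auto)
    also have "\<dots> \<le> (l * \<bar>v\<bar>) powr p + (\<bar>q x\<bar> / l) powr p'"
      using p p'1 by (intro add_mono) (auto simp: divide_le_eq mult_le_cancel_left1 powr_ge_zero intro!: order_trans[OF _ mult_left_mono[of 1]])
    also have "(l * \<bar>v\<bar>) powr p = l powr p * \<bar>v\<bar> powr p" using l by (simp add: powr_mult)
    also have "(\<bar>q x\<bar> / l) powr p' = l powr (- p') * \<bar>q x\<bar> powr p'"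
      using l by (simp add: powr_divide powr_minus_divide)
    finally have a: "\<bar>q x * v\<bar> \<le> l powr p * \<bar>v\<bar> powr p + l powr (- p') * \<bar>q x\<bar> powr p'" .
    have b: "0 \<le> real J * \<bar>v\<bar>" by simp
    have c: "Q J x = \<bar>q x\<bar> powr p'" using True by (simp add: Q_def)
    show ?thesis unfolding c using a b by linarith
  qed
  have "norm ((LINT x|M. q x * u n x) - 0) < e" if n: "n \<ge> N" for n
  proof -
    let ?b = "\<lambda>x. real J * \<bar>u n x\<bar> + l powr (- p') * Q J x + l powr p * \<bar>u n x\<bar> powr p"
    have bi: "integrable M ?b" using u(1) up(1) Qi by auto
    have "norm (LINT x|M. q x * u n x) \<le> (LINT x|M. \<bar>q x * u n x\<bar>)"
      using integral_norm_bound[of M "\<lambda>x. q x * u n x"] by simp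
    also have "\<dots> \<le> (LINT x|M. ?b x)"
      by (rule integral_mono'[OF bi]) (auto intro: bound order_trans[OF abs_ge_zero bound])
    also have "\<dots> = real J * (LINT x|M. \<bar>u n x\<bar>) + l powr (- p') * (LINT x|M. Q J x) + l powr p * (LINT x|M. \<bar>u n x\<bar> powr p)"
      using u(1) up(1) Qi by simp
    also have "\<dots> \<le> e / 4 + e / 4 + e / 4"
    proof (intro add_mono lp')
      have "real J * (LINT x|M. \<bar>u n x\<bar>) \<le> (real J + 1) * (e / (4 * (real J + 1)))"
        using N[OF n] by (intro mult_mono) auto
      also have "\<dots> = e / 4" by (simp add: field_simps)
      finally show "real J * (LINT x|M. \<bar>u n x\<bar>) \<le> e / 4" .
      have "l powr p * (LINT x|M. \<bar>u n x\<bar> powr p) \<le> l powr p * C"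
        by (intro mult_left_mono up) auto
      then show "l powr p * (LINT x|M. \<bar>u n x\<bar> powr p) \<le> e / 4" using lC by linarith
    qed
    finally show ?thesis using e by simp
  qed
  then show "\<exists>N. \<forall>n\<ge>N. norm ((LINT x|M. q x * u n x) - 0) < e" by blast
qed

lemma powr_add_le:
  fixes a b p :: real assumes "p > 0"
  shows "\<bar>a - b\<bar> powr p \<le> 2 powr p * (\<bar>a\<bar> powr p + \<bar>b\<bar> powr p)"
proof -
  define m where "m = max \<bar>a\<bar> \<bar>b\<bar>"
  have "\<bar>a - b\<bar> \<le> 2 * m" unfolding m_def by linarith
  then have "\<bar>a - b\<bar> powr p \<le> (2 * m) powr p" using assms by (intro powr_mono2) auto
  also have "\<dots> = 2 powr p * m powr p" unfolding m_def by (simp add: powr_mult)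
  also have "m powr p \<le> \<bar>a\<bar> powr p + \<bar>b\<bar> powr p" unfolding m_def by (auto simp: max_def)
  finally show ?thesis by simp
qed

text \<open>The double mollification is the form in which the diffusive flux enters the energy
  balance: one mollification stems from the kernel used as test function, the other from the
  mollified solution that multiplies the equation.\<close>

lemma mol_weak_tendsto:
  fixes f q :: "real \<times> real \<Rightarrow> real"
  assumes p: "p > 1" and p': "1/p + 1/p' = 1"
    and [measurable]: "f \<in> borel_measurable borel" and f: "integrable Mx (\<lambda>x. \<bar>f x\<bar> powr p)"
    and [measurable]: "q \<in> borel_measurable borel" and q: "integrable Mx (\<lambda>x. \<bar>q x\<bar> powr p')"
  shows "(\<lambda>n. LINT x|Mx. q x * (mol n f x - f x)) \<longlonglongrightarrow> 0"
    "(\<lambda>n. LINT x|Mx. q x * (mol n (mol n f) x - f x)) \<longlonglongrightarrow> 0"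
proof -
  have fi: "integrable Mx f"
    by (rule integrable_of_powr[where p=p]) (use f p in \<open>auto intro: Mx.finite_measure_axioms\<close>)
  note s1 = mol_powr_integral[OF _ f p] and si = mol_integral_eq(2)[OF fi]
  have s2i: "integrable Mx (\<lambda>x. \<bar>mol n (mol n f) x\<bar> powr p)"
    and s2: "(LINT x|Mx. \<bar>mol n (mol n f) x\<bar> powr p) \<le> (LINT x|Mx. \<bar>f x\<bar> powr p)" for n
    using mol_powr_integral[of "mol n f" p n] s1[of n] p by auto
  have gen: "integrable Mx (\<lambda>x. \<bar>h x - f x\<bar> powr p) \<and>
      (LINT x|Mx. \<bar>h x - f x\<bar> powr p) \<le> 2 powr p * (2 * (LINT x|Mx. \<bar>f x\<bar> powr p))"
    if [measurable]: "h \<in> borel_measurable borel" and hi: "integrable Mx (\<lambda>x. \<bar>h x\<bar> powr p)"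
      "(LINT x|Mx. \<bar>h x\<bar> powr p) \<le> (LINT x|Mx. \<bar>f x\<bar> powr p)" for h
  proof
    have b: "integrable Mx (\<lambda>x. 2 powr p * (\<bar>h x\<bar> powr p + \<bar>f x\<bar> powr p))" using f hi by auto
    show i: "integrable Mx (\<lambda>x. \<bar>h x - f x\<bar> powr p)"
      by (rule Bochner_Integration.integrable_bound[OF b]) (use p powr_add_le[of p] in auto)
    have "(LINT x|Mx. \<bar>h x - f x\<bar> powr p) \<le> (LINT x|Mx. 2 powr p * (\<bar>h x\<bar> powr p + \<bar>f x\<bar> powr p))"
      by (rule integral_mono[OF i b]) (use p powr_add_le[of p] in auto)
    also have "\<dots> = 2 powr p * ((LINT x|Mx. \<bar>h x\<bar> powr p) + (LINT x|Mx. \<bar>f x\<bar> powr p))"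
      using f hi by simp
    also have "\<dots> \<le> 2 powr p * (2 * (LINT x|Mx. \<bar>f x\<bar> powr p))"
      by (intro mult_left_mono) (use hi in auto)
    finally show "(LINT x|Mx. \<bar>h x - f x\<bar> powr p) \<le> 2 powr p * (2 * (LINT x|Mx. \<bar>f x\<bar> powr p))" .
  qed
  have g1: "integrable Mx (\<lambda>x. \<bar>mol n f x - f x\<bar> powr p)"
    "(LINT x|Mx. \<bar>mol n f x - f x\<bar> powr p) \<le> 2 powr p * (2 * (LINT x|Mx. \<bar>f x\<bar> powr p))" for n
    using gen[of "mol n f"] s1[of n] by auto
  have g2: "integrable Mx (\<lambda>x. \<bar>mol n (mol n f) x - f x\<bar> powr p)"
    "(LINT x|Mx. \<bar>mol n (mol n f) x - f x\<bar> powr p) \<le> 2 powr p * (2 * (LINT x|Mx. \<bar>f x\<bar> powr p))" for n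
    using gen[of "mol n (mol n f)"] s2i[of n] s2[of n] by auto
  show "(\<lambda>n. LINT x|Mx. q x * (mol n f x - f x)) \<longlonglongrightarrow> 0"
    by (rule integral_mult_tendsto_0[OF p p' Bochner_Integration.integrable_diff[OF si fi] mol_tendsto_L1(1)[OF fi] g1 _ q]) simp
  show "(\<lambda>n. LINT x|Mx. q x * (mol n (mol n f) x - f x)) \<longlonglongrightarrow> 0"
    by (rule integral_mult_tendsto_0[OF p p' Bochner_Integration.integrable_diff[OF mol_integral_eq(2)[OF si] fi]
        mol_tendsto_L1(2)[OF fi] g2 _ q]) simp
qed

lemma integrable_mult_of_squares:
  fixes f g :: "'a \<Rightarrow> real"
  assumes [measurable]: "f \<in> borel_measurable M" "g \<in> borel_measurable M"
    and f: "integrable M (\<lambda>x. (f x)\<^sup>2)" and g: "integrable M (\<lambda>x. (g x)\<^sup>2)"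
  shows "integrable M (\<lambda>x. f x * g x)"
proof (rule Bochner_Integration.integrable_bound)
  show "integrable M (\<lambda>x. (f x)\<^sup>2 + (g x)\<^sup>2)" using f g by auto
  have "\<bar>a * b\<bar> \<le> a\<^sup>2 + b\<^sup>2" for a b :: real
  proof -
    have "0 \<le> \<bar>a\<bar> * \<bar>b\<bar>" by simp
    moreover have "2 * \<bar>a\<bar> * \<bar>b\<bar> \<le> a\<^sup>2 + b\<^sup>2" using sum_squares_bound[of "\<bar>a\<bar>" "\<bar>b\<bar>"] by simp
    ultimately show ?thesis unfolding abs_mult by linarith
  qed
  then show "AE x in M. norm (f x * g x) \<le> norm ((f x)\<^sup>2 + (g x)\<^sup>2)" by simp
qed auto

text \<open>Expand the square. The squared norm of \<open>mol n f\<close> is, by self-adjointness,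
  the pairing of f with its double mollification, so it and the cross term both converge by
  \<open>mol_weak_tendsto\<close> with p = 2 and q = f.\<close>

lemma mol_L2_tendsto:
  fixes f :: "real \<times> real \<Rightarrow> real"
  assumes [measurable]: "f \<in> borel_measurable borel" and f: "integrable Mx (\<lambda>x. (f x)\<^sup>2)"
  shows "(\<lambda>n. LINT x|Mx. (mol n f x - f x)\<^sup>2) \<longlonglongrightarrow> 0"
    "(\<lambda>n. LINT x|Mx. (mol n f x)\<^sup>2) \<longlonglongrightarrow> (LINT x|Mx. (f x)\<^sup>2)"
proof -
  have f2: "integrable Mx (\<lambda>x. \<bar>f x\<bar> powr 2)" using f by simp
  have fi: "integrable Mx f"
    by (rule integrable_of_square) (use f in \<open>auto intro: Mx.finite_measure_axioms\<close>)
  note w = mol_weak_tendsto[of 2 2, OF _ _ _ f2 _ f2, simplified]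
  have sq: "integrable Mx (\<lambda>x. (mol n f x)\<^sup>2)" for n
    using mol_square_integral(1)[of f n] f by simp
  have p1: "integrable Mx (\<lambda>x. f x * mol n f x)" for n by (rule integrable_mult_of_squares) (use f sq in auto)
  have ss: "(LINT x|Mx. f x * mol n (mol n f) x) = (LINT x|Mx. (mol n f x)\<^sup>2)" "integrable Mx (\<lambda>x. f x * mol n (mol n f) x)" for n
    using mol_integral[OF mol_integral_eq(2)[OF fi, of n] fi, of n] by (auto simp: power2_eq_square)
  have e1: "(LINT x|Mx. f x * (mol n f x - f x)) = (LINT x|Mx. f x * mol n f x) - (LINT x|Mx. (f x)\<^sup>2)" for n
    using p1 f by (simp add: right_diff_distrib power2_eq_square)
  have e2: "(LINT x|Mx. f x * (mol n (mol n f) x - f x)) = (LINT x|Mx. (mol n f x)\<^sup>2) - (LINT x|Mx. (f x)\<^sup>2)" for n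
    using ss f by (simp add: right_diff_distrib power2_eq_square)
  have l2: "(\<lambda>n. (LINT x|Mx. (mol n f x)\<^sup>2) - (LINT x|Mx. (f x)\<^sup>2)) \<longlonglongrightarrow> 0" using w(2) unfolding e2 .
  then show "(\<lambda>n. LINT x|Mx. (mol n f x)\<^sup>2) \<longlonglongrightarrow> (LINT x|Mx. (f x)\<^sup>2)" by (rule LIM_zero_cancel)
  have l1: "(\<lambda>n. (LINT x|Mx. f x * mol n f x) - (LINT x|Mx. (f x)\<^sup>2)) \<longlonglongrightarrow> 0" using w(1) unfolding e1 .
  have "(LINT x|Mx. (mol n f x - f x)\<^sup>2) = ((LINT x|Mx. (mol n f x)\<^sup>2) - (LINT x|Mx. (f x)\<^sup>2))
      - 2 * ((LINT x|Mx. f x * mol n f x) - (LINT x|Mx. (f x)\<^sup>2))" for n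
  proof -
    have "(LINT x|Mx. (mol n f x - f x)\<^sup>2) = (LINT x|Mx. (mol n f x)\<^sup>2 + (f x)\<^sup>2 - 2 * (f x * mol n f x))"
      by (simp add: power2_diff mult_ac)
    also have "\<dots> = (LINT x|Mx. (mol n f x)\<^sup>2) + (LINT x|Mx. (f x)\<^sup>2) - 2 * (LINT x|Mx. f x * mol n f x)"
      using sq[of n] p1[of n] f by simp
    finally show ?thesis by simp
  qed
  then show "(\<lambda>n. LINT x|Mx. (mol n f x - f x)\<^sup>2) \<longlonglongrightarrow> 0"
    using tendsto_diff[OF l2 tendsto_mult_left[OF l1, of 2]] by simp
qed

section \<open>Increments of functions of one variable, controlled by the derivative in L2\<close>

lemma integral_derivative_square_bound:
  fixes \<phi> \<phi>' :: "real \<Rightarrow> real"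
  assumes d: "\<And>s. (\<phi> has_field_derivative \<phi>' s) (at s)" and c: "continuous_on UNIV \<phi>'"
    and st: "0 \<le> s" "s \<le> t" "t \<le> 1"
  shows "(\<phi> t - \<phi> s)\<^sup>2 \<le> (t - s) * (LINT w|ivl 1. (\<phi>' w)\<^sup>2)"
proof (cases "s = t")
  case False
  then have L: "t - s > 0" using st by simp
  \<comment> \<open>The mean slope. Cauchy-Schwarz is obtained by integrating (\<phi>' - J)^2 over
    [s, t].\<close>
  define J where "J = (\<phi> t - \<phi> s) / (t - s)"
  have hi: "(\<phi>' has_integral (\<phi> t - \<phi> s)) {s..t}"
    by (rule fundamental_theorem_of_calculus) (use d st in \<open>auto simp flip: has_real_derivative_iff_has_vector_derivative intro: has_field_derivative_at_within\<close>)
  have cc: "continuous_on A \<phi>'" for A using c continuous_on_subset by blast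
  have i2: "(\<lambda>w. (\<phi>' w)\<^sup>2) integrable_on {a..b}" for a b by (intro integrable_continuous_interval continuous_intros cc)
  have sq: "((\<lambda>w. (\<phi>' w)\<^sup>2) has_integral integral {s..t} (\<lambda>w. (\<phi>' w)\<^sup>2)) {s..t}" using i2 by blast
  have "((\<lambda>w. (\<phi>' w)\<^sup>2 - 2 * J * \<phi>' w + J\<^sup>2) has_integral
      (integral {s..t} (\<lambda>w. (\<phi>' w)\<^sup>2) - 2 * J * (\<phi> t - \<phi> s) + (t - s) *\<^sub>R J\<^sup>2)) {s..t}"
    by (intro has_integral_add has_integral_diff sq has_integral_mult_right hi)
      (use has_integral_const_real[of "J\<^sup>2" s t] st in simp)
  moreover have "0 \<le> (\<phi>' w)\<^sup>2 - 2 * J * \<phi>' w + J\<^sup>2" for w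
    using zero_le_power2[of "\<phi>' w - J"] by (simp add: power2_diff algebra_simps)
  ultimately have "0 \<le> integral {s..t} (\<lambda>w. (\<phi>' w)\<^sup>2) - 2 * J * (\<phi> t - \<phi> s) + (t - s) *\<^sub>R J\<^sup>2"
    using has_integral_nonneg by blast
  moreover have "J * (t - s) = \<phi> t - \<phi> s" unfolding J_def using L by simp
  then have "(t - s) *\<^sub>R J\<^sup>2 = J * (\<phi> t - \<phi> s)" by (simp add: power2_eq_square mult_ac)
  ultimately have "J * (\<phi> t - \<phi> s) \<le> integral {s..t} (\<lambda>w. (\<phi>' w)\<^sup>2)" by linarith
  also have "\<dots> \<le> integral {0..1} (\<lambda>w. (\<phi>' w)\<^sup>2)"
    by (intro integral_subset_le i2) (use st in auto)
  also have "\<dots> = (LINT w|ivl 1. (\<phi>' w)\<^sup>2)"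
    by (rule ivl_continuous(2)[symmetric]) (intro borel_measurable_continuous_onI continuous_intros cc)+
  finally show ?thesis unfolding J_def using L by (simp add: field_simps power2_eq_square)
qed simp

lemma derivative_square_bound:
  fixes \<phi> \<phi>' :: "real \<Rightarrow> real"
  assumes d: "\<And>s. (\<phi> has_field_derivative \<phi>' s) (at s)" and c: "continuous_on UNIV \<phi>'"
    and st: "0 \<le> s" "s \<le> 1" "0 \<le> t" "t \<le> 1"
  shows "(\<phi> s - \<phi> t)\<^sup>2 \<le> \<bar>s - t\<bar> * (LINT w|ivl 1. (\<phi>' w)\<^sup>2)"
  using integral_derivative_square_bound[OF d c, of s t] integral_derivative_square_bound[OF d c, of t s] st
  by (cases "s \<le> t") (auto simp: power2_commute)

text \<open>The shorter arc between s and t may pass through 0 = 1. Splitting the increment there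
  doubles the constant, which the factor 2 in \<open>abs_sin_ge_min\<close> compensates.\<close>

lemma periodic_square_bound:
  fixes \<phi> \<phi>' :: "real \<Rightarrow> real"
  assumes d: "\<And>s. (\<phi> has_field_derivative \<phi>' s) (at s)" and c: "continuous_on UNIV \<phi>'"
    and per: "\<phi> 0 = \<phi> 1"
    and st: "0 \<le> s" "s \<le> 1" "0 \<le> t" "t \<le> 1" and r: "\<bar>sin (pi * (s - t))\<bar> \<le> r"
  shows "(\<phi> s - \<phi> t)\<^sup>2 \<le> r * (LINT w|ivl 1. (\<phi>' w)\<^sup>2)"
proof -
  define I where "I = (LINT w|ivl 1. (\<phi>' w)\<^sup>2)"
  have I0: "I \<ge> 0" unfolding I_def by simp
  have r0: "r \<ge> 0" using r by linarith
  have m: "2 * min \<bar>s - t\<bar> (1 - \<bar>s - t\<bar>) \<le> r"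
  proof -
    have "\<bar>s - t\<bar> \<le> 1" using st by linarith
    from abs_sin_ge_min[OF this] r show ?thesis by linarith
  qed
  show ?thesis
  proof (cases "\<bar>s - t\<bar> \<le> 1 - \<bar>s - t\<bar>")
    case True
    then have "\<bar>s - t\<bar> * I \<le> r * I" using m r0 by (intro mult_right_mono I0) auto
    then show ?thesis using derivative_square_bound[OF d c st] unfolding I_def by linarith
  next
    case False
    have wrap: "(\<phi> a - \<phi> b)\<^sup>2 \<le> r * I" if ab: "0 \<le> a" "a \<le> b" "b \<le> 1" "2 * (a + (1 - b)) \<le> r" for a b
    proof -
      have "(\<phi> a - \<phi> b)\<^sup>2 = ((\<phi> a - \<phi> 0) + (\<phi> 1 - \<phi> b))\<^sup>2" using per by simp
      also have "\<dots> \<le> 2 * (\<phi> a - \<phi> 0)\<^sup>2 + 2 * (\<phi> 1 - \<phi> b)\<^sup>2"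
        using sum_squares_bound[of "\<phi> a - \<phi> 0" "\<phi> 1 - \<phi> b"] by (simp add: power2_sum)
      also have "\<dots> \<le> 2 * (\<bar>a - 0\<bar> * I) + 2 * (\<bar>1 - b\<bar> * I)"
        unfolding I_def by (intro add_mono mult_left_mono derivative_square_bound[OF d c]) (use ab in auto)
      also have "\<dots> = 2 * (a + (1 - b)) * I" using ab by (simp add: algebra_simps)
      also have "\<dots> \<le> r * I" by (intro mult_right_mono ab I0)
      finally show ?thesis .
    qed
    show ?thesis
      using wrap[of s t] wrap[of t s] False m st unfolding I_def
      by (cases "s \<le> t") (auto simp: power2_commute)
  qed
qed

section \<open>Weak gradients\<close>

lemma Mx_integral_continuous:
  fixes f :: "real \<times> real \<Rightarrow> real"
  assumes c: "continuous_on UNIV f"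
  shows "integrable Mx f" "(LINT x|Mx. f x) = (LINT a|ivl 1. LINT b|ivl 1. f (a, b))"
    "(LINT x|Mx. f x) = (LINT b|ivl 1. LINT a|ivl 1. f (a, b))"
proof -
  have [measurable]: "f \<in> borel_measurable borel" using c by (rule borel_measurable_continuous_onI)
  have "compact cell" unfolding cell_def by (intro compact_Times) auto
  moreover have "continuous_on cell f" using c by (rule continuous_on_subset) auto
  ultimately have "bounded (f ` cell)"
    using compact_continuous_image compact_imp_bounded by blast
  then obtain B where B: "\<And>x. x \<in> cell \<Longrightarrow> \<bar>f x\<bar> \<le> B"
    unfolding bounded_iff by auto
  show i: "integrable Mx f"
    by (rule Mx.integrable_const_bound[where B=B])
      (use AE_Mx_cell B in \<open>auto elim: eventually_mono\<close>)
  then have i': "integrable (ivl 1 \<Otimes>\<^sub>M ivl 1) (case_prod (\<lambda>a b. f (a, b)))" unfolding Mx_def by simp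
  show "(LINT x|Mx. f x) = (LINT a|ivl 1. LINT b|ivl 1. f (a, b))"
    using ivlp.integral_fst[OF i'] unfolding Mx_def by simp
  then show "(LINT x|Mx. f x) = (LINT b|ivl 1. LINT a|ivl 1. f (a, b))"
    using ivlp.Fubini_integral[OF i'] by simp
qed

lemma Mx_partial_integral:
  fixes H :: "real \<times> real \<Rightarrow> real"
  assumes H: "continuous_on UNIV H"
  shows "integrable Mx (\<lambda>x. LINT w|ivl 1. H (fst x, w))" "(LINT x|Mx. LINT w|ivl 1. H (fst x, w)) = (LINT x|Mx. H x)"
    "integrable Mx (\<lambda>x. LINT w|ivl 1. H (w, snd x))" "(LINT x|Mx. LINT w|ivl 1. H (w, snd x)) = (LINT x|Mx. H x)"
proof -
  have [measurable]: "H \<in> borel_measurable borel" using H by (rule borel_measurable_continuous_onI)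
  have i: "integrable (ivl 1 \<Otimes>\<^sub>M ivl 1) (case_prod (\<lambda>a b. H (a, b)))"
    using Mx_integral_continuous(1)[OF H] unfolding Mx_def by simp
  have m1: "measure (ivl 1) UNIV = 1" by (simp add: measure_ivl_UNIV)
  define I where "I a = (LINT w|ivl 1. H (a, w))" for a
  define J where "J b = (LINT w|ivl 1. H (w, b))" for b
  have I: "integrable (ivl 1) I" and J: "integrable (ivl 1) J"
    unfolding I_def J_def using ivlp.integrable_fst[OF i] ivlp.integrable_snd[OF i] by auto
  have [measurable]: "I \<in> borel_measurable borel" "J \<in> borel_measurable borel" using I J by auto
  have Ii: "integrable (ivl 1 \<Otimes>\<^sub>M ivl 1) (\<lambda>x. I (fst x))"
  proof (rule ivlp.Fubini_integrable)
    show "integrable (ivl 1) (\<lambda>x. LINT y|ivl 1. norm (I (fst (x, y))))" using I m1 by simp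
    show "AE x in ivl 1. integrable (ivl 1) (\<lambda>y. I (fst (x, y)))" by simp
  qed measurable
  have Ji: "integrable (ivl 1 \<Otimes>\<^sub>M ivl 1) (\<lambda>x. J (snd x))"
  proof (rule ivlp.Fubini_integrable)
    show "integrable (ivl 1) (\<lambda>x. LINT y|ivl 1. norm (J (snd (x, y))))" by simp
    show "AE x in ivl 1. integrable (ivl 1) (\<lambda>y. J (snd (x, y)))" using J by simp
  qed measurable
  show "integrable Mx (\<lambda>x. LINT w|ivl 1. H (fst x, w))" "integrable Mx (\<lambda>x. LINT w|ivl 1. H (w, snd x))"
    using Ii Ji unfolding Mx_def I_def J_def .
  have "(LINT x|Mx. I (fst x)) = (LINT x|Mx. H x)"
    using ivlp.integral_fst'[OF Ii] m1 unfolding Mx_integral_continuous(2)[OF H] unfolding Mx_def I_def by simp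
  then show "(LINT x|Mx. LINT w|ivl 1. H (fst x, w)) = (LINT x|Mx. H x)" unfolding I_def .
  have "(LINT x|Mx. J (snd x)) = (LINT x|Mx. H x)"
    using ivlp.integral_fst'[OF Ji] m1 unfolding Mx_integral_continuous(3)[OF H] unfolding Mx_def J_def by simp
  then show "(LINT x|Mx. LINT w|ivl 1. H (w, snd x)) = (LINT x|Mx. H x)" unfolding J_def .
qed

lemma LINT_derivative_periodic:
  fixes \<phi> \<phi>' :: "real \<Rightarrow> real"
  assumes d: "\<And>s. (\<phi> has_field_derivative \<phi>' s) (at s)" and c: "continuous_on UNIV \<phi>'"
    and per: "\<phi> 0 = \<phi> 1"
  shows "(LINT w|ivl 1. \<phi>' w) = 0"
proof -
  have "(\<phi>' has_integral (\<phi> 1 - \<phi> 0)) {0..1}"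
    by (rule fundamental_theorem_of_calculus) (use d in \<open>auto simp flip: has_real_derivative_iff_has_vector_derivative intro: has_field_derivative_at_within\<close>)
  moreover have "(LINT w|ivl 1. \<phi>' w) = integral {0..1} \<phi>'"
    by (rule ivl_continuous(2)) (use c in \<open>auto intro: borel_measurable_continuous_onI continuous_on_subset\<close>)
  ultimately show ?thesis using per by (simp add: integral_unique)
qed

text \<open>Continuous partial derivatives together with equal values on opposite sides of the cell:
  what makes the integrals of both partial derivatives vanish. The class is closed under products,
  which yields integration by parts.\<close>

definition periodic_C1 :: "(real \<times> real \<Rightarrow> real) \<Rightarrow> (real \<times> real \<Rightarrow> real) \<Rightarrow> (real \<times> real \<Rightarrow> real) \<Rightarrow> bool" where
  "periodic_C1 F F1 F2 \<longleftrightarrow>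
     (\<forall>a b. ((\<lambda>s. F (s, b)) has_field_derivative F1 (a, b)) (at a)) \<and>
     (\<forall>a b. ((\<lambda>s. F (a, s)) has_field_derivative F2 (a, b)) (at b)) \<and>
     continuous_on UNIV F \<and> continuous_on UNIV F1 \<and> continuous_on UNIV F2 \<and>
     (\<forall>b. F (0, b) = F (1, b)) \<and> (\<forall>a. F (a, 0) = F (a, 1))"

lemma continuous_on_Pair1: "continuous_on UNIV F \<Longrightarrow> continuous_on UNIV (\<lambda>s::real. F (s, b::real))"
  and continuous_on_Pair2: "continuous_on UNIV F \<Longrightarrow> continuous_on UNIV (\<lambda>s::real. F (a::real, s))"
  by (auto intro!: continuous_on_compose2[of UNIV F] continuous_intros)

lemma periodic_C1_integral_derivative:
  assumes "periodic_C1 F F1 F2"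
  shows "(LINT x|Mx. F1 x) = 0" "(LINT x|Mx. F2 x) = 0"
proof -
  note a = assms[unfolded periodic_C1_def]
  have "(LINT s|ivl 1. F1 (s, b)) = 0" for b
    by (rule LINT_derivative_periodic[of "\<lambda>s. F (s, b)"]) (use a in \<open>auto intro: continuous_on_Pair1\<close>)
  then show "(LINT x|Mx. F1 x) = 0"
    using Mx_integral_continuous(3)[of F1] a by simp
  have "(LINT s|ivl 1. F2 (b, s)) = 0" for b
    by (rule LINT_derivative_periodic[of "\<lambda>s. F (b, s)"]) (use a in \<open>auto intro: continuous_on_Pair2\<close>)
  then show "(LINT x|Mx. F2 x) = 0"
    using Mx_integral_continuous(2)[of F2] a by simp
qed

lemma periodic_C1_mult:
  assumes "periodic_C1 F F1 F2" "periodic_C1 G G1 G2"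
  shows "periodic_C1 (\<lambda>x. F x * G x) (\<lambda>x. F1 x * G x + G1 x * F x) (\<lambda>x. F2 x * G x + G2 x * F x)"
  using assms unfolding periodic_C1_def by (auto intro!: DERIV_mult continuous_intros)

lemma mol_periodic_C1:
  assumes f: "integrable Mx f"
  shows "periodic_C1 (mol n f) (\<lambda>x. fst (mol_grad n f x)) (\<lambda>x. snd (mol_grad n f x))"
proof -
  have "mol n f (0, b) = mol n f (1, b)" "mol n f (b, 0) = mol n f (b, 1)" for b
    using mol_periodic(1)[of n f 0 1 b 0] mol_periodic(1)[of n f b 0 0 1] by auto
  then show ?thesis
    unfolding periodic_C1_def using mol_DERIV1[OF f] mol_DERIV2[OF f] mol_continuous[OF f] mol_grad_continuous[OF f, of n]
    by (auto intro!: continuous_intros)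
qed

lemma ker2_periodic_C1: "periodic_C1 (\<lambda>y. ker2 n (x - y)) (\<lambda>y. - fst (ker2_grad n (x - y))) (\<lambda>y. - snd (ker2_grad n (x - y)))"
proof -
  have "ker n (a - 1) = ker n a" for a using ker_periodic(1)[of n a "-1"] by simp
  then show ?thesis
    unfolding periodic_C1_def ker2_def ker2_grad_def
    by (auto intro!: continuous_intros derivative_eq_intros DERIV_chain2[OF DERIV_ker])
qed

text \<open>Integration by parts against the kernel: the product of F with
  \<open>ker2 n (x - y)\<close> as a function of y is again in the class, so its partial derivatives
  integrate to zero.\<close>

lemma mol_grad_periodic_C1:
  assumes F: "periodic_C1 F F1 F2"
  shows "mol_grad n F x = mol n (\<lambda>y. (F1 y, F2 y)) x"
proof -
  note c = F[unfolded periodic_C1_def]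
  have Fi: "integrable Mx F" "integrable Mx F1" "integrable Mx F2"
    using Mx_integral_continuous(1) c by auto
  have Gi: "integrable Mx (\<lambda>y. (F1 y, F2 y))"
  proof -
    have "integrable Mx (\<lambda>y. F1 y *\<^sub>R (1::real, 0::real) + F2 y *\<^sub>R (0, 1))"
      by (intro Bochner_Integration.integrable_add integrable_scaleR_left Fi)
    then show ?thesis by simp
  qed
  note m = periodic_C1_integral_derivative[OF periodic_C1_mult[OF F ker2_periodic_C1[of n x]]]
  have i: "integrable Mx (\<lambda>y. F y * fst (ker2_grad n (x - y)))" "integrable Mx (\<lambda>y. F y * snd (ker2_grad n (x - y)))"
    "integrable Mx (\<lambda>y. ker2 n (x - y) * F1 y)" "integrable Mx (\<lambda>y. ker2 n (x - y) * F2 y)"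
    using c by (auto intro!: Mx_integral_continuous(1) continuous_intros)
  have "(LINT y|Mx. ker2 n (x - y) * F1 y) - (LINT y|Mx. F y * fst (ker2_grad n (x - y))) = 0"
    using m(1) i by (simp flip: Bochner_Integration.integral_diff add: mult_ac)
  moreover have "(LINT y|Mx. ker2 n (x - y) * F2 y) - (LINT y|Mx. F y * snd (ker2_grad n (x - y))) = 0"
    using m(2) i by (simp flip: Bochner_Integration.integral_diff add: mult_ac)
  moreover have "fst (mol n (\<lambda>y. (F1 y, F2 y)) x) = (LINT y|Mx. ker2 n (x - y) * F1 y)"
    "snd (mol n (\<lambda>y. (F1 y, F2 y)) x) = (LINT y|Mx. ker2 n (x - y) * F2 y)"
    unfolding mol_def
    using integral_bounded_linear[OF bounded_linear_fst mol_integrable[OF Gi, of n x]]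
      integral_bounded_linear[OF bounded_linear_snd mol_integrable[OF Gi, of n x]] by auto
  ultimately show ?thesis
    using mol_grad_fst_snd[OF Fi(1), of n x] by (intro prod_eqI) auto
qed

text \<open>The path from x = (a, b) to y = (a', b') turns at (a', b). Its horizontal leg is charged
  to the row of x and its vertical leg to the column of y, so each bound depends on one of the two
  points only; averaging with the kernel and integrating then reproduces the gradient
  energy.\<close>

lemma periodic_C1_smoothing:
  assumes F: "periodic_C1 F F1 F2"
  shows "(LINT x|Mx. (F x - mol r F x)\<^sup>2) \<le> 2 / (real r + 1) * (LINT x|Mx. (F1 x)\<^sup>2 + (F2 x)\<^sup>2)"
proof -
  define \<rho> where "\<rho> = 1 / (real r + 1)"
  note c = F[unfolded periodic_C1_def]
  have Fc[continuous_intros]: "continuous_on UNIV F" "continuous_on UNIV F1" "continuous_on UNIV F2" using c by auto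
  have Fi: "integrable Mx F" using Mx_integral_continuous(1) Fc by auto
  have [measurable]: "F \<in> borel_measurable borel" using Fc by (intro borel_measurable_continuous_onI)
  define I1 where "I1 b = (LINT w|ivl 1. (F1 (w, b))\<^sup>2)" for b
  define I2 where "I2 a = (LINT w|ivl 1. (F2 (a, w))\<^sup>2)" for a
  have sqi: "integrable Mx (\<lambda>x. (F1 x)\<^sup>2)" "integrable Mx (\<lambda>x. (F2 x)\<^sup>2)"
    by (intro Mx_integral_continuous(1) continuous_intros)+
  have J1: "integrable Mx (\<lambda>x. I1 (snd x))" "(LINT x|Mx. I1 (snd x)) = (LINT x|Mx. (F1 x)\<^sup>2)"
    unfolding I1_def by (intro Mx_partial_integral[of "\<lambda>x. (F1 x)\<^sup>2"] continuous_intros)+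
  have J2: "integrable Mx (\<lambda>x. I2 (fst x))" "(LINT x|Mx. I2 (fst x)) = (LINT x|Mx. (F2 x)\<^sup>2)"
    unfolding I2_def by (intro Mx_partial_integral[of "\<lambda>x. (F2 x)\<^sup>2"] continuous_intros)+
  have pt: "(F x - F y)\<^sup>2 \<le> 2 * \<rho> * I1 (snd x) + 2 * \<rho> * I2 (fst y)"
    if x: "x \<in> cell" and y: "y \<in> cell" and ker2: "ker2 r (x - y) \<noteq> 0" for x y
  proof -
    obtain a b where xy: "x = (a, b)" by (cases x)
    obtain a' b' where yy: "y = (a', b')" by (cases y)
    have "(F (a, b) - F (a', b))\<^sup>2 \<le> \<rho> * I1 b"
      unfolding I1_def
      by (rule periodic_square_bound[of "\<lambda>s. F (s, b)"])
        (use c x y ker2_supp(1)[OF ker2] in \<open>auto simp: xy yy cell_def \<rho>_def intro: continuous_on_Pair1\<close>)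
    moreover have "(F (a', b) - F (a', b'))\<^sup>2 \<le> \<rho> * I2 a'"
      unfolding I2_def
      by (rule periodic_square_bound[of "\<lambda>s. F (a', s)"])
        (use c x y ker2_supp(2)[OF ker2] in \<open>auto simp: xy yy cell_def \<rho>_def intro: continuous_on_Pair2\<close>)
    moreover have "(F x - F y)\<^sup>2 \<le> 2 * (F (a, b) - F (a', b))\<^sup>2 + 2 * (F (a', b) - F (a', b'))\<^sup>2"
      unfolding xy yy
      using sum_squares_bound[of "F (a, b) - F (a', b)" "F (a', b) - F (a', b')"]
        power2_sum[of "F (a, b) - F (a', b)" "F (a', b) - F (a', b')"] by simp
    ultimately show ?thesis unfolding xy yy by simp
  qed
  have bd: "(F x - mol r F x)\<^sup>2 \<le> 2 * \<rho> * I1 (snd x) + 2 * \<rho> * mol r (\<lambda>y. I2 (fst y)) x" if x: "x \<in> cell" for x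
  proof -
    have i: "integrable Mx (\<lambda>y. (norm (F x - F y))\<^sup>2)"
      by (intro Mx_integral_continuous(1) continuous_intros)
    have j2: "integrable Mx (\<lambda>y. 2 * \<rho> * I1 (snd x) + 2 * \<rho> * I2 (fst y))" using J2 by auto
    have "F x - mol r F x = mol r (\<lambda>y. F x - F y) x"
      using mol_diff[OF _ Fi, of "\<lambda>_. F x" r x] by (simp add: mol_const)
    then have "(F x - mol r F x)\<^sup>2 \<le> mol r (\<lambda>y. (norm (F x - F y))\<^sup>2) x"
      using mol_sq[OF _ i, of r x] by simp
    also have "\<dots> \<le> mol r (\<lambda>y. 2 * \<rho> * I1 (snd x) + 2 * \<rho> * I2 (fst y)) x"
      unfolding mol_def
    proof (rule integral_mono_AE[OF mol_integrable[OF i] mol_integrable[OF j2]])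
      show "AE y in Mx. ker2 r (x - y) *\<^sub>R (norm (F x - F y))\<^sup>2 \<le> ker2 r (x - y) *\<^sub>R (2 * \<rho> * I1 (snd x) + 2 * \<rho> * I2 (fst y))"
        using AE_Mx_cell
      proof eventually_elim
        case (elim y)
        then show ?case
          using pt[OF x elim] ker2_nonneg[of r "x - y"]
          by (cases "ker2 r (x - y) = 0") (auto intro!: mult_left_mono)
      qed
    qed
    also have "\<dots> = 2 * \<rho> * I1 (snd x) + 2 * \<rho> * mol r (\<lambda>y. I2 (fst y)) x"
    proof -
      have k: "integrable Mx (\<lambda>y. ker2 r (x - y))" using mol_integrable[of "\<lambda>_. 1::real" r x] by simp
      have "mol r (\<lambda>y. 2 * \<rho> * I1 (snd x) + 2 * \<rho> * I2 (fst y)) x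
        = (LINT y|Mx. (2 * \<rho> * I1 (snd x)) * ker2 r (x - y) + 2 * \<rho> * (ker2 r (x - y) * I2 (fst y)))"
        unfolding mol_def by (simp add: algebra_simps)
      also have "\<dots> = 2 * \<rho> * I1 (snd x) * (LINT y|Mx. ker2 r (x - y)) + 2 * \<rho> * mol r (\<lambda>y. I2 (fst y)) x"
        using k mol_integrable[OF J2(1), of r x] unfolding mol_def by simp
      finally show ?thesis by (simp add: ker2_LINT)
    qed
    finally show ?thesis .
  qed
  have "(LINT x|Mx. (F x - mol r F x)\<^sup>2) \<le> (LINT x|Mx. 2 * \<rho> * I1 (snd x) + 2 * \<rho> * mol r (\<lambda>y. I2 (fst y)) x)"
  proof (rule integral_mono_AE)
    show "integrable Mx (\<lambda>x. (F x - mol r F x)\<^sup>2)"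
      by (intro Mx_integral_continuous(1) continuous_intros mol_continuous Fi)
    show "integrable Mx (\<lambda>x. 2 * \<rho> * I1 (snd x) + 2 * \<rho> * mol r (\<lambda>y. I2 (fst y)) x)"
      using J1(1) mol_integral_eq(2)[OF J2(1)] by auto
    show "AE x in Mx. (F x - mol r F x)\<^sup>2 \<le> 2 * \<rho> * I1 (snd x) + 2 * \<rho> * mol r (\<lambda>y. I2 (fst y)) x"
      using AE_Mx_cell by eventually_elim (rule bd)
  qed
  also have "\<dots> = 2 * \<rho> * (LINT x|Mx. (F1 x)\<^sup>2) + 2 * \<rho> * (LINT x|Mx. (F2 x)\<^sup>2)"
    using J1 mol_integral_eq[OF J2(1)] J2 by simp
  also have "\<dots> = 2 / (real r + 1) * (LINT x|Mx. (F1 x)\<^sup>2 + (F2 x)\<^sup>2)"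
    using sqi unfolding \<rho>_def by (simp add: algebra_simps add_divide_distrib)
  finally show ?thesis .
qed

text \<open>The weak gradient is tested against the mollification kernels only, which is all that is needed and holds for almost every time slice.\<close>

definition wgrad :: "(real \<times> real \<Rightarrow> real) \<Rightarrow> (real \<times> real \<Rightarrow> real \<times> real) \<Rightarrow> bool" where
  "wgrad f G \<longleftrightarrow> f \<in> borel_measurable borel \<and> G \<in> borel_measurable borel \<and>
     integrable Mx (\<lambda>x. (f x)\<^sup>2) \<and> integrable Mx (\<lambda>x. (norm (G x))\<^sup>2) \<and>
     (\<forall>n x. mol_grad n f x = mol n G x)"

lemma norm_prod_sq: "(norm (z::real \<times> real))\<^sup>2 = (fst z)\<^sup>2 + (snd z)\<^sup>2"
  by (simp add: norm_prod_def)

text \<open>Apply the classical estimate to \<open>mol n f\<close>, with n independent of r; its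
  gradient \<open>mol n G\<close> is no larger in L^2 than G. Letting n tend to infinity removes the
  remaining errors, at the price of a factor 2.\<close>

lemma wgrad_smoothing:
  assumes w: "wgrad f G"
  shows "(LINT x|Mx. (f x - mol r f x)\<^sup>2) \<le> 4 / (real r + 1) * (LINT x|Mx. (norm (G x))\<^sup>2)"
proof -
  note a = w[unfolded wgrad_def]
  have [measurable]: "f \<in> borel_measurable borel" "G \<in> borel_measurable borel" using a by auto
  have f2: "integrable Mx (\<lambda>x. (f x)\<^sup>2)" and G2: "integrable Mx (\<lambda>x. (norm (G x))\<^sup>2)" using a by auto
  have fi: "integrable Mx f"
    by (rule integrable_of_square) (use f2 in \<open>auto intro: Mx.finite_measure_axioms\<close>)
  have Sf2: "integrable Mx (\<lambda>x. (mol n f x)\<^sup>2)" for n using mol_square_integral(1)[of f n] f2 by simp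
  have d2: "integrable Mx (\<lambda>x. (u x - v x)\<^sup>2)"
    if "integrable Mx (\<lambda>x. (u x)\<^sup>2)" "integrable Mx (\<lambda>x. (v x)\<^sup>2)"
      and [measurable]: "u \<in> borel_measurable borel" "v \<in> borel_measurable borel" for u v :: "real \<times> real \<Rightarrow> real"
    using that integrable_mult_of_squares[of u Mx v] by (simp add: power2_diff mult.assoc)
  define I where "I = (LINT x|Mx. (norm (G x))\<^sup>2)"
  have main: "(LINT x|Mx. (f x - mol r f x)\<^sup>2) \<le> 4 / (real r + 1) * I + 8 * (LINT x|Mx. (mol n f x - f x)\<^sup>2)" for n
  proof -
    define F where "F = mol n f"
    have Fi: "integrable Mx F" unfolding F_def by (rule mol_integral_eq(2)[OF fi])
    have [measurable]: "F \<in> borel_measurable borel" unfolding F_def by simp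
    have FF: "(LINT x|Mx. (F x - mol r F x)\<^sup>2) \<le> 2 / (real r + 1) * I"
    proof -
      have "(LINT x|Mx. (F x - mol r F x)\<^sup>2) \<le> 2 / (real r + 1) * (LINT x|Mx. (norm (mol_grad n f x))\<^sup>2)"
        using periodic_C1_smoothing[OF mol_periodic_C1[OF fi], of n r] unfolding F_def norm_prod_sq .
      also have "(LINT x|Mx. (norm (mol_grad n f x))\<^sup>2) \<le> I"
        using mol_square_integral(2)[OF _ G2, of n] w unfolding I_def wgrad_def by (simp del: split_paired_All)
      finally show ?thesis by (simp add: mult_left_mono divide_right_mono)
    qed
    define u where "u x = F x - f x" for x
    have u2: "integrable Mx (\<lambda>x. (u x)\<^sup>2)" unfolding u_def F_def by (rule d2) (use Sf2 f2 in auto)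
    have [measurable]: "u \<in> borel_measurable borel" unfolding u_def by simp
    have Su: "mol r u x = mol r F x - mol r f x" for x unfolding u_def by (rule mol_diff[OF Fi fi])
    have Su2: "integrable Mx (\<lambda>x. (mol r u x)\<^sup>2)" "(LINT x|Mx. (mol r u x)\<^sup>2) \<le> (LINT x|Mx. (u x)\<^sup>2)"
      using mol_square_integral[of u r] u2 by auto
    have F2: "integrable Mx (\<lambda>x. (F x - mol r F x)\<^sup>2)"
      by (rule d2) (use Sf2 mol_square_integral(1)[of F r] in \<open>auto simp: F_def\<close>)
    \<comment> \<open>The difference is written as (F - mol r F) - u + mol r u, where u = F - f is
      small in L^2 for large n.\<close>
    have "(f x - mol r f x)\<^sup>2 \<le> 2 * (F x - mol r F x)\<^sup>2 + 4 * (u x)\<^sup>2 + 4 * (mol r u x)\<^sup>2" for x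
    proof -
      have "(A - B + C)\<^sup>2 \<le> 2 * A\<^sup>2 + 4 * B\<^sup>2 + 4 * C\<^sup>2" for A B C :: real
        using zero_le_power2[of "A - (C - B)"] zero_le_power2[of "B + C"]
        by (simp add: power2_eq_square algebra_simps)
      from this[of "F x - mol r F x" "u x" "mol r u x"] show ?thesis by (simp add: Su u_def)
    qed
    then have "(LINT x|Mx. (f x - mol r f x)\<^sup>2) \<le> (LINT x|Mx. 2 * (F x - mol r F x)\<^sup>2 + 4 * (u x)\<^sup>2 + 4 * (mol r u x)\<^sup>2)"
      using d2[OF f2 Sf2] F2 u2 Su2 by (intro integral_mono) auto
    also have "\<dots> = 2 * (LINT x|Mx. (F x - mol r F x)\<^sup>2) + 4 * (LINT x|Mx. (u x)\<^sup>2) + 4 * (LINT x|Mx. (mol r u x)\<^sup>2)"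
      using F2 u2 Su2 by simp
    also have "\<dots> \<le> 2 * (2 / (real r + 1) * I) + 8 * (LINT x|Mx. (u x)\<^sup>2)" using FF Su2 by linarith
    finally show ?thesis unfolding u_def F_def by simp
  qed
  have "(\<lambda>n. 4 / (real r + 1) * I + 8 * (LINT x|Mx. (mol n f x - f x)\<^sup>2)) \<longlonglongrightarrow> 4 / (real r + 1) * I + 8 * 0"
    by (intro tendsto_intros mol_L2_tendsto(1) f2) auto
  from LIMSEQ_le_const[OF this] main show ?thesis unfolding I_def by auto
qed

text \<open>The Poincare step: within a column, moving to the height \<beta> changes the mollified
  function by at most the square root of h times the derivative energy of that column. For \<beta>
  the nearest grid line below, this compares the cell with the rows of the grid.\<close>

lemma wgrad_row_bound:
  assumes w: "wgrad f G" and h: "\<And>x. x \<in> cell \<Longrightarrow> \<bar>snd x - \<beta> (snd x)\<bar> \<le> h \<and> 0 \<le> \<beta> (snd x) \<and> \<beta> (snd x) \<le> 1"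
    and [measurable]: "\<beta> \<in> borel_measurable borel"
  shows "(LINT x|Mx. (mol n f x - mol n f (fst x, \<beta> (snd x)))\<^sup>2) \<le> h * (LINT x|Mx. (norm (G x))\<^sup>2)"
proof -
  note a = w[unfolded wgrad_def]
  have [measurable]: "f \<in> borel_measurable borel" "G \<in> borel_measurable borel" using a by auto
  have f2: "integrable Mx (\<lambda>x. (f x)\<^sup>2)" and G2: "integrable Mx (\<lambda>x. (norm (G x))\<^sup>2)" using a by auto
  have fi: "integrable Mx f"
    by (rule integrable_of_square) (use f2 in \<open>auto intro: Mx.finite_measure_axioms\<close>)
  define F2 where "F2 x = snd (mol_grad n f x)" for x
  note pC = mol_periodic_C1[OF fi, of n, unfolded periodic_C1_def]
  have c2: "continuous_on UNIV F2" using pC unfolding F2_def by auto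
  define I where "I a = (LINT w|ivl 1. (F2 (a, w))\<^sup>2)" for a
  have sqi: "integrable Mx (\<lambda>x. (F2 x)\<^sup>2)"
    by (intro Mx_integral_continuous(1) continuous_intros c2)
  have i: "integrable Mx (\<lambda>x. I (fst x))" and ieq: "(LINT x|Mx. I (fst x)) = (LINT x|Mx. (F2 x)\<^sup>2)"
    unfolding I_def by (intro Mx_partial_integral[of "\<lambda>x. (F2 x)\<^sup>2"] continuous_intros c2)+
  have I0: "I a \<ge> 0" for a unfolding I_def by simp
  have h0: "h \<ge> 0" using h[of "(0,0)"] unfolding cell_def by force
  have "(LINT x|Mx. (mol n f x - mol n f (fst x, \<beta> (snd x)))\<^sup>2) \<le> (LINT x|Mx. h * I (fst x))"
  proof (rule integral_mono_AE')
    show "integrable Mx (\<lambda>x. h * I (fst x))" using i by auto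
    show "AE x in Mx. 0 \<le> h * I (fst x)" using h0 I0 by auto
    show "AE x in Mx. (mol n f x - mol n f (fst x, \<beta> (snd x)))\<^sup>2 \<le> h * I (fst x)"
      using AE_Mx_cell
    proof eventually_elim
      case (elim x)
      obtain s t where x: "x = (s, t)" by (cases x)
      have "(mol n f (s, t) - mol n f (s, \<beta> t))\<^sup>2 \<le> \<bar>t - \<beta> t\<bar> * I s"
        unfolding I_def
        by (rule derivative_square_bound[of "\<lambda>w. mol n f (s, w)"])
          (use elim h[OF elim] pC c2 in \<open>auto simp: x cell_def F2_def intro: continuous_on_Pair2\<close>)
      also have "\<dots> \<le> h * I s" by (intro mult_right_mono I0) (use h[OF elim] x in auto)
      finally show ?case unfolding x by simp
    qed
  qed
  also have "\<dots> = h * (LINT x|Mx. (F2 x)\<^sup>2)" using ieq by simp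
  also have "(LINT x|Mx. (F2 x)\<^sup>2) \<le> (LINT x|Mx. (norm (mol n G x))\<^sup>2)"
  proof (rule integral_mono[OF sqi mol_square_integral(1)[OF _ G2]])
    show "(F2 x)\<^sup>2 \<le> (norm (mol n G x))\<^sup>2" for x
    proof -
      have "mol_grad n f x = mol n G x" using w unfolding wgrad_def by blast
      then show ?thesis unfolding F2_def norm_prod_sq by simp
    qed
  qed simp
  also have "\<dots> \<le> (LINT x|Mx. (norm (G x))\<^sup>2)" by (rule mol_square_integral(2)[OF _ G2]) simp
  finally show ?thesis using h0 by (simp add: mult_left_mono)
qed

section \<open>Primitives in time\<close>

lemma ivl_integral:
  fixes f :: "real \<Rightarrow> real"
  assumes "f \<in> borel_measurable borel"
  shows "(LINT x|ivl T. f x) = (LINT x:{0..T}|lborel. f x)" "integrable (ivl T) f \<longleftrightarrow> set_integrable lborel {0..T} f"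
  unfolding ivl_def using density_indicator_integral[OF assms, of "{0..T}"] by auto

lemma integrable_ivl_mono:
  fixes f :: "real \<Rightarrow> real"
  assumes f: "integrable (ivl T) f" and t: "t \<le> T"
  shows "integrable (ivl t) f"
proof -
  have m: "f \<in> borel_measurable borel" using f by auto
  have "set_integrable lborel {0..T} f" using f ivl_integral(2)[OF m] by simp
  then have "set_integrable lborel {0..t} f" by (rule set_integrable_subset) (use t in auto)
  then show ?thesis using ivl_integral(2)[OF m] by simp
qed

lemma ivl_restrict:
  fixes f :: "real \<Rightarrow> real"
  assumes f[measurable]: "f \<in> borel_measurable borel" and b: "b \<le> T"
  shows "(LINT a|ivl T. (if a \<le> b then f a else 0)) = (LINT a|ivl b. f a)"
    "(LINT a|ivl T. (if a < b then f a else 0)) = (LINT a|ivl b. f a)"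
proof -
  have "(LINT a|ivl T. (if a \<le> b then f a else 0)) = (LINT a|lborel. indicator {0..T} a *\<^sub>R (if a \<le> b then f a else 0))"
    by (subst ivl_integral) (auto simp: set_lebesgue_integral_def)
  also have "\<dots> = (LINT a|lborel. indicator {0..b} a *\<^sub>R f a)"
    by (intro Bochner_Integration.integral_cong) (use b in \<open>auto simp: indicator_def\<close>)
  also have "\<dots> = (LINT a|ivl b. f a)"
    by (subst ivl_integral) (use f in \<open>auto simp: set_lebesgue_integral_def\<close>)
  finally show 1: "(LINT a|ivl T. (if a \<le> b then f a else 0)) = (LINT a|ivl b. f a)" .
  have "(LINT a|ivl T. (if a < b then f a else 0)) = (LINT a|ivl T. (if a \<le> b then f a else 0))"
  proof (rule integral_cong_AE)
    show "AE a in ivl T. (if a < b then f a else 0) = (if a \<le> b then f a else 0)"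
      unfolding AE_ivl using AE_lborel_singleton[of b] by eventually_elim auto
  qed auto
  then show "(LINT a|ivl T. (if a < b then f a else 0)) = (LINT a|ivl b. f a)" using 1 by simp
qed

text \<open>Positive and negative part of f, taken as densities, define measures that agree on all
  half-lines and hence coincide; so do the densities almost everywhere. It removes the time integral
  from identities known for every final time.\<close>

lemma AE_zero_of_primitive_zero:
  fixes f :: "real \<Rightarrow> real"
  assumes f: "integrable (ivl T) f" and z: "\<And>t. 0 \<le> t \<Longrightarrow> t \<le> T \<Longrightarrow> (LINT s|ivl t. f s) = 0"
  shows "AE s in ivl T. f s = 0"
proof (cases "T \<ge> 0")
  case False
  then show ?thesis unfolding AE_ivl by simp
next
  case T: True
  have m[measurable]: "f \<in> borel_measurable borel" using f by auto
  define h where "h s = indicator {0..T} s * f s" for s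
  have [measurable]: "h \<in> borel_measurable borel" unfolding h_def by simp
  have hi: "integrable lborel h"
    using f ivl_integral(2)[OF m] unfolding h_def set_integrable_def by simp
  have h0: "(LINT s|lborel. indicator {x<..} s * h s) = 0" for x
  proof -
    consider "x \<ge> T" | "x < 0" | "0 \<le> x" "x < T" by linarith
    then show ?thesis
    proof cases
      case 1
      then have e: "indicator {x<..} s * h s = 0" for s unfolding h_def by (auto simp: indicator_def)
      show ?thesis unfolding e by simp
    next
      case 2
      then have e: "indicator {x<..} s * h s = indicator {0..T} s *\<^sub>R f s" for s
        unfolding h_def by (auto simp: indicator_def)
      show ?thesis unfolding e using z[of T] T ivl_integral(1)[OF m, of T] by (simp add: set_lebesgue_integral_def)
    next
      case 3
      then have e: "indicator {x<..} s * h s = indicator {0..T} s *\<^sub>R f s - indicator {0..x} s *\<^sub>R f s" for s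
        unfolding h_def by (auto simp: indicator_def)
      have i1: "integrable lborel (\<lambda>s. indicator {0..T} s *\<^sub>R f s)"
        using f ivl_integral(2)[OF m, of T] unfolding set_integrable_def by simp
      have i2: "integrable lborel (\<lambda>s. indicator {0..x} s *\<^sub>R f s)"
        using integrable_ivl_mono[OF f, of x] 3 ivl_integral(2)[OF m, of x] unfolding set_integrable_def by simp
      show ?thesis
        unfolding e Bochner_Integration.integral_diff[OF i1 i2]
        using z[of T] z[of x] 3 T ivl_integral(1)[OF m, of T] ivl_integral(1)[OF m, of x]
        by (simp add: set_lebesgue_integral_def)
    qed
  qed
  let ?M = "density lborel (\<lambda>s. ennreal (max 0 (h s)))" and ?N = "density lborel (\<lambda>s. ennreal (max 0 (- h s)))"
  have pi: "integrable lborel (\<lambda>s. max 0 (h s))" "integrable lborel (\<lambda>s. max 0 (- h s))"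
    using hi by (auto intro: integrable_max)
  have em: "emeasure (density lborel (\<lambda>s. ennreal (k s))) {x<..} = ennreal (LINT s|lborel. indicator {x<..} s * k s)"
    if k: "integrable lborel k" "\<And>s. k s \<ge> 0" for k :: "real \<Rightarrow> real" and x
  proof -
    have [measurable]: "k \<in> borel_measurable borel" using k by auto
    have "emeasure (density lborel (\<lambda>s. ennreal (k s))) {x<..} = (\<integral>\<^sup>+s. ennreal (indicator {x<..} s * k s) \<partial>lborel)"
      by (subst emeasure_density) (auto intro!: nn_integral_cong simp: indicator_def)
    also have "\<dots> = ennreal (LINT s|lborel. indicator {x<..} s * k s)"
      using integrable_real_mult_indicator[OF _ k(1), of "{x<..}"] k
      by (intro nn_integral_eq_integral) (auto simp: mult.commute)
    finally show ?thesis .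
  qed
  have "?M = ?N"
  proof (rule measure_eqI_lessThan)
    fix x :: real
    show "emeasure ?M {x<..} < \<infinity>" using em[OF pi(1)] by simp
    have "(LINT s|lborel. indicator {x<..} s * max 0 (h s)) - (LINT s|lborel. indicator {x<..} s * max 0 (- h s))
      = (LINT s|lborel. indicator {x<..} s * max 0 (h s) - indicator {x<..} s * max 0 (- h s))"
      using integrable_real_mult_indicator[OF _ pi(1), of "{x<..}"] integrable_real_mult_indicator[OF _ pi(2), of "{x<..}"]
      by (subst Bochner_Integration.integral_diff) (auto simp: mult.commute)
    also have "\<dots> = (LINT s|lborel. indicator {x<..} s * h s)"
      by (intro Bochner_Integration.integral_cong) (auto simp: max_def)
    finally have "(LINT s|lborel. indicator {x<..} s * max 0 (h s)) = (LINT s|lborel. indicator {x<..} s * max 0 (- h s))"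
      using h0 by simp
    then show "emeasure ?M {x<..} = emeasure ?N {x<..}"
      using em[OF pi(1), of x] em[OF pi(2), of x] by simp
  qed auto
  then have "AE s in lborel. ennreal (max 0 (h s)) = ennreal (max 0 (- h s))"
    by (subst (asm) sigma_finite_measure.density_unique_iff[OF sigma_finite_lborel]) auto
  then have "AE s in lborel. h s = 0"
    by eventually_elim (auto simp: max_def split: if_splits)
  then show ?thesis
    unfolding AE_ivl by eventually_elim (auto simp: h_def)
qed

text \<open>The chain rule for D^2 when D is only an indefinite integral. Fubini cuts the square
  [0, T]^2 along its diagonal, and on each of the two triangles the inner integral is D - d.\<close>

lemma primitive_square:
  fixes F D :: "real \<Rightarrow> real"
  assumes F: "integrable (ivl T) F" and T: "T \<ge> 0"
    and D: "\<And>t. 0 \<le> t \<Longrightarrow> t \<le> T \<Longrightarrow> D t = d + (LINT s|ivl t. F s)"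
    and Dm: "D \<in> borel_measurable borel"
  shows "(D T)\<^sup>2 = d\<^sup>2 + 2 * (LINT s|ivl T. D s * F s)"
proof -
  have [measurable]: "F \<in> borel_measurable borel" "D \<in> borel_measurable borel" using F Dm by auto
  define \<Phi> where "\<Phi> t = (LINT s|ivl t. F s)" for t
  define G where "G a b = (if a \<le> b then F a * F b else 0)" for a b
  define H where "H a b = (if b < a then F a * F b else 0)" for a b
  have "integrable (ivl T \<Otimes>\<^sub>M ivl T) (\<lambda>z. F (fst z) * F (snd z))"
  proof (rule ivlp.Fubini_integrable)
    show "integrable (ivl T) (\<lambda>x. LINT y|ivl T. norm (F (fst (x, y)) * F (snd (x, y))))"
      using F by (simp add: abs_mult)
    show "AE x in ivl T. integrable (ivl T) (\<lambda>y. F (fst (x, y)) * F (snd (x, y)))" using F by simp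
  qed measurable
  then have FF: "integrable (ivl T \<Otimes>\<^sub>M ivl T) (case_prod (\<lambda>a b. F a * F b))" by (simp add: split_beta')
  have Gm: "case_prod G \<in> borel_measurable (ivl T \<Otimes>\<^sub>M ivl T)"
    unfolding G_def by measurable
  have Hm: "case_prod H \<in> borel_measurable (ivl T \<Otimes>\<^sub>M ivl T)"
    unfolding H_def by measurable
  have Gi: "integrable (ivl T \<Otimes>\<^sub>M ivl T) (case_prod G)"
    by (rule Bochner_Integration.integrable_bound[OF FF Gm]) (auto simp: G_def)
  have Hi: "integrable (ivl T \<Otimes>\<^sub>M ivl T) (case_prod H)"
    by (rule Bochner_Integration.integrable_bound[OF FF Hm]) (auto simp: H_def)
  have "(\<Phi> T)\<^sup>2 = (LINT a|ivl T. LINT b|ivl T. F a * F b)"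
    unfolding \<Phi>_def power2_eq_square by simp
  also have "\<dots> = integral\<^sup>L (ivl T \<Otimes>\<^sub>M ivl T) (case_prod (\<lambda>a b. F a * F b))"
    by (rule ivlp.integral_fst[OF FF])
  also have "\<dots> = integral\<^sup>L (ivl T \<Otimes>\<^sub>M ivl T) (\<lambda>z. case_prod G z + case_prod H z)"
    by (intro Bochner_Integration.integral_cong) (auto simp: G_def H_def)
  also have "\<dots> = integral\<^sup>L (ivl T \<Otimes>\<^sub>M ivl T) (case_prod G) + integral\<^sup>L (ivl T \<Otimes>\<^sub>M ivl T) (case_prod H)"
    by (rule Bochner_Integration.integral_add[OF Gi Hi])
  also have "integral\<^sup>L (ivl T \<Otimes>\<^sub>M ivl T) (case_prod G) = (LINT b|ivl T. LINT a|ivl T. G a b)"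
    by (rule ivlp.integral_snd[OF Gi, symmetric])
  also have "integral\<^sup>L (ivl T \<Otimes>\<^sub>M ivl T) (case_prod H) = (LINT a|ivl T. LINT b|ivl T. H a b)"
    by (rule ivlp.integral_fst[OF Hi, symmetric])
  also have "(LINT b|ivl T. LINT a|ivl T. G a b) = (LINT b|ivl T. F b * (LINT a|ivl T. (if a \<le> b then F a else 0)))"
    unfolding G_def by (intro Bochner_Integration.integral_cong refl, subst integral_mult_right_zero[symmetric], intro Bochner_Integration.integral_cong) auto
  also have "(LINT a|ivl T. LINT b|ivl T. H a b) = (LINT a|ivl T. F a * (LINT b|ivl T. (if b < a then F b else 0)))"
    unfolding H_def by (intro Bochner_Integration.integral_cong refl, subst integral_mult_right_zero[symmetric], intro Bochner_Integration.integral_cong) auto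
  finally have *: "(\<Phi> T)\<^sup>2 = (LINT b|ivl T. F b * (LINT a|ivl T. (if a \<le> b then F a else 0)))
     + (LINT a|ivl T. F a * (LINT b|ivl T. (if b < a then F b else 0)))" .
  have AEi: "AE s in ivl T. 0 \<le> s \<and> s \<le> T" unfolding AE_ivl by auto
  have "(LINT b|ivl T. F b * (LINT a|ivl T. (if a \<le> b then F a else 0))) = (LINT s|ivl T. F s * (D s - d))"
  proof (rule integral_cong_AE)
    show "AE b in ivl T. F b * (LINT a|ivl T. (if a \<le> b then F a else 0)) = F b * (D b - d)"
      using AEi by eventually_elim (auto simp: ivl_restrict D)
    show "(\<lambda>b. F b * (LINT a|ivl T. (if a \<le> b then F a else 0))) \<in> borel_measurable (ivl T)"
      by measurable
  qed auto
  moreover have "(LINT b|ivl T. F b * (LINT a|ivl T. (if a < b then F a else 0))) = (LINT s|ivl T. F s * (D s - d))"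
  proof (rule integral_cong_AE)
    show "AE b in ivl T. F b * (LINT a|ivl T. (if a < b then F a else 0)) = F b * (D b - d)"
      using AEi by eventually_elim (auto simp: ivl_restrict D)
    show "(\<lambda>b. F b * (LINT a|ivl T. (if a < b then F a else 0))) \<in> borel_measurable (ivl T)"
      by measurable
  qed auto
  ultimately have sq: "(\<Phi> T)\<^sup>2 = 2 * (LINT s|ivl T. F s * (D s - d))" using * by simp
  have DFi: "integrable (ivl T) (\<lambda>s. D s * F s)"
  proof (rule Bochner_Integration.integrable_bound)
    define C where "C = \<bar>d\<bar> + (LINT s|ivl T. \<bar>F s\<bar>)"
    show "integrable (ivl T) (\<lambda>s. C * F s)" using F by simp
    have "\<bar>D t\<bar> \<le> C" if t: "0 \<le> t" "t \<le> T" for t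
    proof -
      have "\<bar>LINT s|ivl t. F s\<bar> \<le> (LINT s|ivl t. \<bar>F s\<bar>)" using integral_norm_bound[of "ivl t" F] by simp
      also have "\<dots> = (LINT s|ivl T. (if s \<le> t then \<bar>F s\<bar> else 0))"
        using ivl_restrict(1)[of "\<lambda>s. \<bar>F s\<bar>" t T] t by simp
      also have "\<dots> \<le> (LINT s|ivl T. \<bar>F s\<bar>)"
        by (rule integral_mono') (use F in auto)
      finally show ?thesis unfolding C_def using D[OF t] by linarith
    qed
    then have "\<bar>D t\<bar> * \<bar>F t\<bar> \<le> \<bar>C\<bar> * \<bar>F t\<bar>" if "0 \<le> t" "t \<le> T" for t
      using that by (intro mult_right_mono) (auto intro: order_trans[OF _ abs_ge_self])
    then show "AE s in ivl T. norm (D s * F s) \<le> norm (C * F s)"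
      using AEi by (auto elim!: eventually_mono[OF AEi] simp: abs_mult)
  qed simp
  have "(LINT s|ivl T. F s * (D s - d)) = (LINT s|ivl T. D s * F s) - d * \<Phi> T"
    using F DFi unfolding \<Phi>_def by (simp add: right_diff_distrib mult.commute)
  moreover have "D T = d + \<Phi> T" using D[of T] T unfolding \<Phi>_def by simp
  ultimately show ?thesis using sq by (simp add: power2_eq_square algebra_simps)
qed

section \<open>The cellular flow\<close>

definition cflow :: "nat \<Rightarrow> real \<times> real \<Rightarrow> real \<times> real" where
  "cflow m x = cell_flow (real m *\<^sub>R x)"

lemma cflow_alt: "cflow m x =
  (- (2*pi) * sin (2*pi*real m * fst x) * cos (2*pi*real m * snd x),
     (2*pi) * cos (2*pi*real m * fst x) * sin (2*pi*real m * snd x))"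
  unfolding cflow_def cell_flow_def by (simp add: mult_ac)

lemma cflow_continuous [continuous_intros]: "continuous_on UNIV (cflow m)"
  unfolding cflow_alt by (intro continuous_intros)

lemma cflow_measurable [measurable]: "cflow m \<in> borel_measurable borel"
  by (intro borel_measurable_continuous_onI continuous_intros)

lemma cflow_components_le: "\<bar>fst (cflow m x)\<bar> \<le> 8" "\<bar>snd (cflow m x)\<bar> \<le> 8"
proof -
  have "\<bar>sin a * cos b\<bar> \<le> 1" for a b :: real
    using mult_mono[of "\<bar>sin a\<bar>" 1 "\<bar>cos b\<bar>" 1] by (simp add: abs_mult)
  then have "2*pi * \<bar>sin a * cos b\<bar> \<le> 8 * 1" for a b :: real
    using pi_less_4 by (intro mult_mono) auto
  from this[of "2*pi*real m * fst x" "2*pi*real m * snd x"] this[of "2*pi*real m * snd x" "2*pi*real m * fst x"]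
  show "\<bar>fst (cflow m x)\<bar> \<le> 8" "\<bar>snd (cflow m x)\<bar> \<le> 8"
    unfolding cflow_alt by (auto simp: abs_mult mult_ac)
qed

lemma norm_le_fst_snd: "norm z \<le> \<bar>fst z\<bar> + \<bar>snd (z :: real \<times> real)\<bar>"
  using norm_Pair_le[of "fst z" "snd z"] by simp

lemma cflow_norm_le: "norm (cflow m x) \<le> 16"
  using norm_Pair_le[of "fst (cflow m x)" "snd (cflow m x)"] cflow_components_le[of m x] by simp

lemma sin_diff_le: "\<bar>sin (2*pi*real m*a) - sin (2*pi*real m*b)\<bar> \<le> 2 * real m * \<bar>sin (pi * (a - b))\<bar>"
  and cos_diff_le: "\<bar>cos (2*pi*real m*a) - cos (2*pi*real m*b)\<bar> \<le> 2 * real m * \<bar>sin (pi * (a - b))\<bar>"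
proof -
  define x where "x = sin ((2*pi*real m*a - 2*pi*real m*b)/2)"
  have "(2*pi*real m*a - 2*pi*real m*b)/2 = real m * (pi * (a - b))" by (simp add: field_simps)
  then have x: "\<bar>x\<bar> \<le> real m * \<bar>sin (pi * (a - b))\<bar>"
    unfolding x_def using abs_sin_nat_mult_le[of m "pi * (a - b)"] by simp
  have "\<bar>sin (2*pi*real m*a) - sin (2*pi*real m*b)\<bar> = 2 * \<bar>x\<bar> * \<bar>cos ((2*pi*real m*a + 2*pi*real m*b)/2)\<bar>"
    unfolding sin_diff_sin x_def by (simp add: abs_mult)
  also have "\<dots> \<le> 2 * \<bar>x\<bar> * 1" by (intro mult_left_mono) auto
  finally show "\<bar>sin (2*pi*real m*a) - sin (2*pi*real m*b)\<bar> \<le> 2 * real m * \<bar>sin (pi * (a - b))\<bar>" using x by simp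
  have "\<bar>cos (2*pi*real m*a) - cos (2*pi*real m*b)\<bar> = 2 * \<bar>sin ((2*pi*real m*a + 2*pi*real m*b)/2)\<bar> * \<bar>sin ((2*pi*real m*b - 2*pi*real m*a)/2)\<bar>"
    unfolding cos_diff_cos by (simp add: abs_mult)
  also have "\<bar>sin ((2*pi*real m*b - 2*pi*real m*a)/2)\<bar> = \<bar>x\<bar>"
  proof -
    have "(2*pi*real m*b - 2*pi*real m*a)/2 = - ((2*pi*real m*a - 2*pi*real m*b)/2)" by (simp add: field_simps)
    then show ?thesis unfolding x_def by (simp only: sin_minus abs_minus_cancel)
  qed
  also have "2 * \<bar>sin ((2*pi*real m*a + 2*pi*real m*b)/2)\<bar> * \<bar>x\<bar> \<le> 2 * 1 * \<bar>x\<bar>"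
    by (intro mult_right_mono mult_left_mono) auto
  finally show "\<bar>cos (2*pi*real m*a) - cos (2*pi*real m*b)\<bar> \<le> 2 * real m * \<bar>sin (pi * (a - b))\<bar>" using x by simp
qed

text \<open>Lipschitz bound with respect to the distance on the torus. The constant is linear in m,
  which is harmless since m is fixed before the kernel radius.\<close>

lemma cflow_diff_le:
  assumes "\<bar>sin (pi * (fst x - fst y))\<bar> \<le> \<rho>" "\<bar>sin (pi * (snd x - snd y))\<bar> \<le> \<rho>"
  shows "norm (cflow m x - cflow m y) \<le> 64 * real m * \<rho>"
proof -
  have p: "\<bar>a * b - a' * b'\<bar> \<le> d + d" if "\<bar>a\<bar> \<le> 1" "\<bar>b'\<bar> \<le> 1" "\<bar>a - a'\<bar> \<le> d" "\<bar>b - b'\<bar> \<le> d" for a b a' b' d :: real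
  proof -
    have "\<bar>a * b - a' * b'\<bar> = \<bar>a * (b - b') + (a - a') * b'\<bar>" by (simp add: algebra_simps)
    also have "\<dots> \<le> \<bar>a\<bar> * \<bar>b - b'\<bar> + \<bar>a - a'\<bar> * \<bar>b'\<bar>" by (metis abs_mult abs_triangle_ineq)
    also have "\<dots> \<le> 1 * d + d * 1" using that by (intro add_mono mult_mono) auto
    finally show ?thesis by simp
  qed
  have m: "2 * real m * \<bar>sin (pi * (fst x - fst y))\<bar> \<le> 2 * real m * \<rho>" "2 * real m * \<bar>sin (pi * (snd x - snd y))\<bar> \<le> 2 * real m * \<rho>"
    using assms by (auto intro!: mult_left_mono)
  note s = order_trans[OF sin_diff_le m(1)] order_trans[OF cos_diff_le m(1)] order_trans[OF sin_diff_le m(2)] order_trans[OF cos_diff_le m(2)]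
  let ?sx = "sin (2*pi*real m * fst x)" and ?cx = "cos (2*pi*real m * fst x)" and ?sy = "sin (2*pi*real m * fst y)" and ?cy = "cos (2*pi*real m * fst y)"
  let ?tx = "sin (2*pi*real m * snd x)" and ?dx = "cos (2*pi*real m * snd x)" and ?ty = "sin (2*pi*real m * snd y)" and ?dy = "cos (2*pi*real m * snd y)"
  have 1: "\<bar>?sx * ?dx - ?sy * ?dy\<bar> \<le> 2 * real m * \<rho> + 2 * real m * \<rho>" by (rule p) (use s in auto)
  have 2: "\<bar>?cx * ?tx - ?cy * ?ty\<bar> \<le> 2 * real m * \<rho> + 2 * real m * \<rho>" by (rule p) (use s in auto)
  have "norm (cflow m x - cflow m y) \<le> \<bar>fst (cflow m x - cflow m y)\<bar> + \<bar>snd (cflow m x - cflow m y)\<bar>"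
    by (rule norm_le_fst_snd)
  also have "fst (cflow m x - cflow m y) = - (2*pi) * (?sx * ?dx - ?sy * ?dy)" unfolding cflow_alt by (simp add: algebra_simps)
  also have "snd (cflow m x - cflow m y) = (2*pi) * (?cx * ?tx - ?cy * ?ty)" unfolding cflow_alt by (simp add: algebra_simps)
  also have "\<bar>- (2*pi) * (?sx * ?dx - ?sy * ?dy)\<bar> + \<bar>(2*pi) * (?cx * ?tx - ?cy * ?ty)\<bar>
      = 2*pi * (\<bar>?sx * ?dx - ?sy * ?dy\<bar> + \<bar>?cx * ?tx - ?cy * ?ty\<bar>)" by (simp add: abs_mult distrib_left)
  also have "\<dots> \<le> 8 * ((2 * real m * \<rho> + 2 * real m * \<rho>) + (2 * real m * \<rho> + 2 * real m * \<rho>))"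
    using pi_less_4 1 2 by (intro mult_mono add_mono) auto
  finally show ?thesis by (simp add: mult_ac)
qed

text \<open>Despite its name not the divergence: it is the x2-derivative of the second component and
  minus the x1-derivative of the first. That the flow is divergence-free is the cancellation of
  these two.\<close>

definition cflow_div :: "nat \<Rightarrow> real \<times> real \<Rightarrow> real" where
  "cflow_div m x = (2*pi)\<^sup>2 * real m * cos (2*pi*real m * fst x) * cos (2*pi*real m * snd x)"

definition cflow_cross :: "nat \<Rightarrow> real \<times> real \<Rightarrow> real" where
  "cflow_cross m x = (2*pi)\<^sup>2 * real m * sin (2*pi*real m * fst x) * sin (2*pi*real m * snd x)"

lemma cflow_partials_continuous [continuous_intros]: "continuous_on UNIV (cflow_div m)" "continuous_on UNIV (cflow_cross m)"
  unfolding cflow_div_def cflow_cross_def by (intro continuous_intros)+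

lemma sin_cos_period:
  "sin (2*pi*real m * (a + of_int k)) = sin (2*pi*real m * a)" "cos (2*pi*real m * (a + of_int k)) = cos (2*pi*real m * a)"
proof -
  have e: "2*pi*real m * (a + of_int k) = 2*pi*real m * a + 2*pi* of_int (int m * k)" by (simp add: algebra_simps)
  have s: "sin (2*pi* of_int j) = 0" "cos (2*pi* of_int j) = 1" for j
    using sin_int_2pin[of j] cos_int_2pin[of j] by (auto simp: mult_ac)
  show "sin (2*pi*real m * (a + of_int k)) = sin (2*pi*real m * a)" "cos (2*pi*real m * (a + of_int k)) = cos (2*pi*real m * a)"
    unfolding e sin_add cos_add s by auto
qed

lemma cflow_periodic_C1:
  "periodic_C1 (\<lambda>x. fst (cflow m x)) (\<lambda>x. - cflow_div m x) (cflow_cross m)"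
  "periodic_C1 (\<lambda>x. snd (cflow m x)) (\<lambda>x. - cflow_cross m x) (cflow_div m)"
proof -
  have p: "sin (2*pi*real m) = 0" "cos (2*pi*real m) = 1"
    using sin_cos_period[of m 0 1] by auto
  show "periodic_C1 (\<lambda>x. fst (cflow m x)) (\<lambda>x. - cflow_div m x) (cflow_cross m)"
    unfolding periodic_C1_def
    by (intro conjI allI continuous_intros) (auto simp: cflow_alt cflow_div_def cflow_cross_def p power2_eq_square intro!: derivative_eq_intros)
  show "periodic_C1 (\<lambda>x. snd (cflow m x)) (\<lambda>x. - cflow_cross m x) (cflow_div m)"
    unfolding periodic_C1_def
    by (intro conjI allI continuous_intros) (auto simp: cflow_alt cflow_div_def cflow_cross_def p power2_eq_square intro!: derivative_eq_intros)
qed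

section \<open>Time-independent test functions: kernels, components of the flow, constants\<close>

lemma test_functionI:
  assumes "\<And>x. (\<phi> has_derivative (\<lambda>h. inner (D x) h)) (at x)" "continuous_on UNIV D" "periodic_x \<phi>"
  shows "test_function (\<lambda>x t. \<phi> x) (\<lambda>z. (D (fst z), 0))"
  unfolding test_function_def
proof (intro conjI allI)
  fix z :: "(real \<times> real) \<times> real"
  have "((\<lambda>w. \<phi> (fst w)) has_derivative (\<lambda>h. inner (D (fst z)) (fst h))) (at z)"
    by (rule has_derivative_compose[OF has_derivative_fst[OF has_derivative_ident] assms(1)])
  then show "((\<lambda>w. \<phi> (fst w)) has_derivative inner (D (fst z), 0)) (at z)"
    by (rule has_derivative_eq_rhs) (simp add: fun_eq_iff inner_prod_def)
  show "continuous_on UNIV (\<lambda>z::(real \<times> real) \<times> real. (D (fst z), 0::real))"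
    by (intro continuous_intros continuous_on_compose2[OF assms(2)]) auto
qed (use assms in auto)

text \<open>This is where exact periodicity of the kernel pays off: it can be inserted directly into
  the weak formulation. The gradient is taken in y, hence the minus sign.\<close>

lemma test_function_ker2: "test_function (\<lambda>y t. ker2 n (x - y)) (\<lambda>z. (- ker2_grad n (x - fst z), 0))"
proof (rule test_functionI)
  fix y
  have "((\<lambda>y. ker n (fst x - fst y) * ker n (snd x - snd y)) has_derivative
     (\<lambda>h. ker n (fst x - fst y) * ((0 - snd h) * ker' n (snd x - snd y)) + ((0 - fst h) * ker' n (fst x - fst y)) * ker n (snd x - snd y))) (at y)"
    by (intro has_derivative_mult DERIV_compose_FDERIV[OF DERIV_ker] has_derivative_diff has_derivative_const
        has_derivative_fst has_derivative_snd has_derivative_ident)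
  then show "((\<lambda>y. ker2 n (x - y)) has_derivative inner (- ker2_grad n (x - y))) (at y)"
    unfolding ker2_def ker2_grad_def fst_diff snd_diff
    by (rule has_derivative_eq_rhs) (auto simp: fun_eq_iff inner_prod_def algebra_simps)
next
  show "periodic_x (\<lambda>y. ker2 n (x - y))"
    unfolding periodic_x_def ker2_def
  proof (intro allI)
    fix a b :: real and k l :: int
    show "ker n (fst (x - (a + of_int k, b + of_int l))) * ker n (snd (x - (a + of_int k, b + of_int l))) =
       ker n (fst (x - (a, b))) * ker n (snd (x - (a, b)))"
      using ker_periodic(1)[of n "fst x - a" "-k"] ker_periodic(1)[of n "snd x - b" "-l"]
      by (simp add: algebra_simps)
  qed
qed (intro continuous_intros)

lemma test_function_cflow:
  "test_function (\<lambda>y t. fst (cflow m y)) (\<lambda>z. ((- cflow_div m (fst z), cflow_cross m (fst z)), 0))"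
  "test_function (\<lambda>y t. snd (cflow m y)) (\<lambda>z. ((- cflow_cross m (fst z), cflow_div m (fst z)), 0))"
proof -
  show "test_function (\<lambda>y t. fst (cflow m y)) (\<lambda>z. ((- cflow_div m (fst z), cflow_cross m (fst z)), 0))"
  proof (rule test_functionI[of "\<lambda>y. fst (cflow m y)" "\<lambda>x. (- cflow_div m x, cflow_cross m x)"])
    show "((\<lambda>y. fst (cflow m y)) has_derivative inner (- cflow_div m x, cflow_cross m x)) (at x)" for x
      unfolding cflow_alt cflow_div_def cflow_cross_def
      by (auto intro!: derivative_eq_intros simp: fun_eq_iff inner_prod_def power2_eq_square algebra_simps)
    show "periodic_x (\<lambda>y. fst (cflow m y))"
      unfolding periodic_x_def cflow_alt by (simp add: sin_cos_period)
  qed (intro continuous_intros)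
  show "test_function (\<lambda>y t. snd (cflow m y)) (\<lambda>z. ((- cflow_cross m (fst z), cflow_div m (fst z)), 0))"
  proof (rule test_functionI[of "\<lambda>y. snd (cflow m y)" "\<lambda>x. (- cflow_cross m x, cflow_div m x)"])
    show "((\<lambda>y. snd (cflow m y)) has_derivative inner (- cflow_cross m x, cflow_div m x)) (at x)" for x
      unfolding cflow_alt cflow_div_def cflow_cross_def
      by (auto intro!: derivative_eq_intros simp: fun_eq_iff inner_prod_def power2_eq_square algebra_simps)
    show "periodic_x (\<lambda>y. snd (cflow m y))"
      unfolding periodic_x_def cflow_alt by (simp add: sin_cos_period)
  qed (intro continuous_intros)
qed

lemma test_function_1: "test_function (\<lambda>y t. 1) (\<lambda>z. 0)"
  unfolding test_function_def periodic_x_def by (auto intro!: derivative_eq_intros)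

section \<open>Weak solutions\<close>

interpretation tM: pair_sigma_finite "ivl T" Mx for T ..

text \<open>Tonelli with time as the outer variable, as solutions are controlled slice by slice in
  time, while the product measure lists space before time.\<close>

lemma integrable_Mt_I:
  fixes f :: "real \<times> real \<Rightarrow> real \<Rightarrow> real"
  assumes [measurable]: "(\<lambda>z. f (fst z) (snd z)) \<in> borel_measurable borel"
    and ae: "AE t in ivl T. integrable Mx (\<lambda>x. f x t)"
    and i: "integrable (ivl T) (\<lambda>t. LINT x|Mx. \<bar>f x t\<bar>)"
  shows "integrable (Mx \<Otimes>\<^sub>M ivl T) (\<lambda>z. f (fst z) (snd z))"
proof -
  have m: "(\<lambda>z. f (fst z) (snd z)) \<in> borel_measurable (Mx \<Otimes>\<^sub>M ivl T)" by simp
  have "(\<lambda>w. (snd w, fst w)) \<in> ivl T \<Otimes>\<^sub>M Mx \<rightarrow>\<^sub>M Mx \<Otimes>\<^sub>M ivl T" by measurable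
  from measurable_compose[OF this m]
  have m2: "(\<lambda>w. f (snd w) (fst w)) \<in> borel_measurable (ivl T \<Otimes>\<^sub>M Mx)" by simp
  have "integrable (ivl T \<Otimes>\<^sub>M Mx) (\<lambda>w. f (snd w) (fst w))"
    by (rule tM.Fubini_integrable[OF m2]) (use ae i in auto)
  from tM.integrable_product_swap[OF this] show ?thesis by (simp add: split_beta')
qed

text \<open>The weak formulation over the product measures, with one weak gradient g fixed so that
  flux and dissipation can be named.\<close>

locale cellular_solution =
  fixes p \<nu> A :: real and m :: nat
    and \<theta>0 :: "real \<times> real \<Rightarrow> real" and \<theta> :: "real \<times> real \<Rightarrow> real \<Rightarrow> real"
    and g :: "real \<times> real \<Rightarrow> real \<Rightarrow> real \<times> real"
  assumes p: "p > 2" and nu: "\<nu> > 0"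
    and th0_meas [measurable]: "\<theta>0 \<in> borel_measurable borel" and th0_sq: "integrable Mx (\<lambda>x. (\<theta>0 x)\<^sup>2)"
    and th_meas [measurable]: "(\<lambda>z. \<theta> (fst z) (snd z)) \<in> borel_measurable borel"
    and th_sq: "\<And>t. 0 \<le> t \<Longrightarrow> integrable Mx (\<lambda>x. (\<theta> x t)\<^sup>2)"
    and th_cont: "\<And>t. 0 \<le> t \<Longrightarrow> ((\<lambda>s. LINT x|Mx. (\<theta> x s - \<theta> x t)\<^sup>2) \<longlongrightarrow> 0) (at t within {0..})"
    and g_meas [measurable]: "(\<lambda>z. g (fst z) (snd z)) \<in> borel_measurable borel"
    and g_p: "\<And>T. 0 \<le> T \<Longrightarrow> integrable (Mx \<Otimes>\<^sub>M ivl T) (\<lambda>z. norm (g (fst z) (snd z)) powr p)"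
    and grad: "\<And>\<psi> D T. test_function \<psi> D \<Longrightarrow> 0 \<le> T \<Longrightarrow>
        (LINT z|(Mx \<Otimes>\<^sub>M ivl T). \<theta> (fst z) (snd z) *\<^sub>R fst (D z))
        = - (LINT z|(Mx \<Otimes>\<^sub>M ivl T). \<psi> (fst z) (snd z) *\<^sub>R g (fst z) (snd z))"
    and eqn: "\<And>\<psi> D t. test_function \<psi> D \<Longrightarrow> 0 \<le> t \<Longrightarrow>
        (LINT x|Mx. \<theta> x t * \<psi> x t) - (LINT x|Mx. \<theta>0 x * \<psi> x 0)
        = (LINT z|(Mx \<Otimes>\<^sub>M ivl t).
             \<theta> (fst z) (snd z) * snd (D z)
             - inner (A *\<^sub>R cflow m (fst z)) (g (fst z) (snd z)) * \<psi> (fst z) (snd z)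
             - \<nu> * norm (g (fst z) (snd z)) powr (p - 2) * inner (g (fst z) (snd z)) (fst (D z)))"
begin

text \<open>The p-Laplacian flux. Its norm is |g|^(p-1), so it lies in the dual space
  L^(p/(p-1)).\<close>

definition q :: "real \<times> real \<Rightarrow> real \<Rightarrow> real \<times> real" where
  "q y t = norm (g y t) powr (p - 2) *\<^sub>R g y t"

text \<open>The dissipation rate of a time slice, up to the factor 2 \<nu>.\<close>

definition N :: "real \<Rightarrow> real" where
  "N t = (LINT y|Mx. norm (g y t) powr p)"

definition E :: "real \<Rightarrow> real" where
  "E t = (LINT x|Mx. (\<theta> x t)\<^sup>2)"

lemma th_comp [measurable]:
  "a \<in> borel_measurable M \<Longrightarrow> b \<in> borel_measurable M \<Longrightarrow> (\<lambda>w. \<theta> (a w) (b w)) \<in> borel_measurable M"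
  using measurable_compose[OF borel_measurable_Pair th_meas, of a M b] by simp

lemma g_comp [measurable]:
  "a \<in> borel_measurable M \<Longrightarrow> b \<in> borel_measurable M \<Longrightarrow> (\<lambda>w. g (a w) (b w)) \<in> borel_measurable M"
  using measurable_compose[OF borel_measurable_Pair g_meas, of a M b] by simp

lemma th_int: "0 \<le> t \<Longrightarrow> integrable Mx (\<lambda>x. \<theta> x t)"
  by (rule integrable_of_square) (use th_sq in \<open>auto intro: Mx.finite_measure_axioms\<close>)

lemma th0_int: "integrable Mx \<theta>0"
  by (rule integrable_of_square) (use th0_sq in \<open>auto intro: Mx.finite_measure_axioms\<close>)

lemma norm_q: "norm (q y t) = norm (g y t) powr (p - 1)"
proof (cases "g y t = 0")
  case False
  then have "norm (g y t) powr (p - 2) * norm (g y t) powr 1 = norm (g y t) powr (p - 1)"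
    using powr_add[of "norm (g y t)" "p - 2" 1] by simp
  then show ?thesis unfolding q_def using False by simp
qed (use p in \<open>auto simp: q_def\<close>)

lemma powr_le_1_powr: "0 \<le> x \<Longrightarrow> 0 \<le> a \<Longrightarrow> a \<le> p \<Longrightarrow> x powr a \<le> 1 + x powr p" for x a :: real
proof (cases "x \<le> 1")
  case True
  assume "0 \<le> x" "0 \<le> a"
  then have "x powr a \<le> 1 powr a" using True by (intro powr_mono2) auto
  then show ?thesis using powr_ge_zero[of x p] powr_one_eq_one[of a] by linarith
next
  case False
  assume "a \<le> p"
  then have "x powr a \<le> x powr p" using False by (intro powr_mono) auto
  then show ?thesis by simp
qed

lemma q_le: "norm (q y t) \<le> 1 + norm (g y t) powr p"
  unfolding norm_q by (rule powr_le_1_powr) (use p in auto)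

lemma g_le: "norm (g y t) \<le> 1 + norm (g y t) powr p"
  using powr_le_1_powr[of "norm (g y t)" 1] p by simp

lemma g2_le: "(norm (g y t))\<^sup>2 \<le> 1 + norm (g y t) powr p"
  using powr_le_1_powr[of "norm (g y t)" 2] p by simp

lemma q_comp [measurable]:
  assumes [measurable]: "a \<in> borel_measurable M" "b \<in> borel_measurable M"
  shows "(\<lambda>w. q (a w) (b w)) \<in> borel_measurable M"
  unfolding q_def by measurable

lemma gq_product_int:
  assumes T: "0 \<le> T"
  shows "integrable (Mx \<Otimes>\<^sub>M ivl T) (\<lambda>z. g (fst z) (snd z))" "integrable (Mx \<Otimes>\<^sub>M ivl T) (\<lambda>z. q (fst z) (snd z))"
    "integrable (Mx \<Otimes>\<^sub>M ivl T) (\<lambda>z. (norm (g (fst z) (snd z)))\<^sup>2)"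
proof -
  interpret fm: finite_measure "Mx \<Otimes>\<^sub>M ivl T"
    by (rule finite_measure_pair_measure) unfold_locales
  have b: "integrable (Mx \<Otimes>\<^sub>M ivl T) (\<lambda>z. 1 + norm (g (fst z) (snd z)) powr p)"
    using g_p[OF T] by auto
  show "integrable (Mx \<Otimes>\<^sub>M ivl T) (\<lambda>z. g (fst z) (snd z))"
    by (rule Bochner_Integration.integrable_bound[OF b]) (auto intro!: AE_I2 order_trans[OF g_le])
  show "integrable (Mx \<Otimes>\<^sub>M ivl T) (\<lambda>z. q (fst z) (snd z))"
    by (rule Bochner_Integration.integrable_bound[OF b]) (auto intro!: AE_I2 order_trans[OF q_le])
  show "integrable (Mx \<Otimes>\<^sub>M ivl T) (\<lambda>z. (norm (g (fst z) (snd z)))\<^sup>2)"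
    by (rule Bochner_Integration.integrable_bound[OF b]) (auto intro!: AE_I2 order_trans[OF g2_le])
qed

lemma N_int:
  assumes T: "0 \<le> T"
  shows "integrable (ivl T) N" "(LINT t|ivl T. N t) = (LINT z|(Mx \<Otimes>\<^sub>M ivl T). norm (g (fst z) (snd z)) powr p)"
    "AE t in ivl T. integrable Mx (\<lambda>y. norm (g y t) powr p)"
proof -
  have i: "integrable (Mx \<Otimes>\<^sub>M ivl T) (case_prod (\<lambda>y t. norm (g y t) powr p))"
    using g_p[OF T] by (simp add: split_beta')
  show "integrable (ivl T) N" unfolding N_def[abs_def] by (rule Mt.integrable_snd[OF i])
  show "(LINT t|ivl T. N t) = (LINT z|(Mx \<Otimes>\<^sub>M ivl T). norm (g (fst z) (snd z)) powr p)"
    unfolding N_def using Mt.integral_snd[OF i] by (simp add: split_beta')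
  show "AE t in ivl T. integrable Mx (\<lambda>y. norm (g y t) powr p)" by (rule Mt.AE_integrable_snd[OF i])
qed

lemma N_nonneg: "0 \<le> N t" unfolding N_def by simp

lemma E_nonneg: "0 \<le> E t" unfolding E_def by simp

text \<open>Continuity into L^2 bounds E near each time, and compactness of [0, T] does the rest.
  Joint integrability of the solution on space-time rests on this; the energy identity, which gives
  more, itself depends on that integrability.\<close>

lemma E_bounded:
  obtains B where "B \<ge> 0" "\<And>t. 0 \<le> t \<Longrightarrow> t \<le> T \<Longrightarrow> E t \<le> B"
proof -
  have "\<exists>U. open U \<and> t \<in> U \<and> (\<forall>s\<in>U. 0 \<le> s \<longrightarrow> E s \<le> 2 * E t + 2)" if t: "0 \<le> t" for t
  proof -
    have "\<forall>\<^sub>F s in at t within {0..}. (LINT x|Mx. (\<theta> x s - \<theta> x t)\<^sup>2) < 1"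
      by (rule order_tendstoD(2)[OF th_cont[OF t]]) simp
    then obtain U where U: "open U" "t \<in> U" "\<And>s. s \<in> U \<Longrightarrow> s \<noteq> t \<Longrightarrow> 0 \<le> s \<Longrightarrow> (LINT x|Mx. (\<theta> x s - \<theta> x t)\<^sup>2) < 1"
      unfolding eventually_at_topological by auto
    have "E s \<le> 2 * E t + 2" if s: "s \<in> U" "0 \<le> s" for s
    proof (cases "s = t")
      case True
      then show ?thesis using E_nonneg[of t] by simp
    next
      case False
      have d: "integrable Mx (\<lambda>x. (\<theta> x s - \<theta> x t)\<^sup>2)"
        using th_sq[OF s(2)] th_sq[OF t] integrable_mult_of_squares[of "\<lambda>x. \<theta> x s" Mx "\<lambda>x. \<theta> x t"]
        by (simp add: power2_diff mult.assoc)
      have "E s \<le> (LINT x|Mx. 2 * (\<theta> x s - \<theta> x t)\<^sup>2 + 2 * (\<theta> x t)\<^sup>2)"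
        unfolding E_def
      proof (rule integral_mono)
        fix x
        show "(\<theta> x s)\<^sup>2 \<le> 2 * (\<theta> x s - \<theta> x t)\<^sup>2 + 2 * (\<theta> x t)\<^sup>2"
          using zero_le_power2[of "\<theta> x s - 2 * \<theta> x t"] by (simp add: power2_eq_square algebra_simps)
      qed (use th_sq s t d in auto)
      also have "\<dots> = 2 * (LINT x|Mx. (\<theta> x s - \<theta> x t)\<^sup>2) + 2 * E t"
        unfolding E_def using d th_sq[OF t] by simp
      finally show ?thesis using U(3)[OF s(1) False s(2)] by simp
    qed
    then show ?thesis using U by blast
  qed
  then obtain U where U: "\<And>t. 0 \<le> t \<Longrightarrow> open (U t)" "\<And>t. 0 \<le> t \<Longrightarrow> t \<in> U t"
    "\<And>t s. 0 \<le> t \<Longrightarrow> s \<in> U t \<Longrightarrow> 0 \<le> s \<Longrightarrow> E s \<le> 2 * E t + 2" by metis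
  obtain C where C: "C \<subseteq> {0..T}" "finite C" "{0..T} \<subseteq> (\<Union>t\<in>C. U t)"
  proof (rule compactE_image[of "{0..T}" "{0..T}" U])
    show "{0..T} \<subseteq> (\<Union>t\<in>{0..T}. U t)" using U(2) by force
  qed (use U(1) in auto)
  show thesis
  proof (rule that)
    show "0 \<le> (\<Sum>t\<in>C. 2 * E t + 2)" using E_nonneg by (intro sum_nonneg) (simp add: add_nonneg_nonneg)
    fix t assume t: "0 \<le> t" "t \<le> T"
    then obtain r where r: "r \<in> C" "t \<in> U r" using C by force
    then have "E t \<le> 2 * E r + 2" using U(3)[of r t] C t by force
    also have "\<dots> \<le> (\<Sum>t\<in>C. 2 * E t + 2)"
      by (rule member_le_sum[OF r(1)]) (use C E_nonneg in \<open>auto simp: add_nonneg_nonneg\<close>)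
    finally show "E t \<le> (\<Sum>t\<in>C. 2 * E t + 2)" .
  qed
qed

lemma th_product_int:
  assumes T: "0 \<le> T"
  shows "integrable (Mx \<Otimes>\<^sub>M ivl T) (\<lambda>z. \<theta> (fst z) (snd z))" "integrable (Mx \<Otimes>\<^sub>M ivl T) (\<lambda>z. (\<theta> (fst z) (snd z))\<^sup>2)"
proof -
  obtain B where B: "B \<ge> 0" "\<And>t. 0 \<le> t \<Longrightarrow> t \<le> T \<Longrightarrow> E t \<le> B" using E_bounded[of T] by auto
  have AEi: "AE t in ivl T. 0 \<le> t \<and> t \<le> T" unfolding AE_ivl by auto
  show i2: "integrable (Mx \<Otimes>\<^sub>M ivl T) (\<lambda>z. (\<theta> (fst z) (snd z))\<^sup>2)"
  proof (rule integrable_Mt_I[where f="\<lambda>x t. (\<theta> x t)\<^sup>2"])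
    show "AE t in ivl T. integrable Mx (\<lambda>x. (\<theta> x t)\<^sup>2)" using AEi th_sq by (auto elim: eventually_mono)
    have "(\<lambda>t. LINT x|Mx. (\<theta> x t)\<^sup>2) \<in> borel_measurable (ivl T)"
    proof -
      have a: "(\<lambda>w. (snd w, fst w)) \<in> ivl T \<Otimes>\<^sub>M Mx \<rightarrow>\<^sub>M Mx \<Otimes>\<^sub>M ivl T" by measurable
      have b: "(\<lambda>z. (\<theta> (fst z) (snd z))\<^sup>2) \<in> borel_measurable (Mx \<Otimes>\<^sub>M ivl T)" by simp
      have "(\<lambda>w. (\<theta> (snd w) (fst w))\<^sup>2) \<in> borel_measurable (ivl T \<Otimes>\<^sub>M Mx)"
        using measurable_compose[OF a b] by simp
      then show ?thesis
        by (intro Mx.borel_measurable_lebesgue_integral) (simp add: split_beta')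
    qed
    moreover have "AE t in ivl T. norm (LINT x|Mx. \<bar>(\<theta> x t)\<^sup>2\<bar>) \<le> B"
      using AEi by eventually_elim (use B E_nonneg in \<open>auto simp: E_def[symmetric]\<close>)
    ultimately show "integrable (ivl T) (\<lambda>t. LINT x|Mx. \<bar>(\<theta> x t)\<^sup>2\<bar>)"
      by (intro ivl.integrable_const_bound[where B=B]) auto
  qed simp
  interpret fm: finite_measure "Mx \<Otimes>\<^sub>M ivl T"
    by (rule finite_measure_pair_measure) unfold_locales
  show "integrable (Mx \<Otimes>\<^sub>M ivl T) (\<lambda>z. \<theta> (fst z) (snd z))"
    by (rule integrable_of_square) (use i2 in \<open>auto intro: fm.finite_measure_axioms\<close>)
qed

text \<open>Testing with the kernel on [0, T] for every T says that the difference of the two sides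
  has a vanishing primitive in time. Both components are treated separately because
  \<open>AE_zero_of_primitive_zero\<close> is about real functions.\<close>

lemma slice_gradient_point:
  assumes T: "0 \<le> T"
  shows "AE t in ivl T. mol_grad n (\<lambda>y. \<theta> y t) x = mol n (\<lambda>y. g y t) x"
proof -
  define a where "a t = mol_grad n (\<lambda>y. \<theta> y t) x - mol n (\<lambda>y. g y t) x" for t
  have i1: "integrable (Mx \<Otimes>\<^sub>M ivl T) (case_prod (\<lambda>y t. \<theta> y t *\<^sub>R ker2_grad n (x - y)))" if T: "0 \<le> T" for T
  proof -
    have "(\<lambda>z. ker2_grad n (x - fst z)) \<in> borel_measurable (borel :: ((real\<times>real)\<times>real) measure)"
      by (intro borel_measurable_continuous_onI continuous_intros)
    then have "integrable (Mx \<Otimes>\<^sub>M ivl T) (\<lambda>z. \<theta> (fst z) (snd z) *\<^sub>R ker2_grad n (x - fst z))"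
      by (intro integrable_scaleR_bounded[where C="ker2_grad_bd n"] th_product_int(1)[OF T]) (auto simp: ker2_grad_le)
    then show ?thesis by (simp add: split_beta')
  qed
  have i2: "integrable (Mx \<Otimes>\<^sub>M ivl T) (case_prod (\<lambda>y t. ker2 n (x - y) *\<^sub>R g y t))" if T: "0 \<le> T" for T
  proof -
    have "(\<lambda>z. ker2 n (x - fst z)) \<in> borel_measurable (borel :: ((real\<times>real)\<times>real) measure)"
      by (intro borel_measurable_continuous_onI continuous_intros)
    then have "integrable (Mx \<Otimes>\<^sub>M ivl T) (\<lambda>z. ker2 n (x - fst z) *\<^sub>R g (fst z) (snd z))"
      by (intro integrable_bounded_scaleR[where C="ker2_bd n"] gq_product_int(1)[OF T]) (auto simp: ker2_abs_le)
    then show ?thesis by (simp add: split_beta')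
  qed
  have ai: "integrable (ivl T) a" if T: "0 \<le> T" for T
    unfolding a_def mol_grad_def mol_def by (intro Bochner_Integration.integrable_diff Mt.integrable_snd i1 i2 T)
  have a0: "(LINT t|ivl T. a t) = 0" if T: "0 \<le> T" for T
  proof -
    have "(LINT z|(Mx \<Otimes>\<^sub>M ivl T). \<theta> (fst z) (snd z) *\<^sub>R - ker2_grad n (x - fst z))
        = - (LINT z|(Mx \<Otimes>\<^sub>M ivl T). ker2 n (x - fst z) *\<^sub>R g (fst z) (snd z))"
      using grad[OF test_function_ker2[of n x] T] by simp
    then have "(LINT z|(Mx \<Otimes>\<^sub>M ivl T). \<theta> (fst z) (snd z) *\<^sub>R ker2_grad n (x - fst z))
        = (LINT z|(Mx \<Otimes>\<^sub>M ivl T). ker2 n (x - fst z) *\<^sub>R g (fst z) (snd z))" by simp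
    moreover have "(LINT t|ivl T. mol_grad n (\<lambda>y. \<theta> y t) x) = (LINT z|(Mx \<Otimes>\<^sub>M ivl T). \<theta> (fst z) (snd z) *\<^sub>R ker2_grad n (x - fst z))"
      unfolding mol_grad_def using Mt.integral_snd[OF i1[OF T]] by (simp add: split_beta')
    moreover have "(LINT t|ivl T. mol n (\<lambda>y. g y t) x) = (LINT z|(Mx \<Otimes>\<^sub>M ivl T). ker2 n (x - fst z) *\<^sub>R g (fst z) (snd z))"
      unfolding mol_def using Mt.integral_snd[OF i2[OF T]] by (simp add: split_beta')
    moreover have "integrable (ivl T) (\<lambda>t. mol_grad n (\<lambda>y. \<theta> y t) x)" "integrable (ivl T) (\<lambda>t. mol n (\<lambda>y. g y t) x)"
      unfolding mol_grad_def mol_def by (intro Mt.integrable_snd i1 i2 T)+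
    ultimately show ?thesis unfolding a_def by simp
  qed
  have "AE t in ivl T. fst (a t) = 0"
  proof (rule AE_zero_of_primitive_zero)
    show "integrable (ivl T) (\<lambda>t. fst (a t))" by (rule integrable_bounded_linear[OF bounded_linear_fst ai[OF T]])
    show "(LINT s|ivl t. fst (a s)) = 0" if "0 \<le> t" for t
      using integral_bounded_linear[OF bounded_linear_fst ai[OF that]] a0[OF that] by simp
  qed
  moreover have "AE t in ivl T. snd (a t) = 0"
  proof (rule AE_zero_of_primitive_zero)
    show "integrable (ivl T) (\<lambda>t. snd (a t))" by (rule integrable_bounded_linear[OF bounded_linear_snd ai[OF T]])
    show "(LINT s|ivl t. snd (a s)) = 0" if "0 \<le> t" for t
      using integral_bounded_linear[OF bounded_linear_snd ai[OF that]] a0[OF that] by simp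
  qed
  ultimately show ?thesis
  proof eventually_elim
    case (elim t)
    then have "a t = 0" by (simp add: prod_eq_iff)
    then show ?case unfolding a_def by simp
  qed
qed

text \<open>The exceptional null set of \<open>slice_gradient_point\<close> depends on n and x. The
  union over all n and all rational points is still null, and continuity of both sides in x extends
  the identity to every point.\<close>

lemma slice_gradient:
  assumes T: "0 \<le> T"
  shows "AE t in ivl T. wgrad (\<lambda>y. \<theta> y t) (\<lambda>y. g y t) \<and> integrable Mx (\<lambda>y. norm (g y t) powr p) \<and> 0 \<le> t \<and> t \<le> T"
proof -
  define Q where "Q = (\<rat> \<times> \<rat> :: (real \<times> real) set)"
  have cQ: "countable Q" unfolding Q_def by (simp add: countable_rat)
  have dQ: "closure Q = UNIV" unfolding Q_def closure_Times Rats_closure_real by simp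
  have "AE t in ivl T. \<forall>n. \<forall>x\<in>Q. mol_grad n (\<lambda>y. \<theta> y t) x = mol n (\<lambda>y. g y t) x"
    unfolding AE_all_countable AE_ball_countable[OF cQ] using slice_gradient_point[OF T] by blast
  moreover have "AE t in ivl T. 0 \<le> t \<and> t \<le> T" unfolding AE_ivl by auto
  ultimately show ?thesis using N_int(3)[OF T]
  proof eventually_elim
    case (elim t)
    have g2: "integrable Mx (\<lambda>x. (norm (g x t))\<^sup>2)"
      by (rule Bochner_Integration.integrable_bound[of Mx "\<lambda>y. 1 + norm (g y t) powr p"])
        (use elim in \<open>auto intro!: AE_I2 order_trans[OF g2_le]\<close>)
    have gi: "integrable Mx (\<lambda>x. g x t)"
      by (rule integrable_of_square) (use g2 in \<open>auto intro: Mx.finite_measure_axioms\<close>)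
    have "mol_grad n (\<lambda>y. \<theta> y t) x = mol n (\<lambda>y. g y t) x" for n x
    proof -
      have "continuous_on (closure Q) (\<lambda>x. mol_grad n (\<lambda>y. \<theta> y t) x - mol n (\<lambda>y. g y t) x)"
        unfolding dQ using elim by (intro continuous_intros mol_grad_continuous mol_continuous th_int gi) auto
      then have "mol_grad n (\<lambda>y. \<theta> y t) x - mol n (\<lambda>y. g y t) x = 0"
        by (rule continuous_constant_on_closure) (use elim dQ in auto)
      then show ?thesis by simp
    qed
    then show ?case unfolding wgrad_def using elim g2 th_sq[of t] by auto
  qed
qed

text \<open>The time derivative of the mollified solution at x, read off from the weak formulation
  with the kernel as test function. The diffusive term carries a plus sign because differentiation
  in y reverses the sign of \<open>ker2_grad\<close>.\<close>

definition Fn :: "nat \<Rightarrow> real \<times> real \<Rightarrow> real \<Rightarrow> real" where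
  "Fn n x s = - (A * mol n (\<lambda>y. inner (cflow m y) (g y s)) x) + \<nu> * (LINT y|Mx. inner (q y s) (ker2_grad n (x - y)))"

lemma Fi_product_int:
  assumes T: "0 \<le> T"
  shows "integrable (Mx \<Otimes>\<^sub>M ivl T) (case_prod (\<lambda>y s. ker2 n (x - y) * inner (cflow m y) (g y s)))"
    "integrable (Mx \<Otimes>\<^sub>M ivl T) (case_prod (\<lambda>y s. inner (q y s) (ker2_grad n (x - y))))"
proof -
  have mm: "(\<lambda>z. ker2 n (x - fst z)) \<in> borel_measurable (borel :: ((real\<times>real)\<times>real) measure)"
    "(\<lambda>z. ker2_grad n (x - fst z)) \<in> borel_measurable (borel :: ((real\<times>real)\<times>real) measure)"
    "(\<lambda>z. cflow m (fst z)) \<in> borel_measurable (borel :: ((real\<times>real)\<times>real) measure)"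
    by (intro borel_measurable_continuous_onI continuous_intros,
        intro borel_measurable_continuous_onI continuous_intros,
        intro borel_measurable_continuous_onI continuous_on_compose2[OF cflow_continuous continuous_on_fst[OF continuous_on_id]], simp)
  note [measurable] = mm
  have "integrable (Mx \<Otimes>\<^sub>M ivl T) (\<lambda>z. ker2 n (x - fst z) * inner (cflow m (fst z)) (g (fst z) (snd z)))"
  proof (rule Bochner_Integration.integrable_bound)
    show "integrable (Mx \<Otimes>\<^sub>M ivl T) (\<lambda>z. ker2_bd n * (16 * norm (g (fst z) (snd z))))"
      using gq_product_int(1)[OF T] by auto
    show "AE z in Mx \<Otimes>\<^sub>M ivl T. norm (ker2 n (x - fst z) * inner (cflow m (fst z)) (g (fst z) (snd z))) \<le> norm (ker2_bd n * (16 * norm (g (fst z) (snd z))))"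
    proof (rule AE_I2)
      fix z
      have "\<bar>inner (cflow m (fst z)) (g (fst z) (snd z))\<bar> \<le> 16 * norm (g (fst z) (snd z))"
        using Cauchy_Schwarz_ineq2[of "cflow m (fst z)" "g (fst z) (snd z)"] mult_right_mono[OF cflow_norm_le[of m "fst z"], of "norm (g (fst z) (snd z))"] by simp
      then have "\<bar>ker2 n (x - fst z)\<bar> * \<bar>inner (cflow m (fst z)) (g (fst z) (snd z))\<bar> \<le> ker2_bd n * (16 * norm (g (fst z) (snd z)))"
        by (intro mult_mono ker2_abs_le) (use ker2_bd_pos[of n] in auto)
      then show "norm (ker2 n (x - fst z) * inner (cflow m (fst z)) (g (fst z) (snd z))) \<le> norm (ker2_bd n * (16 * norm (g (fst z) (snd z))))"
        using ker2_bd_pos[of n] by (simp add: abs_mult)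
    qed
  qed measurable
  then show "integrable (Mx \<Otimes>\<^sub>M ivl T) (case_prod (\<lambda>y s. ker2 n (x - y) * inner (cflow m y) (g y s)))" by (simp add: split_beta')
  have "integrable (Mx \<Otimes>\<^sub>M ivl T) (\<lambda>z. inner (q (fst z) (snd z)) (ker2_grad n (x - fst z)))"
  proof (rule Bochner_Integration.integrable_bound)
    show "integrable (Mx \<Otimes>\<^sub>M ivl T) (\<lambda>z. norm (q (fst z) (snd z)) * ker2_grad_bd n)"
      using gq_product_int(2)[OF T] by auto
    show "AE z in Mx \<Otimes>\<^sub>M ivl T. norm (inner (q (fst z) (snd z)) (ker2_grad n (x - fst z))) \<le> norm (norm (q (fst z) (snd z)) * ker2_grad_bd n)"
    proof (rule AE_I2)
      fix z
      have "\<bar>inner (q (fst z) (snd z)) (ker2_grad n (x - fst z))\<bar> \<le> norm (q (fst z) (snd z)) * ker2_grad_bd n"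
        using Cauchy_Schwarz_ineq2[of "q (fst z) (snd z)" "ker2_grad n (x - fst z)"] mult_left_mono[OF ker2_grad_le[of n "x - fst z"], of "norm (q (fst z) (snd z))"] by simp
      then show "norm (inner (q (fst z) (snd z)) (ker2_grad n (x - fst z))) \<le> norm (norm (q (fst z) (snd z)) * ker2_grad_bd n)"
        using ker2_grad_bd_pos[of n] by simp
    qed
  qed measurable
  then show "integrable (Mx \<Otimes>\<^sub>M ivl T) (case_prod (\<lambda>y s. inner (q y s) (ker2_grad n (x - y))))" by (simp add: split_beta')
qed

lemma Fn_int:
  assumes T: "0 \<le> T"
  shows "integrable (ivl T) (Fn n x)"
  unfolding Fn_def[abs_def] mol_def real_scaleR_def
  by (intro Bochner_Integration.integrable_add integrable_minus integrable_mult_right Mt.integrable_snd Fi_product_int T)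

lemma evolution:
  assumes t: "0 \<le> t"
  shows "mol n (\<lambda>y. \<theta> y t) x = mol n \<theta>0 x + (LINT s|ivl t. Fn n x s)"
proof -
  note i = Fi_product_int[OF t, of n x]
  have "mol n (\<lambda>y. \<theta> y t) x - mol n \<theta>0 x =
    (LINT z|(Mx \<Otimes>\<^sub>M ivl t). - A * (ker2 n (x - fst z) * inner (cflow m (fst z)) (g (fst z) (snd z)))
      + \<nu> * inner (q (fst z) (snd z)) (ker2_grad n (x - fst z)))"
    using eqn[OF test_function_ker2[of n x] t] unfolding mol_def q_def by (simp add: mult_ac)
  also have "\<dots> = - A * (LINT z|(Mx \<Otimes>\<^sub>M ivl t). ker2 n (x - fst z) * inner (cflow m (fst z)) (g (fst z) (snd z)))
      + \<nu> * (LINT z|(Mx \<Otimes>\<^sub>M ivl t). inner (q (fst z) (snd z)) (ker2_grad n (x - fst z)))"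
    using i by (subst Bochner_Integration.integral_add) (auto simp: split_beta')
  also have "(LINT z|(Mx \<Otimes>\<^sub>M ivl t). ker2 n (x - fst z) * inner (cflow m (fst z)) (g (fst z) (snd z)))
    = (LINT s|ivl t. LINT y|Mx. ker2 n (x - y) * inner (cflow m y) (g y s))"
    using Mt.integral_snd[OF i(1)] by (simp add: split_beta')
  also have "(LINT z|(Mx \<Otimes>\<^sub>M ivl t). inner (q (fst z) (snd z)) (ker2_grad n (x - fst z)))
    = (LINT s|ivl t. LINT y|Mx. inner (q y s) (ker2_grad n (x - y)))"
    using Mt.integral_snd[OF i(2)] by (simp add: split_beta')
  also have "- A * (LINT s|ivl t. LINT y|Mx. ker2 n (x - y) * inner (cflow m y) (g y s)) + \<nu> * (LINT s|ivl t. LINT y|Mx. inner (q y s) (ker2_grad n (x - y)))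
    = (LINT s|ivl t. Fn n x s)"
    unfolding Fn_def mol_def real_scaleR_def
    using Mt.integrable_snd[OF i(1)] Mt.integrable_snd[OF i(2)]
    by (subst Bochner_Integration.integral_add) auto
  finally show ?thesis by simp
qed

end

section \<open>The energy identity\<close>

text \<open>For a divergence-free u the integrand is half of div (u F^2); the two terms with
  \<open>cflow_div\<close> cancel.\<close>

lemma periodic_C1_transport_zero:
  assumes F: "periodic_C1 F F1 F2"
  shows "(LINT x|Mx. F x * inner (cflow m x) (F1 x, F2 x)) = 0"
proof -
  note FF = periodic_C1_mult[OF F F]
  note a = periodic_C1_integral_derivative(1)[OF periodic_C1_mult[OF cflow_periodic_C1(1)[of m] FF]]
    and b = periodic_C1_integral_derivative(2)[OF periodic_C1_mult[OF cflow_periodic_C1(2)[of m] FF]]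
  note c = F[unfolded periodic_C1_def]
  have ci[continuous_intros]: "continuous_on UNIV F" "continuous_on UNIV F1" "continuous_on UNIV F2" using c by auto
  have i: "integrable Mx (\<lambda>x. - cflow_div m x * (F x * F x) + (F1 x * F x + F1 x * F x) * fst (cflow m x))"
    "integrable Mx (\<lambda>x. cflow_div m x * (F x * F x) + (F2 x * F x + F2 x * F x) * snd (cflow m x))"
    by (intro Mx_integral_continuous(1) continuous_intros)+
  have "2 * (LINT x|Mx. F x * inner (cflow m x) (F1 x, F2 x)) = (LINT x|Mx. 2 * (F x * inner (cflow m x) (F1 x, F2 x)))"
    by simp
  also have "\<dots> = (LINT x|Mx. (- cflow_div m x * (F x * F x) + (F1 x * F x + F1 x * F x) * fst (cflow m x))
      + (cflow_div m x * (F x * F x) + (F2 x * F x + F2 x * F x) * snd (cflow m x)))"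
    by (intro Bochner_Integration.integral_cong) (auto simp: inner_prod_def algebra_simps)
  also have "\<dots> = 0" unfolding Bochner_Integration.integral_add[OF i] a b by simp
  finally show ?thesis by simp
qed

text \<open>The commutator of mollification and transport is of the order of the kernel radius.\<close>

definition commutator :: "nat \<Rightarrow> nat \<Rightarrow> (real \<times> real \<Rightarrow> real \<times> real) \<Rightarrow> real \<times> real \<Rightarrow> real" where
  "commutator m n G x = mol n (\<lambda>y. inner (cflow m y) (G y)) x - inner (cflow m x) (mol n G x)"

lemma cflow_inner_integrable:
  assumes G: "integrable Mx G"
  shows "integrable Mx (\<lambda>y. inner (cflow m y) (G y))"
proof (rule Bochner_Integration.integrable_bound)
  show "integrable Mx (\<lambda>y. 16 * norm (G y))" using G by auto
  show "AE y in Mx. norm (inner (cflow m y) (G y)) \<le> norm (16 * norm (G y))"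
  proof (rule AE_I2)
    fix y
    show "norm (inner (cflow m y) (G y)) \<le> norm (16 * norm (G y))"
      using Cauchy_Schwarz_ineq2[of "cflow m y" "G y"] mult_right_mono[OF cflow_norm_le[of m y], of "norm (G y)"] by simp
  qed
qed (use G in auto)

text \<open>The commutator is the kernel average of (u(y) - u(x)) . G(y), and on the support of the
  kernel the flow varies by at most 64 m/(n + 1). Keeping the mollified |G|^2 on the right allows
  both an L^2 bound, by integration, and a pointwise one.\<close>

lemma commutator_bound:
  assumes [measurable]: "G \<in> borel_measurable borel" and G2: "integrable Mx (\<lambda>x. (norm (G x))\<^sup>2)"
  shows "(commutator m n G x)\<^sup>2 \<le> (64 * real m / (real n + 1))\<^sup>2 * mol n (\<lambda>y. (norm (G y))\<^sup>2) x"
proof -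
  define c where "c = 64 * real m / (real n + 1)"
  have Gi: "integrable Mx G"
    by (rule integrable_of_square) (use G2 in \<open>auto intro: Mx.finite_measure_axioms\<close>)
  have Gn: "integrable Mx (\<lambda>y. norm (G y))" using Gi by simp
  have e1: "inner (cflow m x) (mol n G x) = (LINT y|Mx. ker2 n (x - y) * inner (cflow m x) (G y))"
    unfolding mol_def using mol_integrable[OF Gi, of n x]
    by (subst integral_inner_right[symmetric]) (auto simp: inner_scaleR_right)
  have i1: "integrable Mx (\<lambda>y. ker2 n (x - y) * inner (cflow m x) (G y))"
    using integrable_inner_right[OF mol_integrable[OF Gi, of n x], of "cflow m x"] by (simp add: inner_scaleR_right)
  have i2: "integrable Mx (\<lambda>y. ker2 n (x - y) * inner (cflow m y) (G y))"
    using mol_integrable[OF cflow_inner_integrable[OF Gi], of n x] by simp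
  have "commutator m n G x = (LINT y|Mx. ker2 n (x - y) * inner (cflow m y) (G y) - ker2 n (x - y) * inner (cflow m x) (G y))"
    unfolding commutator_def e1 unfolding mol_def real_scaleR_def by (rule Bochner_Integration.integral_diff[OF i2 i1, symmetric])
  then have "\<bar>commutator m n G x\<bar> \<le> (LINT y|Mx. \<bar>ker2 n (x - y) * inner (cflow m y) (G y) - ker2 n (x - y) * inner (cflow m x) (G y)\<bar>)"
    using integral_norm_bound[of Mx "\<lambda>y. ker2 n (x - y) * inner (cflow m y) (G y) - ker2 n (x - y) * inner (cflow m x) (G y)"] by simp
  also have "\<dots> \<le> (LINT y|Mx. c * (ker2 n (x - y) * norm (G y)))"
  proof (rule integral_mono)
    show "integrable Mx (\<lambda>y. \<bar>ker2 n (x - y) * inner (cflow m y) (G y) - ker2 n (x - y) * inner (cflow m x) (G y)\<bar>)"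
      using i1 i2 by auto
    show "integrable Mx (\<lambda>y. c * (ker2 n (x - y) * norm (G y)))" using mol_integrable[OF Gn, of n x] by simp
    fix y
    show "\<bar>ker2 n (x - y) * inner (cflow m y) (G y) - ker2 n (x - y) * inner (cflow m x) (G y)\<bar> \<le> c * (ker2 n (x - y) * norm (G y))"
    proof (cases "ker2 n (x - y) = 0")
      case False
      have "\<bar>ker2 n (x - y) * inner (cflow m y) (G y) - ker2 n (x - y) * inner (cflow m x) (G y)\<bar> = ker2 n (x - y) * \<bar>inner (cflow m x - cflow m y) (G y)\<bar>"
        using ker2_nonneg[of n "x - y"] by (simp add: inner_diff_left abs_mult abs_minus_commute flip: right_diff_distrib)
      also have "\<dots> \<le> ker2 n (x - y) * (norm (cflow m x - cflow m y) * norm (G y))"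
        by (intro mult_left_mono Cauchy_Schwarz_ineq2 ker2_nonneg)
      also have "\<dots> \<le> ker2 n (x - y) * (c * norm (G y))"
        using cflow_diff_le[OF ker2_supp[OF False], of m] unfolding c_def
        by (intro mult_left_mono mult_right_mono ker2_nonneg) auto
      finally show ?thesis by (simp add: mult_ac)
    qed simp
  qed
  also have "\<dots> = c * mol n (\<lambda>y. norm (G y)) x" unfolding mol_def by simp
  finally have "\<bar>commutator m n G x\<bar>\<^sup>2 \<le> (c * mol n (\<lambda>y. norm (G y)) x)\<^sup>2" by (intro power_mono) auto
  also have "\<dots> = c\<^sup>2 * (norm (mol n (\<lambda>y. norm (G y)) x))\<^sup>2" by (simp add: power_mult_distrib)
  also have "\<dots> \<le> c\<^sup>2 * mol n (\<lambda>y. (norm (norm (G y)))\<^sup>2) x"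
    by (intro mult_left_mono mol_sq) (use G2 in auto)
  finally show ?thesis unfolding c_def by simp
qed

lemma commutator_continuous:
  assumes Gi: "integrable Mx G"
  shows "continuous_on UNIV (commutator m n G)"
  unfolding commutator_def[abs_def]
  by (intro continuous_intros mol_continuous cflow_inner_integrable Gi)

section \<open>Energy balance of the mollified solution and its limit\<close>

context cellular_solution
begin

text \<open>The times at which the slice has its weak gradient, with finite L^p norm. Almost every
  time is of this kind, and estimates at a single time are stated for these.\<close>

definition good :: "real \<Rightarrow> bool" where
  "good t \<longleftrightarrow> wgrad (\<lambda>y. \<theta> y t) (\<lambda>y. g y t) \<and> integrable Mx (\<lambda>y. norm (g y t) powr p) \<and> 0 \<le> t"

lemma AE_good: "0 \<le> T \<Longrightarrow> AE t in ivl T. good t \<and> t \<le> T"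
  using slice_gradient[of T] unfolding good_def by (auto elim: eventually_mono)

lemma good_facts:
  assumes s: "good s"
  shows "integrable Mx (\<lambda>y. (norm (g y s))\<^sup>2)" "integrable Mx (\<lambda>y. g y s)" "integrable Mx (\<lambda>y. q y s)"
    "(LINT y|Mx. (norm (g y s))\<^sup>2) \<le> 1 + N s" "(LINT y|Mx. norm (g y s)) \<le> 1 + N s" "(LINT y|Mx. norm (q y s)) \<le> 1 + N s"
    "integrable Mx (\<lambda>y. norm (g y s) powr p)" "mol_grad n (\<lambda>y. \<theta> y s) x = mol n (\<lambda>y. g y s) x" "integrable Mx (\<lambda>y. \<theta> y s)"
proof -
  have gp: "integrable Mx (\<lambda>y. norm (g y s) powr p)" using s unfolding good_def by auto
  then show "integrable Mx (\<lambda>y. norm (g y s) powr p)" .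
  have b: "integrable Mx (\<lambda>y. 1 + norm (g y s) powr p)" using gp by auto
  have bN: "(LINT y|Mx. 1 + norm (g y s) powr p) = 1 + N s" unfolding N_def using gp by simp
  show g2: "integrable Mx (\<lambda>y. (norm (g y s))\<^sup>2)" using s unfolding good_def wgrad_def by auto
  show gi: "integrable Mx (\<lambda>y. g y s)"
    by (rule Bochner_Integration.integrable_bound[OF b]) (auto intro!: AE_I2 order_trans[OF g_le])
  show qi: "integrable Mx (\<lambda>y. q y s)"
    by (rule Bochner_Integration.integrable_bound[OF b]) (auto intro!: AE_I2 order_trans[OF q_le])
  show "(LINT y|Mx. (norm (g y s))\<^sup>2) \<le> 1 + N s" "(LINT y|Mx. norm (g y s)) \<le> 1 + N s" "(LINT y|Mx. norm (q y s)) \<le> 1 + N s"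
    unfolding bN[symmetric] using g2 gi qi b by (auto intro!: integral_mono g2_le g_le q_le)
  show "mol_grad n (\<lambda>y. \<theta> y s) x = mol n (\<lambda>y. g y s) x" using s unfolding good_def wgrad_def by blast
  show "integrable Mx (\<lambda>y. \<theta> y s)" using s th_int unfolding good_def by auto
qed

lemma Fn_decomp:
  "Fn n x s = - (A * (inner (cflow m x) (mol n (\<lambda>y. g y s) x) + commutator m n (\<lambda>y. g y s) x)) + \<nu> * (LINT y|Mx. inner (q y s) (ker2_grad n (x - y)))"
  unfolding Fn_def commutator_def by simp

lemma flux_pairing_bound:
  assumes s: "good s"
  shows "\<bar>LINT y|Mx. inner (q y s) (ker2_grad n (x - y))\<bar> \<le> ker2_grad_bd n * (1 + N s)"
proof -
  have "\<bar>LINT y|Mx. inner (q y s) (ker2_grad n (x - y))\<bar> \<le> (LINT y|Mx. \<bar>inner (q y s) (ker2_grad n (x - y))\<bar>)"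
    using integral_norm_bound[of Mx "\<lambda>y. inner (q y s) (ker2_grad n (x - y))"] by simp
  also have "\<dots> \<le> (LINT y|Mx. ker2_grad_bd n * norm (q y s))"
  proof (rule integral_mono')
    show "integrable Mx (\<lambda>y. ker2_grad_bd n * norm (q y s))" using good_facts(3)[OF s] by auto
    fix y
    show "\<bar>inner (q y s) (ker2_grad n (x - y))\<bar> \<le> ker2_grad_bd n * norm (q y s)"
      using Cauchy_Schwarz_ineq2[of "q y s" "ker2_grad n (x - y)"] mult_left_mono[OF ker2_grad_le[of n "x - y"], of "norm (q y s)"]
      by (simp add: mult.commute)
  qed (use ker2_grad_bd_pos[of n] in auto)
  also have "\<dots> \<le> ker2_grad_bd n * (1 + N s)" using good_facts(6)[OF s] ker2_grad_bd_pos[of n] by simp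
  finally show ?thesis .
qed

definition CF :: "nat \<Rightarrow> real" where "CF n = \<bar>A\<bar> * (ker2_bd n * 16) + \<nu> * ker2_grad_bd n"

lemma Fn_bound:
  assumes s: "good s"
  shows "\<bar>Fn n x s\<bar> \<le> CF n * (1 + N s)"
proof -
  note gf = good_facts[OF s]
  have "\<bar>mol n (\<lambda>y. inner (cflow m y) (g y s)) x\<bar> \<le> ker2_bd n * (LINT y|Mx. \<bar>inner (cflow m y) (g y s)\<bar>)"
    using norm_S_bound[OF cflow_inner_integrable[OF gf(2)], of n m x] by simp
  also have "\<dots> \<le> ker2_bd n * (16 * (1 + N s))"
  proof (intro mult_left_mono)
    have "(LINT y|Mx. \<bar>inner (cflow m y) (g y s)\<bar>) \<le> (LINT y|Mx. 16 * norm (g y s))"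
    proof (rule integral_mono')
      show "integrable Mx (\<lambda>y. 16 * norm (g y s))" using gf(2) by auto
      show "\<bar>inner (cflow m y) (g y s)\<bar> \<le> 16 * norm (g y s)" for y
        using Cauchy_Schwarz_ineq2[of "cflow m y" "g y s"] mult_right_mono[OF cflow_norm_le[of m y], of "norm (g y s)"] by simp
    qed auto
    then show "(LINT y|Mx. \<bar>inner (cflow m y) (g y s)\<bar>) \<le> 16 * (1 + N s)" using gf(5) by simp
  qed (use ker2_bd_pos[of n] in auto)
  finally have a: "\<bar>A\<bar> * \<bar>mol n (\<lambda>y. inner (cflow m y) (g y s)) x\<bar> \<le> \<bar>A\<bar> * (ker2_bd n * (16 * (1 + N s)))"
    by (intro mult_left_mono) auto
  have b: "\<nu> * \<bar>LINT y|Mx. inner (q y s) (ker2_grad n (x - y))\<bar> \<le> \<nu> * (ker2_grad_bd n * (1 + N s))"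
    using flux_pairing_bound[OF s, of n x] nu by (intro mult_left_mono) auto
  have "\<bar>Fn n x s\<bar> \<le> \<bar>A\<bar> * \<bar>mol n (\<lambda>y. inner (cflow m y) (g y s)) x\<bar> + \<nu> * \<bar>LINT y|Mx. inner (q y s) (ker2_grad n (x - y))\<bar>"
    unfolding Fn_def using nu abs_triangle_ineq[of "- (A * mol n (\<lambda>y. inner (cflow m y) (g y s)) x)" "\<nu> * (LINT y|Mx. inner (q y s) (ker2_grad n (x - y)))"]
    by (simp add: abs_mult)
  also have "\<dots> \<le> CF n * (1 + N s)" unfolding CF_def using a b by (simp add: algebra_simps)
  finally show ?thesis .
qed

lemma q_powr: "norm (q y s) powr (p / (p - 1)) = norm (g y s) powr p"
  unfolding norm_q powr_powr using p by simp

lemma mol_fst_snd: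
  fixes G :: "real \<times> real \<Rightarrow> real \<times> real"
  assumes "integrable Mx G"
  shows "fst (mol n G x) = mol n (\<lambda>y. fst (G y)) x" "snd (mol n G x) = mol n (\<lambda>y. snd (G y)) x"
  unfolding mol_def
  using integral_bounded_linear[OF bounded_linear_fst mol_integrable[OF assms, of n x]]
    integral_bounded_linear[OF bounded_linear_snd mol_integrable[OF assms, of n x]] by auto

text \<open>Componentwise weak convergence with the dual exponent p' = p/(p-1): the pairing is
  legitimate because |q|^p' = |g|^p, and the limit integrand is q . g = |g|^p. The second bound, 2 N
  per component by Young's inequality, is uniform in n and serves as majorant in time.\<close>

lemma flux_limit:
  assumes s: "good s"
  shows "(\<lambda>n. LINT x|Mx. inner (q x s) (mol n (mol n (\<lambda>y. g y s)) x)) \<longlonglongrightarrow> N s"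
    "\<bar>LINT x|Mx. inner (q x s) (mol n (mol n (\<lambda>y. g y s)) x)\<bar> \<le> 4 * N s"
proof -
  define p' where "p' = p / (p - 1)"
  have p'1: "p' > 1" and pp: "1/p + 1/p' = 1" unfolding p'_def using p by (auto simp: field_simps)
  note gf = good_facts[OF s]
  have comp: "(\<lambda>n. LINT x|Mx. a x * mol n (mol n b) x) \<longlonglongrightarrow> (LINT x|Mx. a x * b x) \<and>
      (\<forall>n. integrable Mx (\<lambda>x. a x * mol n (mol n b) x) \<and> \<bar>LINT x|Mx. a x * mol n (mol n b) x\<bar> \<le> 2 * N s) \<and> integrable Mx (\<lambda>x. a x * b x)"
    if [measurable]: "a \<in> borel_measurable borel" "b \<in> borel_measurable borel"
      and a: "\<And>x. \<bar>a x\<bar> \<le> norm (q x s)" and b: "\<And>x. \<bar>b x\<bar> \<le> norm (g x s)" for a b :: "real \<times> real \<Rightarrow> real"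
  proof -
    have ab: "\<bar>a x\<bar> powr p' \<le> norm (g x s) powr p" "\<bar>b x\<bar> powr p \<le> norm (g x s) powr p" for x
      using powr_mono2[OF _ _ a[of x], of p'] powr_mono2[OF _ _ b[of x], of p] p'1 p q_powr[of x s] unfolding p'_def by auto
    have ai: "integrable Mx (\<lambda>x. \<bar>a x\<bar> powr p')"
      by (rule Bochner_Integration.integrable_bound[OF gf(7)]) (use ab in auto)
    have bi: "integrable Mx (\<lambda>x. \<bar>b x\<bar> powr p)"
      by (rule Bochner_Integration.integrable_bound[OF gf(7)]) (use ab in auto)
    have aN: "(LINT x|Mx. \<bar>a x\<bar> powr p') \<le> N s" "(LINT x|Mx. \<bar>b x\<bar> powr p) \<le> N s"
      unfolding N_def using ab by (auto intro!: integral_mono ai bi gf(7))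
    have yb: "integrable Mx (\<lambda>x. a x * c x) \<and> \<bar>LINT x|Mx. a x * c x\<bar> \<le> 2 * N s"
      if [measurable]: "c \<in> borel_measurable borel" and ci: "integrable Mx (\<lambda>x. \<bar>c x\<bar> powr p)" "(LINT x|Mx. \<bar>c x\<bar> powr p) \<le> N s" for c
    proof -
      have bd: "\<bar>a x * c x\<bar> \<le> \<bar>a x\<bar> powr p' + \<bar>c x\<bar> powr p" for x
      proof -
        have "\<bar>a x * c x\<bar> \<le> \<bar>a x\<bar> powr p' / p' + \<bar>c x\<bar> powr p / p"
          using Youngs_inequality[OF p'1, of p "\<bar>a x\<bar>" "\<bar>c x\<bar>"] p pp by (simp add: abs_mult add.commute)
        moreover have "\<bar>a x\<bar> powr p' / p' \<le> \<bar>a x\<bar> powr p' / 1" "\<bar>c x\<bar> powr p / p \<le> \<bar>c x\<bar> powr p / 1"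
          using p p'1 by (intro divide_left_mono; simp)+
        ultimately show ?thesis by simp
      qed
      have i: "integrable Mx (\<lambda>x. \<bar>a x\<bar> powr p' + \<bar>c x\<bar> powr p)" using ai ci by auto
      have "\<bar>LINT x|Mx. a x * c x\<bar> \<le> (LINT x|Mx. \<bar>a x * c x\<bar>)"
        using integral_norm_bound[of Mx "\<lambda>x. a x * c x"] by simp
      also have "\<dots> \<le> (LINT x|Mx. \<bar>a x\<bar> powr p' + \<bar>c x\<bar> powr p)"
        by (rule integral_mono'[OF i]) (use bd in auto)
      also have "\<dots> = (LINT x|Mx. \<bar>a x\<bar> powr p') + (LINT x|Mx. \<bar>c x\<bar> powr p)" using ai ci by simp
      finally have "\<bar>LINT x|Mx. a x * c x\<bar> \<le> 2 * N s" using aN ci by simp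
      moreover have "integrable Mx (\<lambda>x. a x * c x)"
        by (rule Bochner_Integration.integrable_bound[OF i]) (use bd in \<open>auto intro!: AE_I2 order_trans[OF _ abs_ge_self]\<close>)
      ultimately show ?thesis by simp
    qed
    have SS: "integrable Mx (\<lambda>x. \<bar>mol n (mol n b) x\<bar> powr p)" "(LINT x|Mx. \<bar>mol n (mol n b) x\<bar> powr p) \<le> N s" for n
    proof -
      have S1: "integrable Mx (\<lambda>x. \<bar>mol n b x\<bar> powr p)" "(LINT x|Mx. \<bar>mol n b x\<bar> powr p) \<le> N s"
        using mol_powr_integral[OF _ bi, of n] p aN by auto
      show "integrable Mx (\<lambda>x. \<bar>mol n (mol n b) x\<bar> powr p)" "(LINT x|Mx. \<bar>mol n (mol n b) x\<bar> powr p) \<le> N s"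
        using mol_powr_integral[OF _ S1(1), of n] S1 p by auto
    qed
    have "(\<lambda>n. LINT x|Mx. a x * (mol n (mol n b) x - b x)) \<longlonglongrightarrow> 0"
      by (rule mol_weak_tendsto(2)[of p p']) (use p pp ai bi in auto)
    moreover have "(LINT x|Mx. a x * (mol n (mol n b) x - b x)) = (LINT x|Mx. a x * mol n (mol n b) x) - (LINT x|Mx. a x * b x)" for n
      using yb[OF _ SS] yb[OF _ bi aN(2)] by (simp add: right_diff_distrib)
    ultimately have "(\<lambda>n. (LINT x|Mx. a x * mol n (mol n b) x) - (LINT x|Mx. a x * b x)) \<longlonglongrightarrow> 0" by simp
    from LIM_zero_cancel[OF this] show ?thesis using yb[OF _ SS] yb[OF _ bi aN(2)] by auto
  qed
  note c1 = comp[of "\<lambda>x. fst (q x s)" "\<lambda>x. fst (g x s)"] and c2 = comp[of "\<lambda>x. snd (q x s)" "\<lambda>x. snd (g x s)"]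
  have m1: "(\<lambda>x. fst (q x s)) \<in> borel_measurable borel" "(\<lambda>x. fst (g x s)) \<in> borel_measurable borel"
    "(\<lambda>x. snd (q x s)) \<in> borel_measurable borel" "(\<lambda>x. snd (g x s)) \<in> borel_measurable borel" by auto
  note c1 = c1[OF m1(1,2) abs_fst_le abs_fst_le] and c2 = c2[OF m1(3,4) abs_snd_le abs_snd_le]
  have gn: "integrable Mx (mol n (\<lambda>y. g y s))" for n
  proof (rule Bochner_Integration.integrable_bound)
    show "integrable Mx (mol n (\<lambda>y. norm (g y s)))" by (rule mol_integral_eq(2)) (use gf(2) in auto)
    show "AE x in Mx. norm (mol n (\<lambda>y. g y s) x) \<le> norm (mol n (\<lambda>y. norm (g y s)) x)"
      using norm_S_le[OF gf(2), of n] by (intro AE_I2) (auto intro: order_trans[OF _ abs_ge_self])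
  qed auto
  have e: "inner (q x s) (mol n (mol n (\<lambda>y. g y s)) x) = fst (q x s) * mol n (mol n (\<lambda>y. fst (g y s))) x + snd (q x s) * mol n (mol n (\<lambda>y. snd (g y s))) x" for n x
    using mol_fst_snd[OF gn, of n n x] mol_fst_snd[OF gf(2), of n] by (simp add: inner_prod_def)
  have e2: "(LINT x|Mx. inner (q x s) (mol n (mol n (\<lambda>y. g y s)) x)) = (LINT x|Mx. fst (q x s) * mol n (mol n (\<lambda>y. fst (g y s))) x)
     + (LINT x|Mx. snd (q x s) * mol n (mol n (\<lambda>y. snd (g y s))) x)" for n
    unfolding e using c1 c2 by simp
  show "\<bar>LINT x|Mx. inner (q x s) (mol n (mol n (\<lambda>y. g y s)) x)\<bar> \<le> 4 * N s"
  proof -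
    have "\<bar>LINT x|Mx. fst (q x s) * mol n (mol n (\<lambda>y. fst (g y s))) x\<bar> \<le> 2 * N s"
      "\<bar>LINT x|Mx. snd (q x s) * mol n (mol n (\<lambda>y. snd (g y s))) x\<bar> \<le> 2 * N s" using c1 c2 by blast+
    then show ?thesis unfolding e2 by linarith
  qed
  have "(\<lambda>n. LINT x|Mx. inner (q x s) (mol n (mol n (\<lambda>y. g y s)) x)) \<longlonglongrightarrow> (LINT x|Mx. fst (q x s) * fst (g x s)) + (LINT x|Mx. snd (q x s) * snd (g x s))"
    unfolding e2 using c1 c2 by (intro tendsto_add) blast+
  also have "(LINT x|Mx. fst (q x s) * fst (g x s)) + (LINT x|Mx. snd (q x s) * snd (g x s)) = (LINT x|Mx. fst (q x s) * fst (g x s) + snd (q x s) * snd (g x s))"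
    using c1 c2 by simp
  also have "\<dots> = N s"
    unfolding N_def
  proof (rule Bochner_Integration.integral_cong)
    fix x
    have "fst (q x s) * fst (g x s) + snd (q x s) * snd (g x s) = norm (g x s) powr (p - 2) * (norm (g x s))\<^sup>2"
      unfolding q_def norm_prod_sq by (simp add: power2_eq_square algebra_simps)
    also have "\<dots> = norm (g x s) powr p"
      using powr_add[of "norm (g x s)" "p - 2" 2] p by (cases "g x s = 0") auto
    finally show "fst (q x s) * fst (g x s) + snd (q x s) * snd (g x s) = norm (g x s) powr p" .
  qed simp
  finally show "(\<lambda>n. LINT x|Mx. inner (q x s) (mol n (mol n (\<lambda>y. g y s)) x)) \<longlonglongrightarrow> N s" .
qed

text \<open>Transport drops out by incompressibility and leaves only its commutator. In the
  diffusive term Fubini moves the kernel gradient onto the mollified solution, and integration by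
  parts turns it into the mollification of an already mollified gradient.\<close>

lemma energy_rate:
  assumes s: "good s"
  shows "(LINT x|Mx. mol n (\<lambda>y. \<theta> y s) x * Fn n x s) =
    - A * (LINT x|Mx. mol n (\<lambda>y. \<theta> y s) x * commutator m n (\<lambda>y. g y s) x)
    - \<nu> * (LINT x|Mx. inner (q x s) (mol n (mol n (\<lambda>y. g y s)) x))"
    "integrable Mx (\<lambda>x. mol n (\<lambda>y. \<theta> y s) x * Fn n x s)"
proof -
  note gf = good_facts[OF s]
  define F where "F = mol n (\<lambda>y. \<theta> y s)"
  define G where "G = mol n (\<lambda>y. g y s)"
  define Q where "Q x = (LINT y|Mx. inner (q y s) (ker2_grad n (x - y)))" for x
  have pF: "periodic_C1 F (\<lambda>x. fst (G x)) (\<lambda>x. snd (G x))"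
    using mol_periodic_C1[OF gf(9), of n] unfolding F_def G_def gf(8) .
  have Fc: "continuous_on UNIV F" unfolding F_def by (rule mol_continuous[OF gf(9)])
  have Gc: "continuous_on UNIV G" unfolding G_def by (rule mol_continuous[OF gf(2)])
  have cc: "continuous_on UNIV (commutator m n (\<lambda>y. g y s))" by (rule commutator_continuous[OF gf(2)])
  have [measurable]: "F \<in> borel_measurable borel" using Fc by (rule borel_measurable_continuous_onI)
  have Qc: "continuous_on UNIV Q"
    unfolding Q_def[abs_def]
  proof (rule continuous_param_integral[where w="\<lambda>y. ker2_grad_bd n * norm (q y s)"])
    show "integrable Mx (\<lambda>y. ker2_grad_bd n * norm (q y s))" using gf(3) by auto
    show "norm (inner (q y s) (ker2_grad n (x - y))) \<le> ker2_grad_bd n * norm (q y s)" for x y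
      using Cauchy_Schwarz_ineq2[of "q y s" "ker2_grad n (x - y)"] mult_left_mono[OF ker2_grad_le[of n "x - y"], of "norm (q y s)"]
      by (simp add: mult.commute)
    show "continuous_on UNIV (\<lambda>x. inner (q y s) (ker2_grad n (x - y)))" for y by (intro continuous_intros)
  qed measurable
  note [continuous_intros] = Fc Gc cc Qc
  have i: "integrable Mx (\<lambda>x. F x * inner (cflow m x) (G x))" "integrable Mx (\<lambda>x. F x * commutator m n (\<lambda>y. g y s) x)"
    "integrable Mx (\<lambda>x. F x * Q x)"
    by (intro Mx_integral_continuous(1) continuous_intros)+
  have e: "F x * Fn n x s = (- A * (F x * inner (cflow m x) (G x)) + - A * (F x * commutator m n (\<lambda>y. g y s) x)) + \<nu> * (F x * Q x)" for x
    unfolding Fn_decomp G_def Q_def by (simp add: algebra_simps)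
  show "integrable Mx (\<lambda>x. mol n (\<lambda>y. \<theta> y s) x * Fn n x s)"
    unfolding F_def[symmetric] e using i by auto
  have z: "(LINT x|Mx. F x * inner (cflow m x) (G x)) = 0"
    using periodic_C1_transport_zero[OF pF, of m] by simp
  have FQ: "(LINT x|Mx. F x * Q x) = - (LINT y|Mx. inner (q y s) (mol n G y))"
  proof -
    obtain B where B: "\<And>x. \<bar>F x\<bar> \<le> B" using norm_S_bound[OF gf(9), of n] unfolding F_def by auto
    then have B0: "B \<ge> 0" by (meson abs_ge_zero order_trans)
    have pi: "integrable (Mx \<Otimes>\<^sub>M Mx) (case_prod (\<lambda>x y. F x * inner (q y s) (ker2_grad n (x - y))))"
    proof (rule Bochner_Integration.integrable_bound)
      have "integrable (Mx \<Otimes>\<^sub>M Mx) (\<lambda>z. q (snd z) s)"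
      proof (rule MxMx.Fubini_integrable)
        show "integrable Mx (\<lambda>x. LINT y|Mx. norm (q (snd (x, y)) s))" by simp
        show "AE x in Mx. integrable Mx (\<lambda>y. q (snd (x, y)) s)" using gf(3) by simp
      qed measurable
      then show "integrable (Mx \<Otimes>\<^sub>M Mx) (\<lambda>z. B * (ker2_grad_bd n * norm (q (snd z) s)))" by auto
      show "AE z in Mx \<Otimes>\<^sub>M Mx. norm (case_prod (\<lambda>x y. F x * inner (q y s) (ker2_grad n (x - y))) z) \<le> norm (B * (ker2_grad_bd n * norm (q (snd z) s)))"
      proof (rule AE_I2)
        fix z
        have "\<bar>inner (q (snd z) s) (ker2_grad n (fst z - snd z))\<bar> \<le> ker2_grad_bd n * norm (q (snd z) s)"
          using Cauchy_Schwarz_ineq2[of "q (snd z) s" "ker2_grad n (fst z - snd z)"] mult_left_mono[OF ker2_grad_le[of n "fst z - snd z"], of "norm (q (snd z) s)"]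
          by (simp add: mult.commute)
        then have "\<bar>F (fst z)\<bar> * \<bar>inner (q (snd z) s) (ker2_grad n (fst z - snd z))\<bar> \<le> B * (ker2_grad_bd n * norm (q (snd z) s))"
          by (intro mult_mono B) (use B0 in auto)
        then show "norm (case_prod (\<lambda>x y. F x * inner (q y s) (ker2_grad n (x - y))) z) \<le> norm (B * (ker2_grad_bd n * norm (q (snd z) s)))"
          using B0 ker2_grad_bd_pos[of n] by (simp add: split_beta' abs_mult)
      qed
    qed measurable
    have "(LINT x|Mx. F x * Q x) = (LINT x|Mx. LINT y|Mx. F x * inner (q y s) (ker2_grad n (x - y)))"
      unfolding Q_def by simp
    also have "\<dots> = (LINT y|Mx. LINT x|Mx. F x * inner (q y s) (ker2_grad n (x - y)))"
      using MxMx.Fubini_integral[OF pi] by simp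
    also have "\<dots> = (LINT y|Mx. - inner (q y s) (mol n G y))"
    proof (rule Bochner_Integration.integral_cong)
      fix y
      have Fi: "integrable Mx F" by (rule Mx_integral_continuous(1)[OF Fc])
      have "(LINT x|Mx. F x * inner (q y s) (ker2_grad n (x - y))) = (LINT x|Mx. - inner (q y s) (F x *\<^sub>R ker2_grad n (y - x)))"
        by (subst ker2_commute(2)) (simp add: inner_scaleR_right)
      also have "\<dots> = - inner (q y s) (mol_grad n F y)"
        unfolding mol_grad_def Bochner_Integration.integral_minus
        using integral_inner_right[OF mol_grad_integrable[OF Fi, of n y], of "q y s"] by (simp only:)
      also have "mol_grad n F y = mol n (\<lambda>y. (fst (G y), snd (G y))) y" by (rule mol_grad_periodic_C1[OF pF])
      finally show "(LINT x|Mx. F x * inner (q y s) (ker2_grad n (x - y))) = - inner (q y s) (mol n G y)" by simp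
    qed simp
    finally show ?thesis by simp
  qed
  have "(LINT x|Mx. F x * Fn n x s) = - A * (LINT x|Mx. F x * inner (cflow m x) (G x)) + - A * (LINT x|Mx. F x * commutator m n (\<lambda>y. g y s) x)
    + \<nu> * (LINT x|Mx. F x * Q x)"
    unfolding e using i by simp
  then have "(LINT x|Mx. F x * Fn n x s) = - A * (LINT x|Mx. F x * commutator m n (\<lambda>y. g y s) x) - \<nu> * (LINT y|Mx. inner (q y s) (mol n G y))"
    using z FQ by simp
  then show "(LINT x|Mx. mol n (\<lambda>y. \<theta> y s) x * Fn n x s) =
    - A * (LINT x|Mx. mol n (\<lambda>y. \<theta> y s) x * commutator m n (\<lambda>y. g y s) x)
    - \<nu> * (LINT x|Mx. inner (q x s) (mol n (mol n (\<lambda>y. g y s)) x))"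
    unfolding F_def G_def .
qed

lemma commutator_L2:
  assumes s: "good s"
  shows "integrable Mx (\<lambda>x. (commutator m n (\<lambda>y. g y s) x)\<^sup>2)"
    "(LINT x|Mx. (commutator m n (\<lambda>y. g y s) x)\<^sup>2) \<le> (64 * real m / (real n + 1))\<^sup>2 * (1 + N s)"
proof -
  note gf = good_facts[OF s]
  show i: "integrable Mx (\<lambda>x. (commutator m n (\<lambda>y. g y s) x)\<^sup>2)"
    by (intro Mx_integral_continuous(1) continuous_intros commutator_continuous gf)
  have "(LINT x|Mx. (commutator m n (\<lambda>y. g y s) x)\<^sup>2) \<le> (LINT x|Mx. (64 * real m / (real n + 1))\<^sup>2 * mol n (\<lambda>y. (norm (g y s))\<^sup>2) x)"
    using mol_integral_eq(2)[OF gf(1)] commutator_bound[OF _ gf(1)] by (intro integral_mono i) auto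
  also have "\<dots> = (64 * real m / (real n + 1))\<^sup>2 * (LINT x|Mx. (norm (g x s))\<^sup>2)"
    using mol_integral_eq[OF gf(1), of n] by simp
  also have "\<dots> \<le> (64 * real m / (real n + 1))\<^sup>2 * (1 + N s)"
    by (intro mult_left_mono gf) auto
  finally show "(LINT x|Mx. (commutator m n (\<lambda>y. g y s) x)\<^sup>2) \<le> (64 * real m / (real n + 1))\<^sup>2 * (1 + N s)" .
qed

text \<open>Young's inequality weighted by the kernel radius: the commutator is of that order in
  L^2, hence so is the pairing, which vanishes in the limit for fixed m.\<close>

lemma commutator_pairing:
  assumes s: "good s"
  shows "\<bar>LINT x|Mx. mol n (\<lambda>y. \<theta> y s) x * commutator m n (\<lambda>y. g y s) x\<bar> \<le> 1 / (real n + 1) * (E s + (64 * real m)\<^sup>2 * (1 + N s))"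
proof -
  note gf = good_facts[OF s]
  define \<rho> where "\<rho> = 1 / (real n + 1)"
  have r: "\<rho> > 0" unfolding \<rho>_def by simp
  have s0: "0 \<le> s" using s unfolding good_def by simp
  have F2: "integrable Mx (\<lambda>x. (mol n (\<lambda>y. \<theta> y s) x)\<^sup>2)" "(LINT x|Mx. (mol n (\<lambda>y. \<theta> y s) x)\<^sup>2) \<le> E s"
    unfolding E_def using mol_square_integral[of "\<lambda>y. \<theta> y s" n] th_sq[OF s0] by auto
  have "\<bar>LINT x|Mx. mol n (\<lambda>y. \<theta> y s) x * commutator m n (\<lambda>y. g y s) x\<bar> \<le> (LINT x|Mx. \<bar>mol n (\<lambda>y. \<theta> y s) x * commutator m n (\<lambda>y. g y s) x\<bar>)"
    using integral_norm_bound[of Mx "\<lambda>x. mol n (\<lambda>y. \<theta> y s) x * commutator m n (\<lambda>y. g y s) x"] by simp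
  also have "\<dots> \<le> (LINT x|Mx. \<rho> * (mol n (\<lambda>y. \<theta> y s) x)\<^sup>2 + 1 / \<rho> * (commutator m n (\<lambda>y. g y s) x)\<^sup>2)"
  proof (rule integral_mono')
    show "integrable Mx (\<lambda>x. \<rho> * (mol n (\<lambda>y. \<theta> y s) x)\<^sup>2 + 1 / \<rho> * (commutator m n (\<lambda>y. g y s) x)\<^sup>2)"
      using F2 commutator_L2(1)[OF s] by auto
    fix x
    have y: "\<bar>a * b\<bar> \<le> \<rho> * a\<^sup>2 + 1 / \<rho> * b\<^sup>2" for a b :: real
    proof -
      have "0 \<le> (\<rho> * \<bar>a\<bar> - \<bar>b\<bar>)\<^sup>2" by simp
      then have "2 * (\<rho> * (\<bar>a\<bar> * \<bar>b\<bar>)) \<le> \<rho> * (\<rho> * a\<^sup>2) + b\<^sup>2"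
        by (simp add: power2_diff power_mult_distrib power2_eq_square algebra_simps)
      moreover have "0 \<le> \<rho> * (\<bar>a\<bar> * \<bar>b\<bar>)" using r by simp
      moreover have "\<rho> * (\<rho> * a\<^sup>2 + 1 / \<rho> * b\<^sup>2) = \<rho> * (\<rho> * a\<^sup>2) + b\<^sup>2"
        using r by (simp add: distrib_left)
      ultimately have "\<rho> * (\<bar>a\<bar> * \<bar>b\<bar>) \<le> \<rho> * (\<rho> * a\<^sup>2 + 1 / \<rho> * b\<^sup>2)" by linarith
      then show ?thesis using r by (simp add: abs_mult)
    qed
    show "\<bar>mol n (\<lambda>y. \<theta> y s) x * commutator m n (\<lambda>y. g y s) x\<bar> \<le> \<rho> * (mol n (\<lambda>y. \<theta> y s) x)\<^sup>2 + 1 / \<rho> * (commutator m n (\<lambda>y. g y s) x)\<^sup>2"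
      by (rule y)
    show "0 \<le> \<rho> * (mol n (\<lambda>y. \<theta> y s) x)\<^sup>2 + 1 / \<rho> * (commutator m n (\<lambda>y. g y s) x)\<^sup>2" using r by simp
  qed
  also have "\<dots> = \<rho> * (LINT x|Mx. (mol n (\<lambda>y. \<theta> y s) x)\<^sup>2) + 1 / \<rho> * (LINT x|Mx. (commutator m n (\<lambda>y. g y s) x)\<^sup>2)"
    using F2 commutator_L2(1)[OF s] by simp
  also have "\<dots> \<le> \<rho> * E s + 1 / \<rho> * ((64 * real m / (real n + 1))\<^sup>2 * (1 + N s))"
    by (intro add_mono mult_left_mono F2 commutator_L2[OF s]) (use r in auto)
  also have "\<dots> = \<rho> * (E s + (64 * real m)\<^sup>2 * (1 + N s))"
  proof -
    have "(64 * real m / (real n + 1))\<^sup>2 = \<rho> * \<rho> * (64 * real m)\<^sup>2"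
      unfolding \<rho>_def by (simp add: power2_eq_square)
    then show ?thesis using r by (simp add: algebra_simps)
  qed
  finally show ?thesis unfolding \<rho>_def .
qed

lemma Sth_measurable [measurable]:
  "(\<lambda>z. mol n (\<lambda>y. \<theta> y (snd z)) (fst z)) \<in> borel_measurable borel" "(\<lambda>s. mol n (\<lambda>y. \<theta> y s) x) \<in> borel_measurable borel"
  unfolding mol_def by measurable

lemma Fn_measurable [measurable]: "(\<lambda>z. Fn n (fst z) (snd z)) \<in> borel_measurable borel"
  unfolding Fn_def mol_def by measurable

lemma N_measurable [measurable]: "N \<in> borel_measurable borel"
  unfolding N_def[abs_def] by measurable

lemma E_measurable [measurable]: "E \<in> borel_measurable borel"
  unfolding E_def[abs_def] by measurable

lemma Sth_bound:
  assumes "0 \<le> t"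
  shows "\<bar>mol n (\<lambda>y. \<theta> y t) x\<bar> \<le> ker2_bd n * (1 + E t)"
proof -
  have "(LINT y|Mx. \<bar>\<theta> y t\<bar>) \<le> (LINT y|Mx. 1 + (\<theta> y t)\<^sup>2)"
  proof (rule integral_mono)
    show "\<bar>\<theta> y t\<bar> \<le> 1 + (\<theta> y t)\<^sup>2" for y
      using zero_le_power2[of "\<bar>\<theta> y t\<bar> - 1/2"] by (simp add: power2_eq_square algebra_simps)
  qed (use th_int[OF assms] th_sq[OF assms] in auto)
  also have "\<dots> = 1 + E t" unfolding E_def using th_sq[OF assms] by simp
  finally have "ker2_bd n * (LINT y|Mx. \<bar>\<theta> y t\<bar>) \<le> ker2_bd n * (1 + E t)" using ker2_bd_pos[of n] by simp
  then show ?thesis using norm_S_bound[OF th_int[OF assms], of n x] by simp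
qed

text \<open>At each x the mollified solution is an indefinite integral in time, so
  \<open>primitive_square\<close> applies there; integrate over x and exchange the order.\<close>

lemma energy_mollified:
  assumes t: "0 \<le> t"
  shows "(LINT x|Mx. (mol n (\<lambda>y. \<theta> y t) x)\<^sup>2) - (LINT x|Mx. (mol n \<theta>0 x)\<^sup>2)
    = 2 * (LINT s|ivl t. LINT x|Mx. mol n (\<lambda>y. \<theta> y s) x * Fn n x s)"
proof -
  obtain B where B: "B \<ge> 0" "\<And>s. 0 \<le> s \<Longrightarrow> s \<le> t \<Longrightarrow> E s \<le> B" using E_bounded[of t] by auto
  have sq: "(mol n (\<lambda>y. \<theta> y t) x)\<^sup>2 = (mol n \<theta>0 x)\<^sup>2 + 2 * (LINT s|ivl t. mol n (\<lambda>y. \<theta> y s) x * Fn n x s)" for x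
    by (rule primitive_square[OF Fn_int[OF t] t evolution]) auto
  define C where "C = ker2_bd n * (1 + B) * CF n"
  have bd: "\<bar>mol n (\<lambda>y. \<theta> y s) x * Fn n x s\<bar> \<le> C * (1 + N s)" if "good s" "s \<le> t" for s x
  proof -
    have s0: "0 \<le> s" using that unfolding good_def by auto
    have "\<bar>mol n (\<lambda>y. \<theta> y s) x\<bar> \<le> ker2_bd n * (1 + B)"
      using Sth_bound[OF s0, of n x] B(2)[OF s0 that(2)] ker2_bd_pos[of n] by (smt (verit) mult_left_mono)
    then have "\<bar>mol n (\<lambda>y. \<theta> y s) x\<bar> * \<bar>Fn n x s\<bar> \<le> (ker2_bd n * (1 + B)) * (CF n * (1 + N s))"
      using Fn_bound[OF that(1), of n x] by (intro mult_mono) (use B ker2_bd_pos[of n] in auto)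
    then show ?thesis unfolding C_def by (simp add: abs_mult mult.assoc)
  qed
  have pm: "(\<lambda>z. mol n (\<lambda>y. \<theta> y (snd z)) (fst z) * Fn n (fst z) (snd z)) \<in> borel_measurable borel" by measurable
  have pi0: "integrable (Mx \<Otimes>\<^sub>M ivl t) (\<lambda>z. mol n (\<lambda>y. \<theta> y (snd z)) (fst z) * Fn n (fst z) (snd z))"
  proof (rule integrable_Mt_I[where f="\<lambda>x s. mol n (\<lambda>y. \<theta> y s) x * Fn n x s", OF pm])
    show "AE s in ivl t. integrable Mx (\<lambda>x. mol n (\<lambda>y. \<theta> y s) x * Fn n x s)"
      using AE_good[OF t] by eventually_elim (auto intro: energy_rate(2))
    show "integrable (ivl t) (\<lambda>s. LINT x|Mx. \<bar>mol n (\<lambda>y. \<theta> y s) x * Fn n x s\<bar>)"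
    proof (rule Bochner_Integration.integrable_bound)
      show "integrable (ivl t) (\<lambda>s. C * (1 + N s))" using N_int(1)[OF t] by auto
      show "(\<lambda>s. LINT x|Mx. \<bar>mol n (\<lambda>y. \<theta> y s) x * Fn n x s\<bar>) \<in> borel_measurable (ivl t)"
        unfolding mol_def Fn_def by measurable
      show "AE s in ivl t. norm (LINT x|Mx. \<bar>mol n (\<lambda>y. \<theta> y s) x * Fn n x s\<bar>) \<le> norm (C * (1 + N s))"
        using AE_good[OF t]
      proof eventually_elim
        case (elim s)
        have "(LINT x|Mx. \<bar>mol n (\<lambda>y. \<theta> y s) x * Fn n x s\<bar>) \<le> (LINT x|Mx. C * (1 + N s))"
          by (rule integral_mono) (use elim bd[of s] energy_rate(2)[of s n] in auto)
        then show ?case by simp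
      qed
    qed
  qed
  have pi: "integrable (Mx \<Otimes>\<^sub>M ivl t) (case_prod (\<lambda>x s. mol n (\<lambda>y. \<theta> y s) x * Fn n x s))"
    using pi0 by (simp add: split_beta')
  have S0: "integrable Mx (\<lambda>x. (mol n \<theta>0 x)\<^sup>2)" using mol_square_integral(1)[of \<theta>0 n] th0_sq by simp
  have "(LINT x|Mx. (mol n (\<lambda>y. \<theta> y t) x)\<^sup>2) = (LINT x|Mx. (mol n \<theta>0 x)\<^sup>2) + 2 * (LINT x|Mx. LINT s|ivl t. mol n (\<lambda>y. \<theta> y s) x * Fn n x s)"
    unfolding sq using S0 Mt.integrable_fst[OF pi] by simp
  also have "(LINT x|Mx. LINT s|ivl t. mol n (\<lambda>y. \<theta> y s) x * Fn n x s) = (LINT s|ivl t. LINT x|Mx. mol n (\<lambda>y. \<theta> y s) x * Fn n x s)"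
    using Mt.Fubini_integral[OF pi] by simp
  finally show ?thesis by simp
qed

text \<open>The kernel shrinks while A and m stay fixed. The commutator is then O(1/(n + 1)) even
  after multiplication by A, the flux term tends to N, and dominated convergence in time applies
  since all bounds are affine in N.\<close>

theorem energy_identity:
  assumes t: "0 \<le> t"
  shows "E t = (LINT x|Mx. (\<theta>0 x)\<^sup>2) - 2 * \<nu> * (LINT s|ivl t. N s)"
proof -
  obtain B where B: "B \<ge> 0" "\<And>s. 0 \<le> s \<Longrightarrow> s \<le> t \<Longrightarrow> E s \<le> B" using E_bounded[of t] by auto
  define X where "X n s = (LINT x|Mx. mol n (\<lambda>y. \<theta> y s) x * Fn n x s)" for n s
  define W where "W n s = (LINT x|Mx. inner (q x s) (mol n (mol n (\<lambda>y. g y s)) x))" for n s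
  define R where "R s = B + (64 * real m)\<^sup>2 * (1 + N s)" for s
  have XW: "\<bar>X n s + \<nu> * W n s\<bar> \<le> \<bar>A\<bar> * (1 / (real n + 1) * R s)" if "good s" "s \<le> t" for n s
  proof -
    have s0: "0 \<le> s" using that unfolding good_def by auto
    have "X n s + \<nu> * W n s = - A * (LINT x|Mx. mol n (\<lambda>y. \<theta> y s) x * commutator m n (\<lambda>y. g y s) x)"
      unfolding X_def W_def energy_rate(1)[OF that(1)] by simp
    then have "\<bar>X n s + \<nu> * W n s\<bar> = \<bar>A\<bar> * \<bar>LINT x|Mx. mol n (\<lambda>y. \<theta> y s) x * commutator m n (\<lambda>y. g y s) x\<bar>" by (simp add: abs_mult)
    also have "\<dots> \<le> \<bar>A\<bar> * (1 / (real n + 1) * (E s + (64 * real m)\<^sup>2 * (1 + N s)))"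
      by (intro mult_left_mono commutator_pairing that) auto
    also have "\<dots> \<le> \<bar>A\<bar> * (1 / (real n + 1) * R s)"
      unfolding R_def using B(2)[OF s0 that(2)] by (intro mult_left_mono) auto
    finally show ?thesis .
  qed
  have R0: "R s \<ge> 0" for s unfolding R_def using B N_nonneg by (simp add: add_nonneg_nonneg)
  have lim: "(\<lambda>n. LINT s|ivl t. X n s) \<longlonglongrightarrow> (LINT s|ivl t. - \<nu> * N s)"
  proof (rule integral_dominated_convergence[where w="\<lambda>s. \<bar>A\<bar> * R s + \<nu> * (4 * N s)"])
    show "X n \<in> borel_measurable (ivl t)" for n unfolding X_def mol_def Fn_def by measurable
    show "integrable (ivl t) (\<lambda>s. \<bar>A\<bar> * R s + \<nu> * (4 * N s))" unfolding R_def using N_int(1)[OF t] by auto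
    show "AE s in ivl t. (\<lambda>n. X n s) \<longlonglongrightarrow> - \<nu> * N s"
      using AE_good[OF t]
    proof eventually_elim
      case (elim s)
      have "(\<lambda>n. X n s + \<nu> * W n s) \<longlonglongrightarrow> 0"
      proof (rule Lim_null_comparison)
        show "\<forall>\<^sub>F n in sequentially. norm (X n s + \<nu> * W n s) \<le> \<bar>A\<bar> * (1 / (real n + 1) * R s)" using XW elim by auto
        have "(\<lambda>n. 1 / (real n + 1)) \<longlonglongrightarrow> 0" using LIMSEQ_inverse_real_of_nat by (simp add: inverse_eq_divide add.commute)
        then show "(\<lambda>n. \<bar>A\<bar> * (1 / (real n + 1) * R s)) \<longlonglongrightarrow> 0"
          by (intro tendsto_mult_right_zero tendsto_mult_left_zero)
      qed
      moreover have "(\<lambda>n. \<nu> * W n s) \<longlonglongrightarrow> \<nu> * N s"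
        unfolding W_def by (intro tendsto_mult_left flux_limit) (use elim in auto)
      ultimately have "(\<lambda>n. (X n s + \<nu> * W n s) - \<nu> * W n s) \<longlonglongrightarrow> 0 - \<nu> * N s" by (rule tendsto_diff)
      then show ?case by simp
    qed
    show "AE s in ivl t. norm (X n s) \<le> \<bar>A\<bar> * R s + \<nu> * (4 * N s)" for n
      using AE_good[OF t]
    proof eventually_elim
      case (elim s)
      have "\<bar>A\<bar> * (1 / (real n + 1) * R s) \<le> \<bar>A\<bar> * (1 * R s)"
        by (intro mult_left_mono mult_right_mono R0) auto
      moreover have "\<bar>\<nu> * W n s\<bar> \<le> \<nu> * (4 * N s)"
        unfolding abs_mult W_def using nu flux_limit(2)[of s n] elim by (intro mult_mono) auto
      ultimately show ?case using XW[of s n] elim by simp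
    qed
  qed simp
  have "(\<lambda>n. 2 * (LINT s|ivl t. X n s)) \<longlonglongrightarrow> E t - (LINT x|Mx. (\<theta>0 x)\<^sup>2)"
    unfolding X_def energy_mollified[OF t, symmetric] E_def
    by (intro tendsto_diff mol_L2_tendsto(2) th_sq th0_sq t) auto
  moreover have "(\<lambda>n. 2 * (LINT s|ivl t. X n s)) \<longlonglongrightarrow> 2 * (LINT s|ivl t. - \<nu> * N s)"
    by (intro tendsto_mult_left lim)
  ultimately have "E t - (LINT x|Mx. (\<theta>0 x)\<^sup>2) = 2 * (LINT s|ivl t. - \<nu> * N s)"
    using LIMSEQ_unique by blast
  then show ?thesis by simp
qed

text \<open>Testing with the constant 1 leaves A times the integral of u . g. It vanishes by the
  definition of the weak gradient, tested with the two components of u, because u is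
  divergence-free.\<close>

lemma mean_conserved:
  assumes t: "0 \<le> t"
  shows "(LINT x|Mx. \<theta> x t) = (LINT x|Mx. \<theta>0 x)"
proof -
  let ?M = "Mx \<Otimes>\<^sub>M ivl t"
  have gi: "integrable ?M (\<lambda>z. g (fst z) (snd z))" by (rule gq_product_int(1)[OF t])
  have thi: "integrable ?M (\<lambda>z. \<theta> (fst z) (snd z))" by (rule th_product_int(1)[OF t])
  have mm: "(\<lambda>z. cflow m (fst z)) \<in> borel_measurable (borel :: ((real\<times>real)\<times>real) measure)"
    "(\<lambda>z. cflow_div m (fst z)) \<in> borel_measurable (borel :: ((real\<times>real)\<times>real) measure)"
    "(\<lambda>z. cflow_cross m (fst z)) \<in> borel_measurable (borel :: ((real\<times>real)\<times>real) measure)"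
    by (intro borel_measurable_continuous_onI continuous_on_compose2[OF cflow_continuous continuous_on_fst[OF continuous_on_id]]
        continuous_on_compose2[OF cflow_partials_continuous(1) continuous_on_fst[OF continuous_on_id]]
        continuous_on_compose2[OF cflow_partials_continuous(2) continuous_on_fst[OF continuous_on_id]]; simp)+
  note [measurable] = mm
  have i1: "integrable ?M (\<lambda>z. fst (cflow m (fst z)) *\<^sub>R g (fst z) (snd z))"
    by (rule integrable_bounded_scaleR[OF gi, where C=8]) (auto simp: cflow_components_le)
  have i2: "integrable ?M (\<lambda>z. snd (cflow m (fst z)) *\<^sub>R g (fst z) (snd z))"
    by (rule integrable_bounded_scaleR[OF gi, where C=8]) (auto simp: cflow_components_le)
  obtain C where C: "\<And>x. norm (- cflow_div m x, cflow_cross m x) \<le> C" "\<And>x. norm (- cflow_cross m x, cflow_div m x) \<le> C"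
  proof -
    have b: "\<bar>cflow_div m x\<bar> \<le> (2*pi)\<^sup>2 * real m" "\<bar>cflow_cross m x\<bar> \<le> (2*pi)\<^sup>2 * real m" for x
    proof -
      have "\<bar>cos a * cos b\<bar> \<le> 1" "\<bar>sin a * sin b\<bar> \<le> 1" for a b :: real
        using mult_mono[of "\<bar>cos a\<bar>" 1 "\<bar>cos b\<bar>" 1] mult_mono[of "\<bar>sin a\<bar>" 1 "\<bar>sin b\<bar>" 1] by (auto simp: abs_mult)
      then have "(2*pi)\<^sup>2 * real m * \<bar>cos a * cos b\<bar> \<le> (2*pi)\<^sup>2 * real m * 1" "(2*pi)\<^sup>2 * real m * \<bar>sin a * sin b\<bar> \<le> (2*pi)\<^sup>2 * real m * 1" for a b :: real
        by (intro mult_left_mono; simp)+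
      then show "\<bar>cflow_div m x\<bar> \<le> (2*pi)\<^sup>2 * real m" "\<bar>cflow_cross m x\<bar> \<le> (2*pi)\<^sup>2 * real m"
        unfolding cflow_div_def cflow_cross_def by (simp_all add: abs_mult mult.assoc)
    qed
    have "norm (- cflow_div m x, cflow_cross m x) \<le> (2*pi)\<^sup>2 * real m + (2*pi)\<^sup>2 * real m"
      "norm (- cflow_cross m x, cflow_div m x) \<le> (2*pi)\<^sup>2 * real m + (2*pi)\<^sup>2 * real m" for x
    proof -
      have "norm (- cflow_div m x, cflow_cross m x) \<le> \<bar>cflow_div m x\<bar> + \<bar>cflow_cross m x\<bar>" "norm (- cflow_cross m x, cflow_div m x) \<le> \<bar>cflow_div m x\<bar> + \<bar>cflow_cross m x\<bar>"
        using norm_Pair_le[of "- cflow_div m x" "cflow_cross m x"] norm_Pair_le[of "- cflow_cross m x" "cflow_div m x"] by simp_all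
      then show "norm (- cflow_div m x, cflow_cross m x) \<le> (2*pi)\<^sup>2 * real m + (2*pi)\<^sup>2 * real m"
        "norm (- cflow_cross m x, cflow_div m x) \<le> (2*pi)\<^sup>2 * real m + (2*pi)\<^sup>2 * real m"
        using b[of x] by linarith+
    qed
    then show ?thesis using that by blast
  qed
  have j1: "integrable ?M (\<lambda>z. \<theta> (fst z) (snd z) *\<^sub>R (- cflow_div m (fst z), cflow_cross m (fst z)))"
    by (rule integrable_scaleR_bounded[OF thi, where C=C]) (auto simp: C)
  have j2: "integrable ?M (\<lambda>z. \<theta> (fst z) (snd z) *\<^sub>R (- cflow_cross m (fst z), cflow_div m (fst z)))"
    by (rule integrable_scaleR_bounded[OF thi, where C=C]) (auto simp: C)
  \<comment> \<open>Each test gives a vector identity of which one component is kept: the first for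
    the first component of the flow, the second for the second. Their terms with
    \<open>cflow_div\<close> have opposite signs.\<close>
  have "fst (LINT z|?M. \<theta> (fst z) (snd z) *\<^sub>R (- cflow_div m (fst z), cflow_cross m (fst z))) = - fst (LINT z|?M. fst (cflow m (fst z)) *\<^sub>R g (fst z) (snd z))"
    using grad[OF test_function_cflow(1)[of m] t] by simp
  then have a: "(LINT z|?M. \<theta> (fst z) (snd z) * - cflow_div m (fst z)) = - (LINT z|?M. fst (cflow m (fst z)) * fst (g (fst z) (snd z)))"
    using integral_bounded_linear[OF bounded_linear_fst j1] integral_bounded_linear[OF bounded_linear_fst i1] by simp
  have "snd (LINT z|?M. \<theta> (fst z) (snd z) *\<^sub>R (- cflow_cross m (fst z), cflow_div m (fst z))) = - snd (LINT z|?M. snd (cflow m (fst z)) *\<^sub>R g (fst z) (snd z))"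
    using grad[OF test_function_cflow(2)[of m] t] by simp
  then have b: "(LINT z|?M. \<theta> (fst z) (snd z) * cflow_div m (fst z)) = - (LINT z|?M. snd (cflow m (fst z)) * snd (g (fst z) (snd z)))"
    using integral_bounded_linear[OF bounded_linear_snd j2] integral_bounded_linear[OF bounded_linear_snd i2] by simp
  have k1: "integrable ?M (\<lambda>z. fst (cflow m (fst z)) * fst (g (fst z) (snd z)))" "integrable ?M (\<lambda>z. snd (cflow m (fst z)) * snd (g (fst z) (snd z)))"
    using integrable_bounded_linear[OF bounded_linear_fst i1] integrable_bounded_linear[OF bounded_linear_snd i2] by auto
  have "(LINT z|?M. inner (cflow m (fst z)) (g (fst z) (snd z))) = (LINT z|?M. fst (cflow m (fst z)) * fst (g (fst z) (snd z))) + (LINT z|?M. snd (cflow m (fst z)) * snd (g (fst z) (snd z)))"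
    unfolding inner_prod_def inner_real_def using k1 by simp
  also have "\<dots> = 0" using a b by simp
  finally have z: "(LINT z|?M. inner (cflow m (fst z)) (g (fst z) (snd z))) = 0" .
  have "(LINT x|Mx. \<theta> x t) - (LINT x|Mx. \<theta>0 x) = (LINT z|?M. - A * inner (cflow m (fst z)) (g (fst z) (snd z)))"
    using eqn[OF test_function_1 t] by simp
  also have "\<dots> = 0" using z by simp
  finally show ?thesis by simp
qed

end

section \<open>Separatrices\<close>

lemma mol_DERIV_dir:
  assumes f: "integrable Mx f" and e: "e = (1, 0) \<or> e = (0, 1)"
  shows "((\<lambda>z. mol n f (c + z *\<^sub>R e)) has_field_derivative inner (mol_grad n f (c + z *\<^sub>R e)) e) (at z)"
proof -
  obtain a b where c: "c = (a, b)" by (cases c)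
  show ?thesis
    using e
  proof
    assume e: "e = (1, 0)"
    have "((\<lambda>z. mol n f (a + z, b)) has_field_derivative fst (mol_grad n f (a + z, b)) * (0 + 1)) (at z)"
      by (intro DERIV_chain2[OF mol_DERIV1[OF f]] derivative_intros)
    then show ?thesis by (simp add: c e inner_prod_def)
  next
    assume e: "e = (0, 1)"
    have "((\<lambda>z. mol n f (a, b + z)) has_field_derivative snd (mol_grad n f (a, b + z)) * (0 + 1)) (at z)"
      by (intro DERIV_chain2[OF mol_DERIV2[OF f]] derivative_intros)
    then show ?thesis by (simp add: c e inner_prod_def)
  qed
qed

text \<open>A line through the corner c in direction e along which the flow is tangential; \<sigma>
  is its orientation. The speed vanishes at z = 0 and again at z = 1/(2m), the next corner.\<close>

definition edge :: "nat \<Rightarrow> real \<times> real \<Rightarrow> real \<times> real \<Rightarrow> bool" where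
  "edge m c e \<longleftrightarrow> (e = (1, 0) \<or> e = (0, 1)) \<and>
     (\<exists>\<sigma>. \<bar>\<sigma>\<bar> = 1 \<and> (\<forall>z. cflow m (c + z *\<^sub>R e) = (\<sigma> * (2 * pi * sin (2 * pi * real m * z))) *\<^sub>R e))"

text \<open>At multiples of 1/(2m) the sine of 2 pi m x vanishes and its cosine is 1 or -1. So one
  velocity component is zero along the line, and \<sigma> is, up to sign, the product of the
  parities of i and j.\<close>

lemma edge_grid:
  assumes m: "m > 0"
  shows "edge m (real i / (2 * real m), real j / (2 * real m)) (1, 0)"
    "edge m (real i / (2 * real m), real j / (2 * real m)) (0, 1)"
proof -
  have e: "2 * pi * real m * (real k / (2 * real m) + z) = real k * pi + 2 * pi * real m * z"
    "2 * pi * real m * (real k / (2 * real m)) = real k * pi" for k z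
    using m by (auto simp: field_simps)
  have s: "sin (real k * pi + y) = (-1) ^ k * sin y" "cos (real k * pi) = (-1) ^ k" "sin (real k * pi) = 0" for k y
    by (auto simp: sin_add)
  have "\<exists>\<sigma>. \<bar>\<sigma>\<bar> = 1 \<and> (\<forall>z. cflow m ((real i / (2 * real m), real j / (2 * real m)) + z *\<^sub>R (1, 0)) = (\<sigma> * (2 * pi * sin (2 * pi * real m * z))) *\<^sub>R (1, 0))"
    by (rule exI[of _ "- ((-1) ^ i * (-1) ^ j)"]) (auto simp: cflow_alt e s abs_mult power_abs)
  then show "edge m (real i / (2 * real m), real j / (2 * real m)) (1, 0)" unfolding edge_def by auto
  have "\<exists>\<sigma>. \<bar>\<sigma>\<bar> = 1 \<and> (\<forall>z. cflow m ((real i / (2 * real m), real j / (2 * real m)) + z *\<^sub>R (0, 1)) = (\<sigma> * (2 * pi * sin (2 * pi * real m * z))) *\<^sub>R (0, 1))"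
    by (rule exI[of _ "((-1) ^ i * (-1) ^ j)"]) (auto simp: cflow_alt e s abs_mult power_abs)
  then show "edge m (real i / (2 * real m), real j / (2 * real m)) (0, 1)" unfolding edge_def by auto
qed

text \<open>P bounds the dissipation integrated in time, and n fixes the mollification scale. Both
  are parameters here, which keeps visible what depends on A and what does not.\<close>

locale cellular_decay = cellular_solution +
  fixes \<tau> P :: real and n :: nat
  assumes tau: "\<tau> > 0" and A: "A > 0" and m: "m > 0"
    and init: "(LINT x|Mx. (\<theta>0 x)\<^sup>2) = 1" and mean0: "(LINT x|Mx. \<theta>0 x) = 0"
    and P: "(LINT s|ivl \<tau>. N s) \<le> P"
begin

definition \<rho> :: real where "\<rho> = 1 / (real n + 1)"
definition w :: real where "w = \<rho> powr (1 - 2 / p)"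
definition h :: real where "h = 1 / (2 * real m)"
text \<open>Bounds the time integral of 1 + N, the quantity through which all norms of gradient and
  flux enter.\<close>

definition B :: real where "B = \<tau> + P"
definition \<Theta> :: "real \<times> real \<Rightarrow> real \<Rightarrow> real" where "\<Theta> x t = mol n (\<lambda>y. \<theta> y t) x"
text \<open>Squared distance between the time histories of the mollified solution at two points. The
  integration over time turns the time derivative in the equation into end values that are bounded
  independently of A.\<close>

definition d2 :: "real \<times> real \<Rightarrow> real \<times> real \<Rightarrow> real" where "d2 x y = (LINT t|ivl \<tau>. (\<Theta> x t - \<Theta> y t)\<^sup>2)"

lemma rho: "0 < \<rho>" "\<rho> \<le> 1" unfolding \<rho>_def by auto

lemma w: "0 < w" unfolding w_def using rho by simp

lemma one_plus_N: "integrable (ivl \<tau>) (\<lambda>s. 1 + N s)" "(LINT s|ivl \<tau>. 1 + N s) \<le> B" "0 \<le> B"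
proof -
  have N: "integrable (ivl \<tau>) N" using N_int(1) tau by simp
  then show "integrable (ivl \<tau>) (\<lambda>s. 1 + N s)" by auto
  have "(LINT s|ivl \<tau>. 1 + N s) = \<tau> + (LINT s|ivl \<tau>. N s)"
    using N tau by (simp add: measure_ivl_UNIV)
  then show "(LINT s|ivl \<tau>. 1 + N s) \<le> B" unfolding B_def using P by simp
  moreover have "0 \<le> (LINT s|ivl \<tau>. 1 + N s)" using N_nonneg by (intro integral_nonneg_AE) (simp add: add_nonneg_nonneg)
  ultimately show "0 \<le> B" by simp
qed

lemma E_le_1: "0 \<le> t \<Longrightarrow> E t \<le> 1"
proof -
  assume t: "0 \<le> t"
  have "0 \<le> (LINT s|ivl t. N s)" using N_nonneg by (intro integral_nonneg_AE) auto
  then show ?thesis using energy_identity[OF t] init nu by simp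
qed

lemma Theta_bound: "0 \<le> t \<Longrightarrow> \<bar>\<Theta> x t\<bar> \<le> 2 * ker2_bd n"
proof -
  assume t: "0 \<le> t"
  have "ker2_bd n * (1 + E t) \<le> ker2_bd n * 2" using E_le_1[OF t] ker2_bd_pos[of n] by (intro mult_left_mono) auto
  then show ?thesis using Sth_bound[OF t, of n x] unfolding \<Theta>_def by linarith
qed

lemma Theta0_bound: "\<bar>mol n \<theta>0 x\<bar> \<le> 2 * ker2_bd n"
proof -
  have "(LINT y|Mx. \<bar>\<theta>0 y\<bar>) \<le> (LINT y|Mx. 1 + (\<theta>0 y)\<^sup>2)"
  proof (rule integral_mono)
    show "\<bar>\<theta>0 y\<bar> \<le> 1 + (\<theta>0 y)\<^sup>2" for y
      using zero_le_power2[of "\<bar>\<theta>0 y\<bar> - 1/2"] by (simp add: power2_eq_square algebra_simps)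
  qed (use th0_int th0_sq in auto)
  also have "\<dots> = 2" using th0_sq init by simp
  finally have "ker2_bd n * (LINT y|Mx. \<bar>\<theta>0 y\<bar>) \<le> ker2_bd n * 2" using ker2_bd_pos[of n] by simp
  then show ?thesis using norm_S_bound[OF th0_int, of n x] by simp
qed

lemma Theta_measurable [measurable]: "\<Theta> x \<in> borel_measurable borel"
  unfolding \<Theta>_def[abs_def] by measurable

lemma AE_tau: "AE t in ivl \<tau>. 0 \<le> t \<and> t \<le> \<tau>" unfolding AE_ivl by auto

lemma AE_good_tau: "AE t in ivl \<tau>. good t \<and> t \<le> \<tau>" using AE_good tau by simp

lemma abs_diff_4: "\<bar>a\<bar> \<le> 2 * k \<Longrightarrow> \<bar>b\<bar> \<le> 2 * k \<Longrightarrow> \<bar>a - b\<bar> \<le> 4 * k" for a b k :: real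
  by linarith

lemma d2_int: "integrable (ivl \<tau>) (\<lambda>t. (\<Theta> x t - \<Theta> y t)\<^sup>2)"
proof (rule ivl.integrable_const_bound[where B="(4 * ker2_bd n)\<^sup>2"])
  show "AE t in ivl \<tau>. norm ((\<Theta> x t - \<Theta> y t)\<^sup>2) \<le> (4 * ker2_bd n)\<^sup>2"
    using AE_tau
  proof eventually_elim
    case (elim t)
    have "\<bar>\<Theta> x t - \<Theta> y t\<bar> \<le> 4 * ker2_bd n" by (intro abs_diff_4 Theta_bound) (use elim in auto)
    from power_mono[OF this, of 2] show ?case by simp
  qed
qed measurable

lemma d2_le: "d2 x y \<le> \<tau> * (4 * ker2_bd n)\<^sup>2"
proof -
  have "d2 x y \<le> (LINT t|ivl \<tau>. (4 * ker2_bd n)\<^sup>2)"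
    unfolding d2_def
  proof (rule integral_mono_AE[OF d2_int])
    show "AE t in ivl \<tau>. (\<Theta> x t - \<Theta> y t)\<^sup>2 \<le> (4 * ker2_bd n)\<^sup>2"
      using AE_tau
    proof eventually_elim
      case (elim t)
      have "\<bar>\<Theta> x t - \<Theta> y t\<bar> \<le> 4 * ker2_bd n" by (intro abs_diff_4 Theta_bound) (use elim in auto)
      from power_mono[OF this, of 2] show ?case by simp
    qed
  qed simp
  then show ?thesis using tau by (simp add: measure_ivl_UNIV)
qed

lemma d2_triangle: "d2 x z \<le> 2 * d2 x y + 2 * d2 y z"
proof -
  have "d2 x z \<le> (LINT t|ivl \<tau>. 2 * (\<Theta> x t - \<Theta> y t)\<^sup>2 + 2 * (\<Theta> y t - \<Theta> z t)\<^sup>2)"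
    unfolding d2_def
  proof (rule integral_mono[OF d2_int])
    fix t
    have "(a + b)\<^sup>2 \<le> 2 * a\<^sup>2 + 2 * b\<^sup>2" for a b :: real
      using sum_squares_bound[of a b] by (simp add: power2_sum)
    from this[of "\<Theta> x t - \<Theta> y t" "\<Theta> y t - \<Theta> z t"]
    show "(\<Theta> x t - \<Theta> z t)\<^sup>2 \<le> 2 * (\<Theta> x t - \<Theta> y t)\<^sup>2 + 2 * (\<Theta> y t - \<Theta> z t)\<^sup>2" by simp
  qed (use d2_int in auto)
  also have "\<dots> = 2 * d2 x y + 2 * d2 y z" unfolding d2_def using d2_int by simp
  finally show ?thesis .
qed

lemma d2_self: "d2 x x = 0" unfolding d2_def by simp

lemma ker2_bd_rho: "ker2_bd n = 4096 / \<rho>\<^sup>2"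
  unfolding ker2_bd_def \<rho>_def power_mult_distrib by (simp add: power_divide)

text \<open>Here $p > 2$ enters: multiplied by $\rho^2$ the bound is $O(w^2)$ with $w = \rho^{1-2/p}$, which vanishes with the kernel radius.\<close>

lemma mol_g2_bound:
  assumes s: "good s"
  shows "mol n (\<lambda>y. (norm (g y s))\<^sup>2) x \<le> 4096 * \<rho> powr (- 4 / p) * (1 + N s)"
proof -
  note gf = good_facts[OF s]
  \<comment> \<open>The truncation level balancing both parts: the kernel is of order \<rho>^(-2) at
    most, and L^2 as well as L^(2-p) * \<rho>^(-2) equals \<rho>^(-4/p).\<close>
  define L where "L = \<rho> powr (- 2 / p)"
  have L: "L > 0" unfolding L_def using rho by simp
  have pt: "(norm (g y s))\<^sup>2 \<le> L\<^sup>2 + L powr (2 - p) * norm (g y s) powr p" for y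
  proof (cases "norm (g y s) \<le> L")
    case True
    then have "(norm (g y s))\<^sup>2 \<le> L\<^sup>2" by (intro power_mono) auto
    then show ?thesis by (simp add: add_increasing2)
  next
    case False
    then have gL: "norm (g y s) > L" by simp
    have "(norm (g y s))\<^sup>2 = norm (g y s) powr (2 - p) * norm (g y s) powr p"
      using gL L by (simp flip: powr_add)
    also have "\<dots> \<le> L powr (2 - p) * norm (g y s) powr p"
      using gL L p by (intro mult_right_mono powr_mono2') auto
    finally show ?thesis using L by (simp add: add_increasing)
  qed
  have "mol n (\<lambda>y. (norm (g y s))\<^sup>2) x \<le> mol n (\<lambda>y. L\<^sup>2 + L powr (2 - p) * norm (g y s) powr p) x"
    by (rule mol_mono) (use gf(1,7) pt in auto)
  also have "\<dots> = (LINT y|Mx. L\<^sup>2 * ker2 n (x - y) + L powr (2 - p) * (ker2 n (x - y) * norm (g y s) powr p))"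
    unfolding mol_def by (simp add: algebra_simps)
  also have "\<dots> = L\<^sup>2 + L powr (2 - p) * mol n (\<lambda>y. norm (g y s) powr p) x"
    using mol_integrable[OF gf(7), of n x] mol_integrable[of "\<lambda>_. 1::real" n x] unfolding mol_def by (simp add: ker2_LINT)
  also have "\<dots> \<le> L\<^sup>2 + L powr (2 - p) * (ker2_bd n * N s)"
  proof -
    have "mol n (\<lambda>y. norm (g y s) powr p) x \<le> ker2_bd n * N s"
      using norm_S_bound[OF gf(7), of n x] unfolding N_def by simp
    then show ?thesis by (intro add_left_mono mult_left_mono) auto
  qed
  also have "L\<^sup>2 = \<rho> powr (- 4 / p)"
    unfolding L_def using rho by (simp add: powr_powr flip: powr_numeral)
  also have "L powr (2 - p) * (ker2_bd n * N s) = 4096 * \<rho> powr (- 4 / p) * N s"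
  proof -
    have "L powr (2 - p) = \<rho> powr (- 4 / p + 2)"
    proof -
      have "- 2 / p * (2 - p) = - 4 / p + 2" using p by (simp add: field_simps)
      then show ?thesis unfolding L_def powr_powr by (simp only:)
    qed
    also have "\<dots> = \<rho> powr (- 4 / p) * \<rho>\<^sup>2" unfolding powr_add using rho by simp
    finally show ?thesis unfolding ker2_bd_rho using rho by (simp add: field_simps)
  qed
  also have "\<rho> powr (- 4 / p) + 4096 * \<rho> powr (- 4 / p) * N s \<le> 4096 * \<rho> powr (- 4 / p) * (1 + N s)"
    by (simp add: distrib_left)
  finally show ?thesis .
qed

lemma w_rho: "\<rho>\<^sup>2 * \<rho> powr (- 4 / p) = w\<^sup>2"
proof -
  have "\<rho>\<^sup>2 * \<rho> powr (- 4 / p) = \<rho> powr (2 + - 4 / p)" unfolding powr_add using rho by simp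
  also have "\<dots> = \<rho> powr ((1 - 2 / p) * 2)" by (simp add: algebra_simps)
  also have "\<dots> = w powr 2" unfolding w_def powr_powr by simp
  also have "\<dots> = w\<^sup>2" using w by simp
  finally show ?thesis .
qed

lemma commutator_bound':
  assumes s: "good s"
  shows "(commutator m n (\<lambda>y. g y s) x)\<^sup>2 \<le> (64 * real m)\<^sup>2 * 4096 * w\<^sup>2 * (1 + N s)"
proof -
  have "(commutator m n (\<lambda>y. g y s) x)\<^sup>2 \<le> (64 * real m * \<rho>)\<^sup>2 * mol n (\<lambda>y. (norm (g y s))\<^sup>2) x"
    using commutator_bound[OF _ good_facts(1)[OF s], of m n x] unfolding \<rho>_def by simp
  also have "\<dots> \<le> (64 * real m * \<rho>)\<^sup>2 * (4096 * \<rho> powr (- 4 / p) * (1 + N s))"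
    by (intro mult_left_mono mol_g2_bound s) auto
  also have "\<dots> = (64 * real m)\<^sup>2 * 4096 * (\<rho>\<^sup>2 * \<rho> powr (- 4 / p)) * (1 + N s)"
    by (simp add: power_mult_distrib)
  finally show ?thesis unfolding w_rho .
qed

lemma grad_bound:
  assumes s: "good s"
  shows "(norm (mol_grad n (\<lambda>y. \<theta> y s) x))\<^sup>2 \<le> 4096 * \<rho> powr (- 4 / p) * (1 + N s)"
proof -
  have "(norm (mol_grad n (\<lambda>y. \<theta> y s) x))\<^sup>2 \<le> mol n (\<lambda>y. (norm (g y s))\<^sup>2) x"
    unfolding good_facts(8)[OF s] by (rule mol_sq) (use good_facts(1)[OF s] in auto)
  then show ?thesis using mol_g2_bound[OF s, of x] by linarith
qed

lemma unit_dir: "e = (1, 0) \<or> e = (0, 1) \<Longrightarrow> norm (e :: real \<times> real) = 1"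
  by auto

text \<open>The mollified gradient is O(\<rho>^(-2/p)), so over a distance \<rho> the solution
  changes by O(w). This handles the two ends of an edge, where the flow is too slow to be
  exploited.\<close>

lemma d2_close:
  assumes e: "e = (1, 0) \<or> e = (0, 1)" and z: "\<bar>z - z'\<bar> \<le> \<rho>"
  shows "d2 (c + z *\<^sub>R e) (c + z' *\<^sub>R e) \<le> 4096 * w\<^sup>2 * B"
proof -
  have "d2 (c + z *\<^sub>R e) (c + z' *\<^sub>R e) \<le> (LINT t|ivl \<tau>. 4096 * w\<^sup>2 * (1 + N t))"
    unfolding d2_def
  proof (rule integral_mono_AE[OF d2_int])
    show "integrable (ivl \<tau>) (\<lambda>t. 4096 * w\<^sup>2 * (1 + N t))" using one_plus_N(1) by simp
    show "AE t in ivl \<tau>. (\<Theta> (c + z *\<^sub>R e) t - \<Theta> (c + z' *\<^sub>R e) t)\<^sup>2 \<le> 4096 * w\<^sup>2 * (1 + N t)"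
      using AE_good_tau
    proof eventually_elim
      case (elim t)
      define D where "D = sqrt (4096 * \<rho> powr (- 4 / p) * (1 + N t))"
      have D: "D \<ge> 0" "D\<^sup>2 = 4096 * \<rho> powr (- 4 / p) * (1 + N t)" unfolding D_def using N_nonneg[of t] by auto
      have "norm (mol_grad n (\<lambda>y. \<theta> y t) x) \<le> D" for x
        by (rule power2_le_imp_le) (use D elim grad_bound[of t x] in auto)
      then have der: "\<bar>inner (mol_grad n (\<lambda>y. \<theta> y t) x) e\<bar> \<le> D" for x
        using Cauchy_Schwarz_ineq2[of "mol_grad n (\<lambda>y. \<theta> y t) x" e] unit_dir[OF e] by (metis mult.right_neutral order_trans)
      have "norm (\<Theta> (c + z *\<^sub>R e) t - \<Theta> (c + z' *\<^sub>R e) t) \<le> D * norm (z - z')"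
        unfolding \<Theta>_def
        by (rule field_differentiable_bound[where S=UNIV and f'="\<lambda>z. inner (mol_grad n (\<lambda>y. \<theta> y t) (c + z *\<^sub>R e)) e"])
          (use elim der mol_DERIV_dir[OF good_facts(9) e] in \<open>auto intro: has_field_derivative_at_within\<close>)
      also have "\<dots> \<le> D * \<rho>" using z D by (intro mult_left_mono) auto
      finally have "\<bar>\<Theta> (c + z *\<^sub>R e) t - \<Theta> (c + z' *\<^sub>R e) t\<bar>\<^sup>2 \<le> (D * \<rho>)\<^sup>2" by (intro power_mono) auto
      also have "\<dots> = 4096 * (\<rho>\<^sup>2 * \<rho> powr (- 4 / p)) * (1 + N t)" unfolding power_mult_distrib D(2) by simp
      finally show ?case unfolding w_rho by simp
    qed
  qed
  also have "\<dots> = 4096 * w\<^sup>2 * (LINT t|ivl \<tau>. 1 + N t)" by simp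
  also have "\<dots> \<le> 4096 * w\<^sup>2 * B" by (intro mult_left_mono one_plus_N) auto
  finally show ?thesis .
qed

text \<open>The constant of the commutator terms; the factor 4 comes from squaring the difference of
  two commutators. It depends on m, but neither on n nor on A.\<close>

definition C1 :: real where "C1 = 4 * (64 * real m)\<^sup>2 * 4096 * B"
text \<open>Collects what is not multiplied by A in the edge estimate: the end values at the times 0
  and \<tau>, and the diffusive flux. It grows with n but is independent of A.\<close>

definition Cn :: real where "Cn = 32 * (ker2_bd n)\<^sup>2 + 16 * ker2_bd n * \<nu> * ker2_grad_bd n * B"

text \<open>Along an edge the flow is parallel to the edge, so the transport term in the time derivative of $D(z,t)^2$ is
  $A$ times the $z$-derivative of $D^2$; everything else is $O(1)$, apart from $A$ times the commutator.\<close>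

lemma edge_derivative:
  assumes ed: "edge m c e"
  shows "\<exists>G'. ((\<lambda>z. d2 (c + z *\<^sub>R e) c) has_field_derivative G') (at z) \<and>
     2 * pi * \<bar>sin (2 * pi * real m * z)\<bar> * \<bar>G'\<bar> \<le> w * d2 (c + z *\<^sub>R e) c + C1 * w + Cn / A"
proof -
  obtain \<sigma> where e: "e = (1, 0) \<or> e = (0, 1)" and \<sigma>: "\<bar>\<sigma>\<bar> = 1"
    and cflow: "\<And>z. cflow m (c + z *\<^sub>R e) = (\<sigma> * (2 * pi * sin (2 * pi * real m * z))) *\<^sub>R e"
    using ed unfolding edge_def by auto
  have umc: "cflow m c = 0" using cflow[of 0] by simp
  define D where "D z t = \<Theta> (c + z *\<^sub>R e) t - \<Theta> c t" for z t
  define D' where "D' z t = inner (mol_grad n (\<lambda>y. \<theta> y t) (c + z *\<^sub>R e)) e" for z t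
  \<comment> \<open>Cut off outside $[0,\tau]$, because slices at negative times are not even integrable.\<close>
  define k where "k z t = (if 0 \<le> t \<and> t \<le> \<tau> then (D z t)\<^sup>2 else 0)" for z t
  define k' where "k' z t = (if 0 \<le> t \<and> t \<le> \<tau> then 2 * D z t * D' z t else 0)" for z t
  have Dm[measurable]: "D z \<in> borel_measurable borel" for z unfolding D_def[abs_def] by measurable
  have D'm[measurable]: "D' z \<in> borel_measurable borel" for z
    unfolding D'_def[abs_def] mol_grad_def by measurable
  have Db: "\<bar>D z t\<bar> \<le> 4 * ker2_bd n" if "0 \<le> t" for z t
    unfolding D_def by (intro abs_diff_4 Theta_bound that)
  have D'b: "\<bar>D' z t\<bar> \<le> 2 * ker2_grad_bd n" if t: "0 \<le> t" for z t
  proof -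
    have "norm (mol_grad n (\<lambda>y. \<theta> y t) x) \<le> 2 * ker2_grad_bd n" for x
    proof -
    have "norm (mol_grad n (\<lambda>y. \<theta> y t) x) \<le> (LINT y|Mx. norm (\<theta> y t *\<^sub>R ker2_grad n (x - y)))"
      unfolding mol_grad_def by (rule integral_norm_bound)
    also have "(LINT y|Mx. norm (\<theta> y t *\<^sub>R ker2_grad n (x - y))) \<le> (LINT y|Mx. ker2_grad_bd n * (1 + (\<theta> y t)\<^sup>2))"
    proof (rule integral_mono')
      show "integrable Mx (\<lambda>y. ker2_grad_bd n * (1 + (\<theta> y t)\<^sup>2))" using th_sq[OF t] by auto
      fix y
      have "\<bar>\<theta> y t\<bar> \<le> 1 + (\<theta> y t)\<^sup>2"
        using zero_le_power2[of "\<bar>\<theta> y t\<bar> - 1/2"] by (simp add: power2_eq_square algebra_simps)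
      then have "\<bar>\<theta> y t\<bar> * norm (ker2_grad n (x - y)) \<le> (1 + (\<theta> y t)\<^sup>2) * ker2_grad_bd n" by (intro mult_mono ker2_grad_le) auto
      then show "norm (\<theta> y t *\<^sub>R ker2_grad n (x - y)) \<le> ker2_grad_bd n * (1 + (\<theta> y t)\<^sup>2)" by (simp add: mult.commute)
    qed (use ker2_grad_bd_pos[of n] in auto)
    also have "(LINT y|Mx. ker2_grad_bd n * (1 + (\<theta> y t)\<^sup>2)) = ker2_grad_bd n * (1 + E t)" unfolding E_def using th_sq[OF t] by simp
    also have "\<dots> \<le> ker2_grad_bd n * 2" using E_le_1[OF t] ker2_grad_bd_pos[of n] by simp
    finally show ?thesis by simp
    qed
    then show ?thesis unfolding D'_def
      using Cauchy_Schwarz_ineq2[of "mol_grad n (\<lambda>y. \<theta> y t) (c + z *\<^sub>R e)" e] unit_dir[OF e] by (metis mult.right_neutral order_trans)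
  qed
  have Dder: "((\<lambda>z. D z t) has_field_derivative D' z t) (at z)" if "0 \<le> t" for z t
    unfolding D_def D'_def \<Theta>_def using DERIV_diff[OF mol_DERIV_dir[OF th_int[OF that] e] DERIV_const] by simp
  have km[measurable]: "k z \<in> borel_measurable borel" for z unfolding k_def[abs_def] by measurable
  have k'm[measurable]: "k' z \<in> borel_measurable borel" for z unfolding k'_def[abs_def] by measurable
  have ki: "integrable (ivl \<tau>) (k z)" for z
  proof (rule ivl.integrable_const_bound[where B="(4 * ker2_bd n)\<^sup>2"])
    have "\<bar>k z t\<bar> \<le> (4 * ker2_bd n)\<^sup>2" for t
      using power_mono[OF Db[of t z], of 2] unfolding k_def by auto
    then show "AE t in ivl \<tau>. norm (k z t) \<le> (4 * ker2_bd n)\<^sup>2" by simp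
  qed simp
  have keq: "d2 (c + z *\<^sub>R e) c = (LINT t|ivl \<tau>. k z t)" for z
    unfolding d2_def by (rule integral_cong_AE) (auto intro!: eventually_mono[OF AE_tau] simp: k_def D_def)
  have der: "((\<lambda>z. LINT t|ivl \<tau>. k z t) has_field_derivative (LINT t|ivl \<tau>. k' z t)) (at z)" for z
  proof (rule DERIV_param_integral[where w="\<lambda>_. 2 * (4 * ker2_bd n) * (2 * ker2_grad_bd n)"])
    show "\<bar>k' z t\<bar> \<le> 2 * (4 * ker2_bd n) * (2 * ker2_grad_bd n)" for z t
    proof (cases "0 \<le> t \<and> t \<le> \<tau>")
      case True
      have "\<bar>D z t\<bar> * \<bar>D' z t\<bar> \<le> (4 * ker2_bd n) * (2 * ker2_grad_bd n)"
        by (intro mult_mono Db D'b) (use True ker2_bd_pos[of n] in auto)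
      then show ?thesis using True unfolding k'_def by (simp add: abs_mult mult_ac)
    qed (use ker2_bd_pos[of n] ker2_grad_bd_pos[of n] in \<open>auto simp: k'_def\<close>)
    show "((\<lambda>z. k z t) has_real_derivative k' z t) (at z)" for z t
    proof (cases "0 \<le> t \<and> t \<le> \<tau>")
      case True
      have "((\<lambda>z. (D z t)\<^sup>2) has_real_derivative 2 * D z t * D' z t) (at z)"
        using True by (auto intro!: derivative_eq_intros Dder)
      then show ?thesis using True unfolding k_def k'_def by simp
    qed (auto simp: k_def k'_def)
  qed (use ki in auto)
  define G' where "G' = (LINT t|ivl \<tau>. k' z t)"
  have G'D: "G' = (LINT t|ivl \<tau>. 2 * D z t * D' z t)"
    unfolding G'_def by (rule integral_cong_AE) (auto intro!: eventually_mono[OF AE_tau] simp: k'_def)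
  have k'i: "integrable (ivl \<tau>) (\<lambda>t. 2 * D z t * D' z t)"
  proof (rule ivl.integrable_const_bound[where B="2 * (4 * ker2_bd n) * (2 * ker2_grad_bd n)"])
    show "AE t in ivl \<tau>. norm (2 * D z t * D' z t) \<le> 2 * (4 * ker2_bd n) * (2 * ker2_grad_bd n)"
      using AE_tau
    proof eventually_elim
      case (elim t)
      have "\<bar>D z t\<bar> * \<bar>D' z t\<bar> \<le> (4 * ker2_bd n) * (2 * ker2_grad_bd n)"
        by (intro mult_mono Db D'b) (use elim ker2_bd_pos[of n] in auto)
      then show ?case by (simp add: abs_mult mult_ac)
    qed
  qed measurable
  let ?x = "c + z *\<^sub>R e"
  define \<omega> where "\<omega> = \<sigma> * (2 * pi * sin (2 * pi * real m * z))"
  define Q where "Q x t = (LINT y|Mx. inner (q y t) (ker2_grad n (x - y)))" for x t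
  define R where "R t = 2 * D z t * (- A * (commutator m n (\<lambda>y. g y t) ?x - commutator m n (\<lambda>y. g y t) c) + \<nu> * (Q ?x t - Q c t))" for t
  \<comment> \<open>At the corner c the flow vanishes, so transport acts only at the moving point.
    There the flow is \<omega> times e, and the transport term is a derivative in z.\<close>
  have F: "Fn n ?x t - Fn n c t = - A * \<omega> * D' z t - A * (commutator m n (\<lambda>y. g y t) ?x - commutator m n (\<lambda>y. g y t) c) + \<nu> * (Q ?x t - Q c t)"
    if "good t" for t
    unfolding Fn_decomp cflow umc Q_def D'_def \<omega>_def good_facts(8)[OF that] by (simp add: inner_commute algebra_simps)
  define d0 where "d0 = mol n \<theta>0 ?x - mol n \<theta>0 c"
  \<comment> \<open>The equation enters here, integrated from 0 to \<tau> at fixed z. Solved for A *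
    \<omega> * G', it bounds a derivative in space by end values in time and the remainder
    R.\<close>
  have "(D z \<tau>)\<^sup>2 = d0\<^sup>2 + 2 * (LINT t|ivl \<tau>. D z t * (Fn n ?x t - Fn n c t))"
  proof (rule primitive_square)
    show "integrable (ivl \<tau>) (\<lambda>t. Fn n ?x t - Fn n c t)" using Fn_int tau by auto
    show "D z t = d0 + (LINT s|ivl t. Fn n ?x s - Fn n c s)" if t: "0 \<le> t" for t
      unfolding D_def \<Theta>_def d0_def evolution[OF t] using Fn_int[OF t] by simp
  qed (use tau in auto)
  moreover have Fint: "integrable (ivl \<tau>) (\<lambda>t. D z t * (Fn n ?x t - Fn n c t))"
  proof (rule Bochner_Integration.integrable_bound)
    show "integrable (ivl \<tau>) (\<lambda>t. 4 * ker2_bd n * (Fn n ?x t - Fn n c t))" using Fn_int tau by auto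
    show "(\<lambda>t. D z t * (Fn n ?x t - Fn n c t)) \<in> borel_measurable (ivl \<tau>)" unfolding Fn_def mol_def by measurable
    show "AE t in ivl \<tau>. norm (D z t * (Fn n ?x t - Fn n c t)) \<le> norm (4 * ker2_bd n * (Fn n ?x t - Fn n c t))"
      using AE_tau
    proof eventually_elim
      case (elim t)
      have "\<bar>D z t\<bar> * \<bar>Fn n ?x t - Fn n c t\<bar> \<le> 4 * ker2_bd n * \<bar>Fn n ?x t - Fn n c t\<bar>"
        by (intro mult_right_mono Db) (use elim in auto)
      then show ?case using ker2_bd_pos[of n] by (simp add: abs_mult)
    qed
  qed
  ultimately have sq: "(D z \<tau>)\<^sup>2 - d0\<^sup>2 = (LINT t|ivl \<tau>. 2 * (D z t * (Fn n ?x t - Fn n c t)))" by simp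
  have Rm[measurable]: "R \<in> borel_measurable borel"
    unfolding R_def[abs_def] commutator_def Q_def mol_def by measurable
  have FR: "AE t in ivl \<tau>. 2 * (D z t * (Fn n ?x t - Fn n c t)) = - A * \<omega> * (2 * D z t * D' z t) + R t"
    using AE_good_tau by eventually_elim (auto simp: F R_def algebra_simps)
  have Ri: "integrable (ivl \<tau>) R"
  proof -
    have "integrable (ivl \<tau>) (\<lambda>t. 2 * (D z t * (Fn n ?x t - Fn n c t)) - - A * \<omega> * (2 * D z t * D' z t))"
      by (intro Bochner_Integration.integrable_diff integrable_mult_right Fint k'i)
    moreover have "AE t in ivl \<tau>. 2 * (D z t * (Fn n ?x t - Fn n c t)) - - A * \<omega> * (2 * D z t * D' z t) = R t"
      using FR by eventually_elim simp
    ultimately show ?thesis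
      by (subst integrable_cong_AE[of R "ivl \<tau>" "\<lambda>t. 2 * (D z t * (Fn n ?x t - Fn n c t)) - - A * \<omega> * (2 * D z t * D' z t)"])
        (auto elim!: eventually_mono)
  qed
  have "(LINT t|ivl \<tau>. 2 * (D z t * (Fn n ?x t - Fn n c t))) = (LINT t|ivl \<tau>. - A * \<omega> * (2 * D z t * D' z t) + R t)"
    by (rule integral_cong_AE) (use FR Fint in auto)
  also have "\<dots> = - A * \<omega> * G' + (LINT t|ivl \<tau>. R t)"
    unfolding G'D using k'i Ri by (subst Bochner_Integration.integral_add) auto
  finally have id: "A * \<omega> * G' = d0\<^sup>2 - (D z \<tau>)\<^sup>2 + (LINT t|ivl \<tau>. R t)" using sq by simp
  have Rb: "AE t in ivl \<tau>. \<bar>R t\<bar> \<le> A * (w * (D z t)\<^sup>2 + w * (4 * (64 * real m)\<^sup>2 * 4096) * (1 + N t)) + 16 * ker2_bd n * \<nu> * ker2_grad_bd n * (1 + N t)"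
    using AE_good_tau
  proof eventually_elim
    case (elim t)
    then have t0: "0 \<le> t" and gd: "good t" unfolding good_def by auto
    define \<kappa> where "\<kappa> = commutator m n (\<lambda>y. g y t) ?x - commutator m n (\<lambda>y. g y t) c"
    have "\<kappa>\<^sup>2 \<le> 2 * (commutator m n (\<lambda>y. g y t) ?x)\<^sup>2 + 2 * (commutator m n (\<lambda>y. g y t) c)\<^sup>2"
      unfolding \<kappa>_def using zero_le_power2[of "commutator m n (\<lambda>y. g y t) ?x + commutator m n (\<lambda>y. g y t) c"]
      by (simp add: power2_sum power2_diff)
    also have "\<dots> \<le> 4 * ((64 * real m)\<^sup>2 * 4096 * w\<^sup>2 * (1 + N t))"
      using commutator_bound'[OF gd, of ?x] commutator_bound'[OF gd, of c] by linarith
    finally have \<kappa>: "\<kappa>\<^sup>2 \<le> w\<^sup>2 * ((4 * (64 * real m)\<^sup>2 * 4096) * (1 + N t))" by (simp add: mult_ac)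
    \<comment> \<open>Young's inequality with weight w, matched to \<kappa> = O(w): both resulting
      terms carry one factor w, and the first integrates to w times \<open>d2\<close>, which is
      absorbed when the edge is traversed.\<close>
    have y: "2 * \<bar>D z t\<bar> * \<bar>\<kappa>\<bar> \<le> w * (D z t)\<^sup>2 + w * ((4 * (64 * real m)\<^sup>2 * 4096) * (1 + N t))"
    proof -
      have "0 \<le> (w * \<bar>D z t\<bar> - \<bar>\<kappa>\<bar>)\<^sup>2" by simp
      then have "w * (2 * \<bar>D z t\<bar> * \<bar>\<kappa>\<bar>) \<le> w\<^sup>2 * (D z t)\<^sup>2 + \<kappa>\<^sup>2"
        by (simp add: power2_diff power_mult_distrib algebra_simps)
      also have "\<dots> \<le> w\<^sup>2 * (D z t)\<^sup>2 + w\<^sup>2 * ((4 * (64 * real m)\<^sup>2 * 4096) * (1 + N t))" using \<kappa> by simp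
      also have "\<dots> = w * (w * (D z t)\<^sup>2 + w * ((4 * (64 * real m)\<^sup>2 * 4096) * (1 + N t)))"
        by (simp add: power2_eq_square distrib_left)
      finally show ?thesis using w mult_le_cancel_left_pos by blast
    qed
    have Qb: "\<bar>Q ?x t - Q c t\<bar> \<le> 2 * (ker2_grad_bd n * (1 + N t))"
      using flux_pairing_bound[OF gd, of n ?x] flux_pairing_bound[OF gd, of n c] unfolding Q_def by linarith
    have "\<bar>R t\<bar> \<le> A * (2 * \<bar>D z t\<bar> * \<bar>\<kappa>\<bar>) + \<nu> * (2 * \<bar>D z t\<bar> * \<bar>Q ?x t - Q c t\<bar>)"
    proof -
      have "R t = - (A * (2 * D z t * \<kappa>)) + \<nu> * (2 * D z t * (Q ?x t - Q c t))"
        unfolding R_def \<kappa>_def by (simp add: algebra_simps)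
      then have "\<bar>R t\<bar> \<le> \<bar>A * (2 * D z t * \<kappa>)\<bar> + \<bar>\<nu> * (2 * D z t * (Q ?x t - Q c t))\<bar>" by linarith
      then show ?thesis using A nu by (simp add: abs_mult)
    qed
    also have "\<dots> \<le> A * (w * (D z t)\<^sup>2 + w * ((4 * (64 * real m)\<^sup>2 * 4096) * (1 + N t))) + \<nu> * (2 * (4 * ker2_bd n) * (2 * (ker2_grad_bd n * (1 + N t))))"
      using A nu by (intro add_mono mult_left_mono y mult_mono Qb Db t0) (use ker2_bd_pos[of n] in auto)
    finally show ?case by (simp add: mult_ac)
  qed
  have D2i: "integrable (ivl \<tau>) (\<lambda>t. (D z t)\<^sup>2)" unfolding D_def by (rule d2_int)
  have Gd2: "(LINT t|ivl \<tau>. (D z t)\<^sup>2) = d2 ?x c" unfolding D_def d2_def ..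
  have "\<bar>LINT t|ivl \<tau>. R t\<bar> \<le> (LINT t|ivl \<tau>. \<bar>R t\<bar>)" using integral_norm_bound[of "ivl \<tau>" R] by simp
  also have "\<dots> \<le> (LINT t|ivl \<tau>. A * (w * (D z t)\<^sup>2 + w * (4 * (64 * real m)\<^sup>2 * 4096) * (1 + N t)) + 16 * ker2_bd n * \<nu> * ker2_grad_bd n * (1 + N t))"
    by (rule integral_mono_AE[OF _ _ Rb]) (use Ri D2i one_plus_N(1) in auto)
  also have "\<dots> = A * (w * d2 ?x c + w * (4 * (64 * real m)\<^sup>2 * 4096) * (LINT t|ivl \<tau>. 1 + N t)) + 16 * ker2_bd n * \<nu> * ker2_grad_bd n * (LINT t|ivl \<tau>. 1 + N t)"
    using D2i one_plus_N(1) unfolding Gd2[symmetric] by simp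
  also have "\<dots> \<le> A * (w * d2 ?x c + w * (4 * (64 * real m)\<^sup>2 * 4096) * B) + 16 * ker2_bd n * \<nu> * ker2_grad_bd n * B"
    using A nu w ker2_bd_pos[of n] ker2_grad_bd_pos[of n] by (intro add_mono mult_left_mono add_left_mono one_plus_N(2)) auto
  finally have RI: "\<bar>LINT t|ivl \<tau>. R t\<bar> \<le> A * (w * d2 ?x c + C1 * w) + 16 * ker2_bd n * \<nu> * ker2_grad_bd n * B"
    unfolding C1_def by (simp add: mult_ac)
  have "\<bar>d0\<bar> \<le> 4 * ker2_bd n" unfolding d0_def by (intro abs_diff_4 Theta0_bound)
  from power_mono[OF this, of 2] have dd: "d0\<^sup>2 \<le> 16 * (ker2_bd n)\<^sup>2" by (simp add: power_mult_distrib)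
  from power_mono[OF Db[of \<tau> z], of 2] have dt: "(D z \<tau>)\<^sup>2 \<le> 16 * (ker2_bd n)\<^sup>2" using tau by (simp add: power_mult_distrib)
  have "\<bar>A * \<omega> * G'\<bar> \<le> A * (w * d2 ?x c + C1 * w) + Cn"
    unfolding id Cn_def using RI dd dt zero_le_power2[of d0] zero_le_power2[of "D z \<tau>"] by linarith
  moreover have "\<bar>A * \<omega> * G'\<bar> = A * (\<bar>\<omega>\<bar> * \<bar>G'\<bar>)" using A by (simp add: abs_mult)
  moreover have "A * (w * d2 ?x c + C1 * w) + Cn = A * (w * d2 ?x c + C1 * w + Cn / A)" using A by (simp add: distrib_left)
  ultimately have "\<bar>\<omega>\<bar> * \<bar>G'\<bar> \<le> w * d2 ?x c + C1 * w + Cn / A"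
    using A mult_le_cancel_left_pos by metis
  moreover have "\<bar>\<omega>\<bar> = 2 * pi * \<bar>sin (2 * pi * real m * z)\<bar>" unfolding \<omega>_def using \<sigma> by (simp add: abs_mult)
  ultimately show ?thesis using der[of z] unfolding keq[symmetric] G'_def[symmetric] by auto
qed

end

context cellular_decay
begin

definition l :: real where "l = ln (real n + 1)"

text \<open>Outcome of an absorption: with s0 = 4096 w^2 B, the supremum M over an edge satisfies M
  \<le> 4 s0 + 4 l (w M + C1 w + Cn/A). If 4 l w \<le> 1/2, half of M is absorbed and the constants
  double, so 32768 = 8 * 4096.\<close>

definition \<epsilon> :: real where "\<epsilon> = 32768 * w\<^sup>2 * B + 8 * l * (C1 * w + Cn / A)"

lemma h: "0 < h" "h \<le> 1/2"
  unfolding h_def using m by (auto simp: field_simps)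

lemma l_nonneg: "0 \<le> l" unfolding l_def by simp

lemma l_rho: "l = - ln \<rho>" unfolding l_def \<rho>_def by (simp add: ln_div)

lemma C_nonneg: "0 \<le> C1" "0 \<le> Cn"
  unfolding C1_def Cn_def using one_plus_N(3) ker2_bd_pos[of n] ker2_grad_bd_pos[of n] nu by auto

lemma eps_nonneg: "0 \<le> \<epsilon>"
  unfolding \<epsilon>_def using C_nonneg l_nonneg A w one_plus_N(3) by (intro add_nonneg_nonneg mult_nonneg_nonneg) auto

lemma d2_nonneg: "0 \<le> d2 x y" unfolding d2_def by simp

text \<open>The logarithm is the travel time along the separatrix between two points at distance $\rho$ from its end points.\<close>

lemma edge_bound:
  assumes ed: "edge m c e" and rh: "2 * \<rho> < h" and small: "4 * l * w \<le> 1/2" and z: "0 \<le> z" "z \<le> h"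
  shows "d2 (c + z *\<^sub>R e) c \<le> \<epsilon>"
proof -
  have e: "e = (1, 0) \<or> e = (0, 1)" using ed unfolding edge_def by auto
  define G where "G z = d2 (c + z *\<^sub>R e) c" for z
  have "\<forall>z. \<exists>G'. (G has_field_derivative G') (at z) \<and> 2 * pi * \<bar>sin (2 * pi * real m * z)\<bar> * \<bar>G'\<bar> \<le> w * G z + C1 * w + Cn / A"
    unfolding G_def using edge_derivative[OF ed] by blast
  then obtain G' where G': "\<And>z. (G has_field_derivative G' z) (at z)"
    "\<And>z. 2 * pi * \<bar>sin (2 * pi * real m * z)\<bar> * \<bar>G' z\<bar> \<le> w * G z + C1 * w + Cn / A" by metis
  \<comment> \<open>The differential inequality contains G on its right-hand side. It is replaced
    there by its supremum over the edge, finite by \<open>d2_le\<close>, and absorbed at the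
    end.\<close>
  define M where "M = Sup (G ` {0..h})"
  have bdd: "bdd_above (G ` {0..h})" unfolding G_def by (rule bdd_aboveI2) (rule d2_le)
  have GM: "G z \<le> M" if "z \<in> {0..h}" for z unfolding M_def using that bdd by (intro cSup_upper) auto
  have M0: "0 \<le> M" using GM[of 0] h d2_nonneg[of "c + 0 *\<^sub>R e" c] unfolding G_def by auto
  define \<kappa> where "\<kappa> = w * M + C1 * w + Cn / A"
  have k0: "0 \<le> \<kappa>" unfolding \<kappa>_def using M0 w C_nonneg A by (intro add_nonneg_nonneg) auto
  define s0 where "s0 = 4096 * w\<^sup>2 * B"
  have s0: "0 \<le> s0" unfolding s0_def using one_plus_N(3) by auto
  \<comment> \<open>On the edge 2 pi m z = pi z/h, and Jordan's inequality bounds the sine below by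
    the distance to the nearer end. Replacing the reciprocal of the minimum by a sum of reciprocals
    gives an explicit primitive.\<close>
  have G'b: "\<bar>G' z\<bar> \<le> \<kappa> * (1 / z + 1 / (h - z))" if z: "\<rho> \<le> z" "z \<le> h - \<rho>" for z
  proof -
    have zp: "0 < z" "0 < h - z" using z rho by auto
    define \<mu> where "\<mu> = min z (h - z)"
    have mu: "\<mu> > 0" unfolding \<mu>_def using zp by simp
    have a: "2 * pi * real m * z = pi * (z / h)" unfolding h_def by simp
    have b: "2 * min \<bar>z / h\<bar> (1 - \<bar>z / h\<bar>) \<le> \<bar>sin (pi * (z / h))\<bar>"
      using zp h by (intro abs_sin_ge_min) auto
    have d: "\<mu> \<le> min \<bar>z / h\<bar> (1 - \<bar>z / h\<bar>)"
    proof -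
      have "\<bar>z / h\<bar> = z / h" using zp h by simp
      moreover have "z \<le> z / h" "h - z \<le> (h - z) / h"
        using zp h by (simp_all add: le_divide_eq mult_left_le)
      moreover have "(h - z) / h = 1 - z / h" using h by (simp add: diff_divide_distrib)
      ultimately show ?thesis unfolding \<mu>_def by auto
    qed
    have "\<mu> \<le> 2 * \<mu>" using mu by simp
    also have "\<dots> \<le> 2 * min \<bar>z / h\<bar> (1 - \<bar>z / h\<bar>)" by (rule mult_left_mono[OF d]) simp
    also have "\<dots> \<le> 1 * \<bar>sin (2 * pi * real m * z)\<bar>" unfolding a using b by simp
    also have "\<dots> \<le> 2 * pi * \<bar>sin (2 * pi * real m * z)\<bar>"
      using pi_gt3 by (intro mult_right_mono) auto
    finally have "\<mu> * \<bar>G' z\<bar> \<le> 2 * pi * \<bar>sin (2 * pi * real m * z)\<bar> * \<bar>G' z\<bar>" by (intro mult_right_mono) auto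
    also have "\<dots> \<le> w * G z + C1 * w + Cn / A" by (rule G'(2))
    also have "\<dots> \<le> \<kappa>" unfolding \<kappa>_def using GM[of z] zp w by (simp add: mult_left_mono)
    finally have "\<bar>G' z\<bar> \<le> \<kappa> * (1 / \<mu>)" using mu by (simp add: field_simps)
    also have "\<dots> \<le> \<kappa> * (1 / z + 1 / (h - z))"
    proof (rule mult_left_mono[OF _ k0])
      show "1 / \<mu> \<le> 1 / z + 1 / (h - z)" unfolding \<mu>_def using zp by (cases "z \<le> h - z") (auto simp: min_def)
    qed
    finally show ?thesis .
  qed
  have Gr: "G z \<le> s0" if "0 \<le> z" "z \<le> \<rho>" for z
    using d2_close[OF e, of z 0 c] that unfolding G_def s0_def by simp
  have mid: "G z \<le> s0 + 2 * l * \<kappa>" if z: "\<rho> \<le> z" "z \<le> h - \<rho>" for z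
  proof -
    \<comment> \<open>The difference of logarithms is a primitive of 1/x + 1/(h - x). Monotonicity
      of \<Psi> is the integrated form of the bound on G', started at \<rho>, where G is at most
      s0.\<close>
    define \<Psi> where "\<Psi> x = \<kappa> * (ln x - ln (h - x)) - G x" for x
    have "\<Psi> \<rho> \<le> \<Psi> z"
    proof (rule DERIV_nonneg_imp_nondecreasing[OF z(1)])
      fix x assume x: "\<rho> \<le> x" "x \<le> z"
      have xp: "0 < x" "0 < h - x" using x z rho by auto
      have "(\<Psi> has_field_derivative (\<kappa> * (1 / x - (1 / (h - x)) * (0 - 1)) - G' x)) (at x)"
        unfolding \<Psi>_def[abs_def] using xp
        by (intro DERIV_diff DERIV_cmult G'(1) DERIV_ln_divide DERIV_chain2[OF DERIV_ln_divide] derivative_intros) auto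
      moreover have "0 \<le> \<kappa> * (1 / x - (1 / (h - x)) * (0 - 1)) - G' x"
        using G'b[of x] x z by simp
      ultimately show "\<exists>y. (\<Psi> has_real_derivative y) (at x) \<and> 0 \<le> y" by blast
    qed
    then have "G z \<le> G \<rho> + \<kappa> * ((ln z - ln (h - z)) - (ln \<rho> - ln (h - \<rho>)))"
      unfolding \<Psi>_def by (simp add: algebra_simps)
    also have "\<dots> \<le> s0 + \<kappa> * (2 * l)"
    proof (intro add_mono mult_left_mono k0)
      show "G \<rho> \<le> s0" using Gr[of \<rho>] rho by simp
      have "ln z \<le> 0" "ln (h - \<rho>) \<le> 0" using z h rho rh by auto
      moreover have "ln \<rho> \<le> ln (h - z)" using z rho by simp
      ultimately show "ln z - ln (h - z) - (ln \<rho> - ln (h - \<rho>)) \<le> 2 * l" unfolding l_rho by linarith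
    qed
    finally show ?thesis by (simp add: mult_ac)
  qed
  have lk: "0 \<le> l * \<kappa>" using l_nonneg k0 by simp
  have all: "G z \<le> 4 * s0 + 4 * l * \<kappa>" if z: "0 \<le> z" "z \<le> h" for z
  proof -
    consider "z \<le> \<rho>" | "\<rho> \<le> z" "z \<le> h - \<rho>" | "h - \<rho> \<le> z" by linarith
    then show ?thesis
    proof cases
      case 1 then show ?thesis using Gr[of z] z s0 lk by simp
    next
      case 2 then show ?thesis using mid[of z] s0 lk by simp
    next
      case 3
      \<comment> \<open>The last stretch, of length \<rho>, is crossed by \<open>d2_close\<close>
        from the point h - \<rho>, at the price of the factor 2 in the triangle inequality.\<close>
      have "G z \<le> 2 * d2 (c + z *\<^sub>R e) (c + (h - \<rho>) *\<^sub>R e) + 2 * G (h - \<rho>)"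
        unfolding G_def by (rule d2_triangle)
      moreover have "d2 (c + z *\<^sub>R e) (c + (h - \<rho>) *\<^sub>R e) \<le> s0"
        unfolding s0_def by (rule d2_close[OF e]) (use 3 z in auto)
      moreover have "G (h - \<rho>) \<le> s0 + 2 * l * \<kappa>" by (rule mid) (use rh in auto)
      ultimately show ?thesis by linarith
    qed
  qed
  have "M \<le> 4 * s0 + 4 * l * \<kappa>"
    unfolding M_def by (rule cSup_least) (use all h in auto)
  also have "4 * l * \<kappa> = 4 * l * w * M + 4 * l * (C1 * w + Cn / A)" unfolding \<kappa>_def by (simp add: algebra_simps)
  also have "4 * l * w * M \<le> 1/2 * M" by (intro mult_right_mono small M0)
  finally have "M \<le> \<epsilon>" unfolding \<epsilon>_def s0_def by simp
  then show ?thesis using GM[of z] z unfolding G_def by simp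
qed

section \<open>From one edge to the whole grid, and from the grid to the energy\<close>

context
  assumes rh: "2 * \<rho> < h" and small: "4 * l * w \<le> 1/2"
begin

text \<open>The triangle inequality for squares gives 2 \<epsilon> + 2 * 4^k \<epsilon>, which is at
  most 4^(k+1) \<epsilon>. The number of steps is bounded in terms of m alone, so the geometric
  growth is affordable.\<close>

lemma corner_step:
  assumes e: "e = (1, 0) \<or> e = (0, 1)" and b: "d2 (real i * h, real j * h) (0, 0) \<le> 4 ^ k * \<epsilon>" and z: "0 \<le> z" "z \<le> h"
  shows "d2 ((real i * h, real j * h) + z *\<^sub>R e) (0, 0) \<le> 4 ^ Suc k * \<epsilon>"
proof -
  have "edge m (real i * h, real j * h) e"
    using edge_grid[OF m, of i j] e unfolding h_def by auto
  from edge_bound[OF this rh small z]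
  have "d2 ((real i * h, real j * h) + z *\<^sub>R e) (0, 0) \<le> 2 * \<epsilon> + 2 * (4 ^ k * \<epsilon>)"
    using d2_triangle[of "(real i * h, real j * h) + z *\<^sub>R e" "(0, 0)" "(real i * h, real j * h)"] b by linarith
  also have "\<dots> \<le> 2 * (4 ^ k * \<epsilon>) + 2 * (4 ^ k * \<epsilon>)"
    using mult_right_mono[OF one_le_power[of "4::real" k] eps_nonneg] by simp
  finally show ?thesis by simp
qed

text \<open>The path goes up the left side of the cell and along a horizontal grid line: i + j edges
  in all.\<close>

lemma corner_bound: "d2 (real i * h, real j * h) (0, 0) \<le> 4 ^ (i + j) * \<epsilon>"
proof (induction i)
  case 0
  show ?case
  proof (induction j)
    case 0
    then show ?case using eps_nonneg by (simp add: d2_self)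
  next
    case (Suc j)
    from corner_step[of "(0, 1)" 0 j "0 + j" h] Suc h show ?case by (simp add: distrib_right add.commute)
  qed
next
  case (Suc i)
  from corner_step[of "(1, 0)" i j "i + j" h] Suc h show ?case by (simp add: distrib_right add.commute)
qed

definition \<beta> :: "real \<Rightarrow> real" where "\<beta> s = real_of_int \<lfloor>2 * real m * s\<rfloor> / (2 * real m)"

lemma beta_measurable [measurable]: "\<beta> \<in> borel_measurable borel"
  unfolding \<beta>_def[abs_def] by measurable

lemma beta:
  assumes "0 \<le> s" "s \<le> 1"
  obtains i where "\<beta> s = real i * h" "i \<le> 2 * m" "0 \<le> s - \<beta> s" "s - \<beta> s \<le> h"
proof -
  define i where "i = nat \<lfloor>2 * real m * s\<rfloor>"
  have 0: "0 \<le> \<lfloor>2 * real m * s\<rfloor>" using assms by simp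
  then have ri: "real i = real_of_int \<lfloor>2 * real m * s\<rfloor>" unfolding i_def by simp
  have mp: "0 < 2 * real m" using m by simp
  have "real i \<le> 2 * real m * s" "2 * real m * s \<le> real i + 1" unfolding ri by linarith+
  moreover have "2 * real m * s \<le> 2 * real m * 1" using assms by (intro mult_left_mono) auto
  ultimately have a: "real i \<le> 2 * real m * s" "2 * real m * s \<le> real i + 1" "real i \<le> real (2 * m)" by auto
  have b: "\<beta> s = real i / (2 * real m)" unfolding \<beta>_def ri ..
  show thesis
  proof (rule that[of i])
    show "\<beta> s = real i * h" unfolding b h_def by simp
    show "i \<le> 2 * m" using a(3) of_nat_le_iff by blast
    show "0 \<le> s - \<beta> s" unfolding b using a(1) mp by (simp add: divide_le_eq mult.commute)
    have "s \<le> (real i + 1) / (2 * real m)" using a(2) mp by (simp add: le_divide_eq mult.commute)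
    then show "s - \<beta> s \<le> h" unfolding b h_def by (simp add: add_divide_distrib)
  qed
qed

text \<open>The point lies on a horizontal edge that starts at a corner with indices i and j, so i +
  j full edges and part of one more lead to it. Both indices are at most 2 m, hence the exponent 4 m
  + 1.\<close>

lemma row_bound:
  assumes x: "x \<in> cell"
  shows "d2 (fst x, \<beta> (snd x)) (0, 0) \<le> 4 ^ (4 * m + 1) * \<epsilon>"
proof -
  have x01: "0 \<le> fst x" "fst x \<le> 1" "0 \<le> snd x" "snd x \<le> 1" using x unfolding cell_def by auto
  obtain i where i: "\<beta> (fst x) = real i * h" "i \<le> 2 * m" "0 \<le> fst x - \<beta> (fst x)" "fst x - \<beta> (fst x) \<le> h"
    using beta[OF x01(1,2)] .
  obtain j where j: "\<beta> (snd x) = real j * h" "j \<le> 2 * m" using beta[OF x01(3,4)] .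
  have "d2 ((real i * h, real j * h) + (fst x - \<beta> (fst x)) *\<^sub>R (1, 0)) (0, 0) \<le> 4 ^ Suc (i + j) * \<epsilon>"
    by (rule corner_step[OF _ corner_bound i(3,4)]) auto
  then have "d2 (fst x, \<beta> (snd x)) (0, 0) \<le> 4 ^ Suc (i + j) * \<epsilon>" using i(1) j(1) by simp
  also have "\<dots> \<le> 4 ^ (4 * m + 1) * \<epsilon>"
    using i(2) j(2) by (intro mult_right_mono eps_nonneg power_increasing) auto
  finally show ?thesis .
qed

definition Y :: "real \<Rightarrow> real" where "Y t = (LINT x|Mx. (\<Theta> (fst x, \<beta> (snd x)) t - \<Theta> (0, 0) t)\<^sup>2)"

text \<open>By Fubini the time integral of Y is the average over the cell of \<open>d2\<close>
  between row points and the origin. The edge estimates bound that quantity, whereas Y at a single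
  time is not controlled by them.\<close>

lemma Y_int: "integrable (ivl \<tau>) Y" "(LINT t|ivl \<tau>. Y t) \<le> 4 ^ (4 * m + 1) * \<epsilon>"
proof -
  let ?f = "\<lambda>x t. (\<Theta> (fst x, \<beta> (snd x)) t - \<Theta> (0, 0) t)\<^sup>2"
  have mm: "(\<lambda>z. ?f (fst z) (snd z)) \<in> borel_measurable borel"
    unfolding \<Theta>_def mol_def by measurable
  have bd: "\<bar>?f x t\<bar> \<le> (4 * ker2_bd n)\<^sup>2" if "0 \<le> t" for x t
    using power_mono[OF abs_diff_4[OF Theta_bound Theta_bound], of t t "(fst x, \<beta> (snd x))" "(0,0)" 2] that by simp
  have sm: "(\<lambda>x. ?f x t) \<in> borel_measurable borel" for t unfolding \<Theta>_def mol_def by measurable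
  have fi: "integrable Mx (\<lambda>x. ?f x t)" if "0 \<le> t" for t
    by (rule Mx.integrable_const_bound[where B="(4 * ker2_bd n)\<^sup>2"]) (use bd[OF that] sm in auto)
  have "integrable (Mx \<Otimes>\<^sub>M ivl \<tau>) (\<lambda>z. ?f (fst z) (snd z))"
  proof (rule integrable_Mt_I[where f="?f", OF mm])
    show "AE t in ivl \<tau>. integrable Mx (\<lambda>x. ?f x t)" using AE_tau by eventually_elim (use fi in auto)
    show "integrable (ivl \<tau>) (\<lambda>t. LINT x|Mx. \<bar>?f x t\<bar>)"
    proof (rule ivl.integrable_const_bound[where B="(4 * ker2_bd n)\<^sup>2"])
      show "AE t in ivl \<tau>. norm (LINT x|Mx. \<bar>?f x t\<bar>) \<le> (4 * ker2_bd n)\<^sup>2"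
        using AE_tau
      proof eventually_elim
        case (elim t)
        have "(LINT x|Mx. \<bar>?f x t\<bar>) \<le> (LINT x|Mx. (4 * ker2_bd n)\<^sup>2)"
          by (rule integral_mono') (use bd[of t] elim in auto)
        then show ?case by simp
      qed
      show "(\<lambda>t. LINT x|Mx. \<bar>?f x t\<bar>) \<in> borel_measurable (ivl \<tau>)" unfolding \<Theta>_def mol_def by measurable
    qed
  qed
  then have i: "integrable (Mx \<Otimes>\<^sub>M ivl \<tau>) (case_prod ?f)" by (simp add: split_beta')
  show "integrable (ivl \<tau>) Y" unfolding Y_def[abs_def] by (rule Mt.integrable_snd[OF i])
  have "(LINT t|ivl \<tau>. Y t) = (LINT x|Mx. d2 (fst x, \<beta> (snd x)) (0, 0))"
    unfolding Y_def d2_def by (rule Mt.Fubini_integral[OF i])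
  also have "\<dots> \<le> (LINT x|Mx. 4 ^ (4 * m + 1) * \<epsilon>)"
  proof (rule integral_mono_AE)
    show "integrable Mx (\<lambda>x. d2 (fst x, \<beta> (snd x)) (0, 0))" unfolding d2_def by (rule Mt.integrable_fst[OF i])
    show "AE x in Mx. d2 (fst x, \<beta> (snd x)) (0, 0) \<le> 4 ^ (4 * m + 1) * \<epsilon>"
      using AE_Mx_cell by eventually_elim (rule row_bound)
  qed simp
  finally show "(LINT t|ivl \<tau>. Y t) \<le> 4 ^ (4 * m + 1) * \<epsilon>" by simp
qed

text \<open>The mean is zero, so E is at most the squared distance to any constant, here the value c
  at the origin. That distance is split into the mollification error, the passage to the row below,
  and the deviation on the rows; the weights 2, 4, 4 produce 8 \<rho>, 4 h and 4 Y.\<close>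

lemma E_slice_bound:
  assumes t: "good t"
  shows "E t \<le> (8 * \<rho> + 4 * h) * (1 + N t) + 4 * Y t"
proof -
  have t0: "0 \<le> t" and wg: "wgrad (\<lambda>y. \<theta> y t) (\<lambda>y. g y t)" using t unfolding good_def by auto
  note gf = good_facts[OF t]
  define c where "c = \<Theta> (0, 0) t"
  have thi: "integrable Mx (\<lambda>x. \<theta> x t)" and th2: "integrable Mx (\<lambda>x. (\<theta> x t)\<^sup>2)" using th_int th_sq t0 by auto
  have Tc: "continuous_on UNIV (\<lambda>x. \<Theta> x t)" unfolding \<Theta>_def by (rule mol_continuous[OF thi])
  have T2: "integrable Mx (\<lambda>x. (\<Theta> x t)\<^sup>2)" by (intro Mx_integral_continuous(1) continuous_intros Tc)
  have [measurable]: "(\<lambda>x. \<Theta> x t) \<in> borel_measurable borel" using Tc by (rule borel_measurable_continuous_onI)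
  have i1: "integrable Mx (\<lambda>x. (\<theta> x t - \<Theta> x t)\<^sup>2)"
    using th2 T2 integrable_mult_of_squares[of "\<lambda>x. \<theta> x t" Mx "\<lambda>x. \<Theta> x t"] by (simp add: power2_diff mult.assoc)
  have [measurable]: "(\<lambda>x. \<Theta> (fst x, \<beta> (snd x)) t) \<in> borel_measurable borel"
    unfolding \<Theta>_def mol_def by measurable
  have Tb: "\<bar>\<Theta> x t - \<Theta> y t\<bar> \<le> 4 * ker2_bd n" for x y by (intro abs_diff_4 Theta_bound t0)
  have sqb: "(\<Theta> x t - \<Theta> y t)\<^sup>2 \<le> (4 * ker2_bd n)\<^sup>2" for x y using power_mono[OF Tb[of x y], of 2] by simp
  have i2: "integrable Mx (\<lambda>x. (\<Theta> x t - \<Theta> (fst x, \<beta> (snd x)) t)\<^sup>2)" "integrable Mx (\<lambda>x. (\<Theta> (fst x, \<beta> (snd x)) t - c)\<^sup>2)"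
    unfolding c_def using sqb by (auto intro!: Mx.integrable_const_bound[where B="(4 * ker2_bd n)\<^sup>2"])
  have "E t \<le> (LINT x|Mx. (\<theta> x t - c)\<^sup>2)"
  proof -
    have z: "(LINT x|Mx. \<theta> x t) = 0" using mean_conserved[OF t0] mean0 by simp
    have "(LINT x|Mx. (\<theta> x t - c)\<^sup>2) = (LINT x|Mx. (\<theta> x t)\<^sup>2 - 2 * c * \<theta> x t + c\<^sup>2)"
      by (simp add: power2_diff algebra_simps)
    also have "\<dots> = E t - 2 * c * (LINT x|Mx. \<theta> x t) + c\<^sup>2" unfolding E_def using thi th2 by simp
    finally show ?thesis using z by simp
  qed
  also have "\<dots> \<le> (LINT x|Mx. 2 * (\<theta> x t - \<Theta> x t)\<^sup>2 + 4 * (\<Theta> x t - \<Theta> (fst x, \<beta> (snd x)) t)\<^sup>2 + 4 * (\<Theta> (fst x, \<beta> (snd x)) t - c)\<^sup>2)"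
  proof (rule integral_mono')
    show "integrable Mx (\<lambda>x. 2 * (\<theta> x t - \<Theta> x t)\<^sup>2 + 4 * (\<Theta> x t - \<Theta> (fst x, \<beta> (snd x)) t)\<^sup>2 + 4 * (\<Theta> (fst x, \<beta> (snd x)) t - c)\<^sup>2)"
      using i1 i2 by auto
    fix x
    have "(a + b + d)\<^sup>2 \<le> 2 * a\<^sup>2 + 4 * b\<^sup>2 + 4 * d\<^sup>2" for a b d :: real
      using zero_le_power2[of "a - (b + d)"] zero_le_power2[of "b - d"] by (simp add: power2_eq_square algebra_simps)
    from this[of "\<theta> x t - \<Theta> x t" "\<Theta> x t - \<Theta> (fst x, \<beta> (snd x)) t" "\<Theta> (fst x, \<beta> (snd x)) t - c"]
    show "(\<theta> x t - c)\<^sup>2 \<le> 2 * (\<theta> x t - \<Theta> x t)\<^sup>2 + 4 * (\<Theta> x t - \<Theta> (fst x, \<beta> (snd x)) t)\<^sup>2 + 4 * (\<Theta> (fst x, \<beta> (snd x)) t - c)\<^sup>2" by simp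
  qed auto
  also have "\<dots> = 2 * (LINT x|Mx. (\<theta> x t - \<Theta> x t)\<^sup>2) + 4 * (LINT x|Mx. (\<Theta> x t - \<Theta> (fst x, \<beta> (snd x)) t)\<^sup>2) + 4 * Y t"
    unfolding Y_def c_def[symmetric] using i1 i2 by simp
  also have "\<dots> \<le> 2 * (4 * \<rho> * (1 + N t)) + 4 * (h * (1 + N t)) + 4 * Y t"
  proof (intro add_mono mult_left_mono)
    have "(LINT x|Mx. (\<theta> x t - \<Theta> x t)\<^sup>2) \<le> 4 * \<rho> * (LINT x|Mx. (norm (g x t))\<^sup>2)"
      using wgrad_smoothing[OF wg, of n] unfolding \<Theta>_def \<rho>_def by simp
    also have "\<dots> \<le> 4 * \<rho> * (1 + N t)" using rho by (intro mult_left_mono gf) auto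
    finally show "(LINT x|Mx. (\<theta> x t - \<Theta> x t)\<^sup>2) \<le> 4 * \<rho> * (1 + N t)" .
    have "(LINT x|Mx. (\<Theta> x t - \<Theta> (fst x, \<beta> (snd x)) t)\<^sup>2) \<le> h * (LINT x|Mx. (norm (g x t))\<^sup>2)"
      unfolding \<Theta>_def
    proof (rule wgrad_row_bound[OF wg])
      fix x assume x: "x \<in> cell"
      then have x01: "0 \<le> snd x" "snd x \<le> 1" unfolding cell_def by auto
      obtain j where j: "\<beta> (snd x) = real j * h" "0 \<le> snd x - \<beta> (snd x)" "snd x - \<beta> (snd x) \<le> h" using beta[OF x01] .
      have "0 \<le> \<beta> (snd x)" unfolding j(1) using h by simp
      then show "\<bar>snd x - \<beta> (snd x)\<bar> \<le> h \<and> 0 \<le> \<beta> (snd x) \<and> \<beta> (snd x) \<le> 1" using j x01 by auto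
    qed simp
    also have "\<dots> \<le> h * (1 + N t)" using h by (intro mult_left_mono gf) auto
    finally show "(LINT x|Mx. (\<Theta> x t - \<Theta> (fst x, \<beta> (snd x)) t)\<^sup>2) \<le> h * (1 + N t)" .
  qed auto
  finally show ?thesis by (simp add: algebra_simps)
qed

text \<open>The energy is nonincreasing, so a value above 1/4 at the end keeps it above 1/4 on all
  of [0, \<tau>], and the slice bound can be integrated. The right-hand side can be made small by
  the parameters, which gives the contradiction.\<close>

theorem decay:
  assumes E: "E \<tau> > 1/4"
  shows "\<tau> / 4 \<le> (8 * \<rho> + 4 * h) * B + 4 ^ (4 * m + 2) * \<epsilon>"
proof -
  have E14: "1/4 \<le> E t" if t: "0 \<le> t" "t \<le> \<tau>" for t
  proof -
    have "(LINT s|ivl t. N s) = (LINT s|ivl \<tau>. (if s \<le> t then N s else 0))"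
      using ivl_restrict(1)[of N t \<tau>] t by simp
    also have "\<dots> \<le> (LINT s|ivl \<tau>. N s)"
      by (rule integral_mono') (use N_int(1)[of \<tau>] tau N_nonneg in auto)
    finally have "2 * \<nu> * (LINT s|ivl t. N s) \<le> 2 * \<nu> * (LINT s|ivl \<tau>. N s)" using nu by simp
    then show ?thesis using energy_identity[of t] energy_identity[of \<tau>] t E by simp
  qed
  have "AE t in ivl \<tau>. 1/4 \<le> (8 * \<rho> + 4 * h) * (1 + N t) + 4 * Y t"
    using AE_good_tau
  proof eventually_elim
    case (elim t)
    then show ?case using E_slice_bound[of t] E14[of t] unfolding good_def by linarith
  qed
  then have "(LINT t|ivl \<tau>. 1/4) \<le> (LINT t|ivl \<tau>. (8 * \<rho> + 4 * h) * (1 + N t) + 4 * Y t)"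
    by (intro integral_mono_AE) (use one_plus_N(1) Y_int(1) in auto)
  also have "\<dots> = (8 * \<rho> + 4 * h) * (LINT t|ivl \<tau>. 1 + N t) + 4 * (LINT t|ivl \<tau>. Y t)"
    using one_plus_N(1) Y_int(1) by (subst Bochner_Integration.integral_add) auto
  also have "\<dots> \<le> (8 * \<rho> + 4 * h) * B + 4 * (4 ^ (4 * m + 1) * \<epsilon>)"
    by (intro add_mono mult_left_mono one_plus_N(2) Y_int(2)) (use rho h in auto)
  finally show ?thesis using tau by (simp add: measure_ivl_UNIV)
qed

end

end

section \<open>Decay of weak solutions\<close>

text \<open>A translation between set integrals and product measures. It rests on Borel
  measurability of all integrands, which for test functions and their derivatives follows from
  continuity.\<close>

lemma weak_solution_cellular:
  assumes p: "p > 2" and nu: "\<nu> > 0"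
    and th0: "\<theta>0 \<in> borel_measurable lborel" "set_integrable lborel cell (\<lambda>x. (\<theta>0 x)\<^sup>2)"
    and ws: "weak_solution p \<nu> (\<lambda>x. A *\<^sub>R cell_flow (real m *\<^sub>R x)) \<theta>0 \<theta>"
  obtains g where "cellular_solution p \<nu> A m \<theta>0 \<theta> g"
proof -
  note ws = ws[unfolded weak_solution_def]
  obtain g where g: "(\<lambda>z. g (fst z) (snd z)) \<in> borel_measurable lborel"
    "\<forall>T\<ge>0. set_integrable lborel (cell \<times> {0..T}) (\<lambda>z. norm (g (fst z) (snd z)) powr p)"
    "\<forall>\<psi> D T. test_function \<psi> D \<and> T \<ge> 0 \<longrightarrow>
        (LINT z:(cell \<times> {0..T})|lborel. \<theta> (fst z) (snd z) *\<^sub>R fst (D z))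
        = - (LINT z:(cell \<times> {0..T})|lborel. \<psi> (fst z) (snd z) *\<^sub>R g (fst z) (snd z))"
    "\<forall>\<psi> D t. test_function \<psi> D \<and> t \<ge> 0 \<longrightarrow>
        (LINT x:cell|lborel. \<theta> x t * \<psi> x t) - (LINT x:cell|lborel. \<theta>0 x * \<psi> x 0)
        = (LINT z:(cell \<times> {0..t})|lborel.
             \<theta> (fst z) (snd z) * snd (D z)
             - inner (A *\<^sub>R cell_flow (real m *\<^sub>R fst z)) (g (fst z) (snd z)) * \<psi> (fst z) (snd z)
             - \<nu> * norm (g (fst z) (snd z)) powr (p - 2) * inner (g (fst z) (snd z)) (fst (D z)))"
    using ws by (elim conjE exE) (rule that; assumption)
  have [measurable]: "\<theta>0 \<in> borel_measurable borel" using th0 by simp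
  have tm: "(\<lambda>z. \<theta> (fst z) (snd z)) \<in> borel_measurable borel" using ws by simp
  have gm: "(\<lambda>z. g (fst z) (snd z)) \<in> borel_measurable borel" using g(1) by simp
  note [measurable] = tm gm
  have comp: "(\<lambda>x. f x t) \<in> borel_measurable borel"
    if "(\<lambda>z. f (fst z) (snd z)) \<in> borel_measurable borel" for f :: "real \<times> real \<Rightarrow> real \<Rightarrow> real" and t
  proof -
    have "(\<lambda>x. (x, t)) \<in> borel \<rightarrow>\<^sub>M (borel :: ((real\<times>real)\<times>real) measure)"
      by (intro borel_measurable_continuous_onI continuous_intros)
    from measurable_compose[OF this that] show ?thesis by simp
  qed
  have th2[measurable]: "(\<lambda>x. \<theta> x t) \<in> borel_measurable borel" for t by (rule comp[OF tm])
  have umm[measurable]: "(\<lambda>z. cflow m (fst z)) \<in> borel_measurable (borel :: ((real\<times>real)\<times>real) measure)"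
    by (intro borel_measurable_continuous_onI continuous_on_compose2[OF cflow_continuous continuous_on_fst[OF continuous_on_id]]) simp
  have tf: "(\<lambda>z. \<psi> (fst z) (snd z)) \<in> borel_measurable borel" "D \<in> borel_measurable borel" if "test_function \<psi> D" for \<psi> D
  proof -
    have "\<And>z. isCont (\<lambda>w. \<psi> (fst w) (snd w)) z"
      using that unfolding test_function_def by (meson has_derivative_continuous)
    then show "(\<lambda>z. \<psi> (fst z) (snd z)) \<in> borel_measurable borel"
      by (intro borel_measurable_continuous_onI) (simp add: continuous_at_imp_continuous_on)
    show "D \<in> borel_measurable borel"
      using that unfolding test_function_def by (intro borel_measurable_continuous_onI) auto
  qed
  have "cellular_solution p \<nu> A m \<theta>0 \<theta> g"
  proof
    show "integrable Mx (\<lambda>x. (\<theta>0 x)\<^sup>2)" using th0(2) by (subst Mx_integral(2)[symmetric]) auto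
    show "integrable Mx (\<lambda>x. (\<theta> x t)\<^sup>2)" if "0 \<le> t" for t
      using ws that by (subst Mx_integral(2)[symmetric]) auto
    show "((\<lambda>s. LINT x|Mx. (\<theta> x s - \<theta> x t)\<^sup>2) \<longlongrightarrow> 0) (at t within {0..})" if "0 \<le> t" for t
    proof -
      have eq: "(LINT x:cell|lborel. (\<theta> x s - \<theta> x t)\<^sup>2) = (LINT x|Mx. (\<theta> x s - \<theta> x t)\<^sup>2)" for s
        by (rule Mx_integral(1)) measurable
      have c: "\<forall>t\<ge>0. ((\<lambda>s. LINT x:cell|lborel. (\<theta> x s - \<theta> x t)\<^sup>2) \<longlongrightarrow> 0) (at t within {0..})"
        using ws by (elim conjE)
      show ?thesis using c[rule_format, OF that] unfolding eq .
    qed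
    show "integrable (Mx \<Otimes>\<^sub>M ivl T) (\<lambda>z. norm (g (fst z) (snd z)) powr p)" if "0 \<le> T" for T
      using g(2) that by (subst Mt_integral(2)[symmetric]) auto
    show "(LINT z|(Mx \<Otimes>\<^sub>M ivl T). \<theta> (fst z) (snd z) *\<^sub>R fst (D z))
        = - (LINT z|(Mx \<Otimes>\<^sub>M ivl T). \<psi> (fst z) (snd z) *\<^sub>R g (fst z) (snd z))"
      if t: "test_function \<psi> D" and T: "0 \<le> T" for \<psi> D T
    proof -
      note [measurable] = tf[OF t]
      have "(LINT z:(cell \<times> {0..T})|lborel. \<theta> (fst z) (snd z) *\<^sub>R fst (D z)) = (LINT z|(Mx \<Otimes>\<^sub>M ivl T). \<theta> (fst z) (snd z) *\<^sub>R fst (D z))"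
        "(LINT z:(cell \<times> {0..T})|lborel. \<psi> (fst z) (snd z) *\<^sub>R g (fst z) (snd z)) = (LINT z|(Mx \<Otimes>\<^sub>M ivl T). \<psi> (fst z) (snd z) *\<^sub>R g (fst z) (snd z))"
        by (rule Mt_integral(1); measurable)+
      then show ?thesis using g(3) t T by simp
    qed
    show "(LINT x|Mx. \<theta> x t * \<psi> x t) - (LINT x|Mx. \<theta>0 x * \<psi> x 0)
        = (LINT z|(Mx \<Otimes>\<^sub>M ivl t). \<theta> (fst z) (snd z) * snd (D z)
             - inner (A *\<^sub>R cflow m (fst z)) (g (fst z) (snd z)) * \<psi> (fst z) (snd z)
             - \<nu> * norm (g (fst z) (snd z)) powr (p - 2) * inner (g (fst z) (snd z)) (fst (D z)))"
      if tst: "test_function \<psi> D" and t: "0 \<le> t" for \<psi> D t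
    proof -
      note [measurable] = tf[OF tst] comp[OF tf(1)[OF tst]]
      have e1: "(LINT x:cell|lborel. \<theta> x t * \<psi> x t) = (LINT x|Mx. \<theta> x t * \<psi> x t)"
        "(LINT x:cell|lborel. \<theta>0 x * \<psi> x 0) = (LINT x|Mx. \<theta>0 x * \<psi> x 0)"
        by (rule Mx_integral(1); measurable)+
      have e2: "(LINT z:(cell \<times> {0..t})|lborel. \<theta> (fst z) (snd z) * snd (D z)
             - inner (A *\<^sub>R cflow m (fst z)) (g (fst z) (snd z)) * \<psi> (fst z) (snd z)
             - \<nu> * norm (g (fst z) (snd z)) powr (p - 2) * inner (g (fst z) (snd z)) (fst (D z)))
         = (LINT z|(Mx \<Otimes>\<^sub>M ivl t). \<theta> (fst z) (snd z) * snd (D z)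
             - inner (A *\<^sub>R cflow m (fst z)) (g (fst z) (snd z)) * \<psi> (fst z) (snd z)
             - \<nu> * norm (g (fst z) (snd z)) powr (p - 2) * inner (g (fst z) (snd z)) (fst (D z)))"
        by (rule Mt_integral(1)) measurable
      show ?thesis using g(4)[rule_format, OF conjI[OF tst t]] unfolding e1 e2[unfolded cflow_def] cflow_def .
    qed
  qed (use p nu in auto)
  then show thesis by (rule that)
qed

theorem theorem4p7:
  fixes p \<nu> \<tau> :: real
  assumes "p > 2" and "\<nu> > 0" and "\<tau> > 0"
  shows "\<exists>m::nat. \<exists>A::real. m > 0 \<and>
           (\<forall>\<theta>0 \<theta>.
              \<theta>0 \<in> borel_measurable lborel \<and> periodic_x \<theta>0 \<and>
              set_integrable lborel cell (\<lambda>x. (\<theta>0 x)^2) \<and>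
              (LINT x:cell|lborel. \<theta>0 x) = 0 \<and>
              L2norm_cell \<theta>0 = 1 \<and>
              weak_solution p \<nu> (\<lambda>x. A *\<^sub>R cell_flow (real m *\<^sub>R x)) \<theta>0 \<theta>
              \<longrightarrow> L2norm_cell (\<lambda>x. \<theta> x \<tau>) \<le> 1/2)"
proof -
  \<comment> \<open>By the energy identity 2 \<nu> times the integrated dissipation is at most the
    initial energy 1.\<close>
  define P where "P = 1 / (2 * \<nu>)"
  define B where "B = \<tau> + P"
  have B: "B > 0" unfolding B_def P_def using assms by (simp add: add_pos_pos)
  \<comment> \<open>Makes 4 h B = 2 B/m smaller than \<tau>/16, one of four equal shares of the
    \<tau>/4 in \<open>decay\<close>.\<close>
  obtain m :: nat where m: "32 * B / \<tau> < real m" using reals_Archimedean2 by blast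
  have m0: "real m > 0" using m B assms by (smt (verit) divide_pos_pos mult_pos_pos)
  have hB: "4 * (1 / (2 * real m)) * B < \<tau> / 16"
    using m m0 assms by (simp add: field_simps)
  define a where "a = 1 - 2 / p"
  have a: "a > 0" unfolding a_def using assms by simp
  define W where "W n = (1 / (real n + 1)) powr a" for n :: nat
  define L where "L n = ln (real n + 1)" for n :: nat
  define c1 where "c1 = 4 * (64 * real m)\<^sup>2 * 4096 * B"
  define Z where "Z = (4::real) ^ (4 * m + 2)"
  have r0: "(\<lambda>n. 1 / (real n + 1)) \<longlonglongrightarrow> 0"
    using LIMSEQ_inverse_real_of_nat by (simp add: inverse_eq_divide add.commute)
  have Weq: "W n = 1 / real (Suc n) powr a" for n unfolding W_def by (simp add: powr_divide add.commute)
  \<comment> \<open>The logarithmic travel time times the commutator size: a positive power of the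
    kernel radius beats the logarithm. Positivity of the exponent a is the condition p > 2.\<close>
  have LW: "(\<lambda>n. L n * W n) \<longlonglongrightarrow> 0"
    using LIMSEQ_Suc[OF lim_ln_over_power[OF a]] unfolding Weq L_def by (simp add: add.commute)
  have W0: "W \<longlonglongrightarrow> 0"
  proof -
    have "(\<lambda>n. real (Suc n) powr (- a)) \<longlonglongrightarrow> 0"
      by (rule tendsto_neg_powr) (use a filterlim_compose[OF filterlim_real_sequentially filterlim_Suc] in auto)
    then show ?thesis unfolding Weq by (simp add: powr_minus_divide)
  qed
  have t1: "(\<lambda>n. 8 * (1 / (real n + 1)) * B) \<longlonglongrightarrow> 8 * 0 * B" by (intro tendsto_intros r0)
  have t2: "(\<lambda>n. 2 * (1 / (real n + 1))) \<longlonglongrightarrow> 2 * 0" by (intro tendsto_intros r0)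
  have t3: "(\<lambda>n. 4 * (L n * W n)) \<longlonglongrightarrow> 4 * 0" by (intro tendsto_intros LW)
  have t4: "(\<lambda>n. Z * (32768 * (W n)\<^sup>2 * B + 8 * c1 * (L n * W n))) \<longlonglongrightarrow> Z * (32768 * 0\<^sup>2 * B + 8 * c1 * 0)"
    by (intro tendsto_intros W0 LW)
  \<comment> \<open>The two conditions with \<tau>/16 are the shares of the mollification error and
    of the part of \<epsilon> free of 1/A. The other two are the hypotheses of the edge
    estimate.\<close>
  have "\<forall>\<^sub>F n in sequentially. 8 * (1 / (real n + 1)) * B < \<tau> / 16 \<and> 2 * (1 / (real n + 1)) < 1 / (2 * real m)
      \<and> 4 * (L n * W n) < 1/2 \<and> Z * (32768 * (W n)\<^sup>2 * B + 8 * c1 * (L n * W n)) < \<tau> / 16"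
    by (intro eventually_conj order_tendstoD(2)[OF t1] order_tendstoD(2)[OF t2] order_tendstoD(2)[OF t3] order_tendstoD(2)[OF t4])
      (use assms m0 in auto)
  from eventually_happens'[OF sequentially_bot this] obtain n where n: "8 * (1 / (real n + 1)) * B < \<tau> / 16" "2 * (1 / (real n + 1)) < 1 / (2 * real m)"
    "4 * (L n * W n) < 1/2" "Z * (32768 * (W n)\<^sup>2 * B + 8 * c1 * (L n * W n)) < \<tau> / 16"
    by blast
  define cn where "cn = 32 * (ker2_bd n)\<^sup>2 + 16 * ker2_bd n * \<nu> * ker2_grad_bd n * B"
  \<comment> \<open>Chosen last, when cn is a fixed number: the part of the bound with 1/A stays
    below \<tau>/32. The + 1 keeps A positive even when L n = 0.\<close>
  define A where "A = 32 * (Z * (8 * L n * cn) + 1) / \<tau>"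
  have cn0: "cn \<ge> 0" unfolding cn_def using B ker2_bd_pos[of n] ker2_grad_bd_pos[of n] assms by auto
  have qp: "Z * (8 * L n * cn) \<ge> 0" unfolding Z_def L_def using cn0 by (intro mult_nonneg_nonneg) auto
  have A0: "A > 0" unfolding A_def using qp assms by (intro divide_pos_pos mult_pos_pos add_nonneg_pos) auto
  have An: "Z * (8 * L n * (cn / A)) < \<tau> / 16"
  proof -
    have "32 * (Z * (8 * L n * cn)) < A * \<tau>" unfolding A_def using assms by simp
    then have "Z * (8 * L n * cn) < A * (\<tau> / 16)" using qp unfolding times_divide_eq_right by linarith
    then have "Z * (8 * L n * cn) / A < \<tau> / 16" using A0 by (simp add: divide_less_eq mult.commute)
    then show ?thesis by simp
  qed
  show ?thesis
  proof (intro exI[of _ m] exI[of _ A] conjI allI impI)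
    show "m > 0" using m0 by simp
    fix \<theta>0 \<theta>
    assume H: "\<theta>0 \<in> borel_measurable lborel \<and> periodic_x \<theta>0 \<and> set_integrable lborel cell (\<lambda>x. (\<theta>0 x)^2) \<and>
      (LINT x:cell|lborel. \<theta>0 x) = 0 \<and> L2norm_cell \<theta>0 = 1 \<and>
      weak_solution p \<nu> (\<lambda>x. A *\<^sub>R cell_flow (real m *\<^sub>R x)) \<theta>0 \<theta>"
    then obtain g where cs: "cellular_solution p \<nu> A m \<theta>0 \<theta> g"
      using weak_solution_cellular[of p \<nu> \<theta>0 A m \<theta>] assms by blast
    interpret cellular_solution p \<nu> A m \<theta>0 \<theta> g by (rule cs)
    have init: "(LINT x|Mx. (\<theta>0 x)\<^sup>2) = 1"
    proof -
      have "sqrt (LINT x|Mx. (\<theta>0 x)\<^sup>2) = 1"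
        using H Mx_integral(1)[of "\<lambda>x. (\<theta>0 x)\<^sup>2"] unfolding L2norm_cell_def by simp
      then show ?thesis by simp
    qed
    have mean: "(LINT x|Mx. \<theta>0 x) = 0" using H Mx_integral(1)[of \<theta>0] by simp
    have "E \<tau> \<le> 1/4"
    proof (rule ccontr)
      assume "\<not> E \<tau> \<le> 1/4"
      then have Et: "E \<tau> > 1/4" by simp
      have "2 * \<nu> * (LINT s|ivl \<tau>. N s) \<le> 1" using energy_identity[of \<tau>] init Et assms by simp
      then have PN: "(LINT s|ivl \<tau>. N s) \<le> P" unfolding P_def using assms by (simp add: field_simps)
      interpret cd: cellular_decay p \<nu> A m \<theta>0 \<theta> g \<tau> P n
        by unfold_locales (use assms A0 m0 init mean PN in auto)
      have eqs: "cd.\<rho> = 1 / (real n + 1)" "cd.h = 1 / (2 * real m)" "cd.w = W n" "cd.l = L n" "cd.B = B" "cd.C1 = c1" "cd.Cn = cn"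
        unfolding cd.\<rho>_def cd.h_def cd.w_def cd.l_def cd.B_def cd.C1_def cd.Cn_def W_def L_def B_def c1_def cn_def a_def by auto
      have "\<tau> / 4 \<le> (8 * cd.\<rho> + 4 * cd.h) * cd.B + 4 ^ (4 * m + 2) * cd.\<epsilon>"
        by (rule cd.decay) (use n Et in \<open>auto simp: eqs\<close>)
      also have "\<dots> = 8 * (1 / (real n + 1)) * B + 4 * (1 / (2 * real m)) * B
          + Z * (32768 * (W n)\<^sup>2 * B + 8 * c1 * (L n * W n)) + Z * (8 * L n * (cn / A))"
        unfolding cd.\<epsilon>_def eqs Z_def by (simp add: algebra_simps)
      also have "\<dots> < \<tau> / 16 + \<tau> / 16 + \<tau> / 16 + \<tau> / 16"
        using n hB An by linarith
      finally show False by simp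
    qed
    then have "sqrt (E \<tau>) \<le> sqrt ((1/2)\<^sup>2)" by (intro real_sqrt_le_mono) (simp add: power2_eq_square)
    moreover have "L2norm_cell (\<lambda>x. \<theta> x \<tau>) = sqrt (E \<tau>)"
      unfolding L2norm_cell_def E_def using Mx_integral(1)[of "\<lambda>x. (\<theta> x \<tau>)\<^sup>2"] by simp
    ultimately show "L2norm_cell (\<lambda>x. \<theta> x \<tau>) \<le> 1/2" by simp
  qed
qed

end
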